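(* Let $m,n\in\mathbb N$, let $X=\{x_1,\dots,x_m\}$ be a set of $m$ distinct points of $\mathbb R^3$, $r_j=|x-x_j|$, and let $H$ be the minimal Schrödinger operator in $L^2(\mathbb R^3,\mathbb C^n)$, $$H=-\Delta\otimes I_n,\qquad \operatorname{dom}(H)=\{f\in W_2^2(\mathbb R^3,\mathbb C^n): f(x_j)=0,\ j\in\{1,\dots,m\}\}.$$ Then: (i) The domain of $H^*$ is $$\operatorname{dom}(H^* )=\Bigl\{f=\sum_{j=1}^m\Bigl(\xi_{0j}\frac{e^{-r_j}}{r_j}+\xi_{1j}e^{-r_j}\Bigr)+f_H:\ \xi_{0j},\xi_{1j}\in\mathbb C^n,\ f_H\in\operatorname{dom}(H)\Bigr\}.$$ (ii) A boundary triplet $\Pi=\{\mathcal H,\Gamma_0,\Gamma_1\}$ for $H^*$ is defined by $\mathcal H=\oplus_{j=1}^m\mathbb C^n$ and, for $f\in\operatorname{dom}(H^* )$ written as in (i), $$\Gamma_0f=\{\Gamma_{0j}f\}_{j=1}^m=4\pi\Bigl\{\lim_{x\to x_j}f(x)|x-x_j|\Bigr\}_{j=1}^m=4\pi\{\xi_{0j}\}_{j=1}^m,$$ $$\Gamma_1f=\{\Gamma_{1j}f\}_{j=1}^m=\Bigl\{\lim_{x\to x_j}\Bigl(f(x)-\frac{\xi_{0j}}{|x-x_j|}\Bigr)\Bigr\}_{j=1}^m .$$ (iii) The operator $H_0=H^*\upharpoonright\ker(\Gamma_0)$ is self-adjoint with $\operatorname{dom}(H_0)=W_2^2(\mathbb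 R^3,\mathbb C^n)$.
   Context: A triplet $\{\mathcal H,\Gamma_0,\Gamma_1\}$ is a boundary triplet for the adjoint $A^*$ of a closed densely defined symmetric operator $A$ with equal deficiency indices if $\mathcal H$ is a Hilbert space and $\Gamma_0,\Gamma_1:\operatorname{dom}(A^* )\to\mathcal H$ are linear maps such that (a) $(A^*f,g)-(f,A^*g)=(\Gamma_1f,\Gamma_0g)_{\mathcal H}-(\Gamma_0f,\Gamma_1g)_{\mathcal H}$ for all $f,g\in\operatorname{dom}(A^* )$, and (b) $(\Gamma_0,\Gamma_1)^\top:\operatorname{dom}(A^* )\to\mathcal H\oplus\mathcal H$ is surjective. The operator $H$ is closed, densely defined, nonnegative and symmetric, with deficiency indices $n_\pm(H)=mn$; point values make sense by the Sobolev embedding theorem. *)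

theory Defs
  imports "HOL-Analysis.Analysis"
begin

section \<open>Complex Hilbert spaces\<close>

text \<open>The complex inner product is linear in the first and conjugate-linear in the second argument.\<close>

class complex_inner = real_inner +
  fixes scaleC :: "complex \<Rightarrow> 'a \<Rightarrow> 'a"  (infixr \<open>*\<^sub>C\<close> 75)
    and cinner :: "'a \<Rightarrow> 'a \<Rightarrow> complex"
  assumes scaleC_add_right: "c *\<^sub>C (x + y) = c *\<^sub>C x + c *\<^sub>C y"
    and scaleC_add_left: "(c + d) *\<^sub>C x = c *\<^sub>C x + d *\<^sub>C x"
    and scaleC_scaleC: "c *\<^sub>C d *\<^sub>C x = (c * d) *\<^sub>C x"
    and scaleC_of_real: "complex_of_real r *\<^sub>C x = r *\<^sub>R x"
    and cinner_add_left: "cinner (x + y) z = cinner x z + cinner y z"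
    and cinner_scaleC_left: "cinner (c *\<^sub>C x) y = c * cinner x y"
    and cinner_commute: "cinner x y = cnj (cinner y x)"
    and inner_eq_Re_cinner: "inner x y = Re (cinner x y)"

class complex_hilbert = complex_inner + complete_space

instantiation complex :: complex_hilbert
begin

definition "c *\<^sub>C (z :: complex) = c * z"
definition "cinner (z :: complex) w = z * cnj w"

instance
  by standard (auto simp: scaleC_complex_def cinner_complex_def algebra_simps
      scaleR_conv_of_real inner_complex_def)

end

instantiation vec :: (complex_inner, finite) complex_inner
begin

definition "c *\<^sub>C x = (\<chi> i. c *\<^sub>C (x $ i))"
definition "cinner x y = (\<Sum>i\<in>UNIV. cinner (x $ i) (y $ i))"

instance
proof
  fix c d :: complex and r :: real and x y z :: "'a ^ 'b"
  show "cinner x y = cnj (cinner y x)"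
    by (simp add: cinner_vec_def, rule sum.cong, simp, rule cinner_commute)
qed (simp_all add: scaleC_vec_def cinner_vec_def vec_eq_iff inner_vec_def scaleC_add_right
      scaleC_add_left scaleC_scaleC scaleC_of_real cinner_add_left cinner_scaleC_left
      inner_eq_Re_cinner sum.distrib sum_distrib_left)

end

instance vec :: (complex_hilbert, finite) complex_hilbert ..


section \<open>Unbounded operators and boundary triplets\<close>

text \<open>An operator is identified with its graph, so \<^term>\<open>Domain A\<close> is its domain and an
  extension is a superset.\<close>

type_synonym 'a operator = "('a \<times> 'a) set"

definition linear_operator :: "'a::complex_inner operator \<Rightarrow> bool" where
  "linear_operator A \<longleftrightarrow> single_valued A \<and> (0, 0) \<in> A \<and>
     (\<forall>(f, f') \<in> A. \<forall>(g, g') \<in> A. (f + g, f' + g') \<in> A) \<and>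
     (\<forall>c. \<forall>(f, f') \<in> A. (c *\<^sub>C f, c *\<^sub>C f') \<in> A)"

definition densely_defined :: "'a::complex_inner operator \<Rightarrow> bool" where
  "densely_defined A \<longleftrightarrow> closure (Domain A) = UNIV"

definition symmetric_operator :: "'a::complex_inner operator \<Rightarrow> bool" where
  "symmetric_operator A \<longleftrightarrow> (\<forall>(f, f') \<in> A. \<forall>(g, g') \<in> A. cinner f' g = cinner f g')"

definition adjoint_operator :: "'a::complex_inner operator \<Rightarrow> 'a operator" where
  "adjoint_operator A = {(g, g'). \<forall>(f, f') \<in> A. cinner f' g = cinner f g'}"

definition self_adjoint :: "'a::complex_inner operator \<Rightarrow> bool" where
  "self_adjoint A \<longleftrightarrow> linear_operator A \<and> densely_defined A \<and> adjoint_operator A = A"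

definition defect_subspace :: "'a::complex_inner operator \<Rightarrow> complex \<Rightarrow> 'a set" where
  "defect_subspace A z = {f. (f, z *\<^sub>C f) \<in> adjoint_operator A}"

text \<open>For a closed subspace of a Hilbert space an orthonormal subset is an orthonormal
  (Hilbert) basis iff only the zero vector of the subspace is orthogonal to it.\<close>

definition orthonormal_basis_of :: "'a::complex_inner set \<Rightarrow> 'a set \<Rightarrow> bool" where
  "orthonormal_basis_of S B \<longleftrightarrow> B \<subseteq> S \<and>
     (\<forall>b\<in>B. \<forall>c\<in>B. cinner b c = (if b = c then 1 else 0)) \<and>
     (\<forall>f\<in>S. (\<forall>b\<in>B. cinner f b = 0) \<longrightarrow> f = 0)"

text \<open>The Hilbert space dimensions of the kernels of the operators \<open>A\<^sup>* - \<i>\<close> and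
  \<open>A\<^sup>* + \<i>\<close> coincide.\<close>

definition equal_deficiency_indices :: "'a::complex_inner operator \<Rightarrow> bool" where
  "equal_deficiency_indices A \<longleftrightarrow>
     (\<exists>B C. orthonormal_basis_of (defect_subspace A \<i>) B \<and>
            orthonormal_basis_of (defect_subspace A (- \<i>)) C \<and> B \<approx> C)"

definition clinear_map_on ::
    "'a::complex_inner set \<Rightarrow> ('a \<Rightarrow> 'h::complex_inner) \<Rightarrow> bool" where
  "clinear_map_on D \<Gamma> \<longleftrightarrow> (\<forall>f\<in>D. \<forall>g\<in>D. \<Gamma> (f + g) = \<Gamma> f + \<Gamma> g) \<and>
     (\<forall>c. \<forall>f\<in>D. \<Gamma> (c *\<^sub>C f) = c *\<^sub>C \<Gamma> f)"

text \<open>The boundary space is the type \<open>'h\<close>. Only the values of the boundary maps on the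
  domain of the adjoint matter.\<close>

definition boundary_triplet ::
    "'a::complex_hilbert operator \<Rightarrow> ('a \<Rightarrow> 'h::complex_hilbert) \<Rightarrow> ('a \<Rightarrow> 'h) \<Rightarrow> bool" where
  "boundary_triplet A \<Gamma>\<^sub>0 \<Gamma>\<^sub>1 \<longleftrightarrow>
     linear_operator A \<and> closed A \<and> densely_defined A \<and> symmetric_operator A \<and>
     equal_deficiency_indices A \<and>
     clinear_map_on (Domain (adjoint_operator A)) \<Gamma>\<^sub>0 \<and>
     clinear_map_on (Domain (adjoint_operator A)) \<Gamma>\<^sub>1 \<and>
     (\<forall>(f, f') \<in> adjoint_operator A. \<forall>(g, g') \<in> adjoint_operator A.
        cinner f' g - cinner f g' = cinner (\<Gamma>\<^sub>1 f) (\<Gamma>\<^sub>0 g) - cinner (\<Gamma>\<^sub>0 f) (\<Gamma>\<^sub>1 g)) \<and>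
     (\<lambda>f. (\<Gamma>\<^sub>0 f, \<Gamma>\<^sub>1 f)) ` Domain (adjoint_operator A) = UNIV"


section \<open>The Hilbert space $L^2(\mathbb{R}^3,\mathbb{C}^n)$\<close>

definition square_integrable :: "(real^3 \<Rightarrow> complex^'n) \<Rightarrow> bool" where
  "square_integrable f \<longleftrightarrow> f \<in> borel_measurable lborel \<and> integrable lborel (\<lambda>x. (norm (f x))\<^sup>2)"

definition L2_rel :: "(real^3 \<Rightarrow> complex^'n) \<Rightarrow> (real^3 \<Rightarrow> complex^'n) \<Rightarrow> bool" where
  "L2_rel f g \<longleftrightarrow> square_integrable f \<and> square_integrable g \<and> (AE x in lborel. f x = g x)"

lemma square_integrable_zero: "square_integrable (\<lambda>x. 0)"
  by (simp add: square_integrable_def)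

lemma square_integrable_add:
  assumes "square_integrable f" "square_integrable g"
  shows "square_integrable (\<lambda>x. f x + g x)"
  unfolding square_integrable_def
proof
  show m: "(\<lambda>x. f x + g x) \<in> borel_measurable lborel"
    using assms by (auto simp: square_integrable_def)
  have b: "(norm (f x + g x))\<^sup>2 \<le> 2 * (norm (f x))\<^sup>2 + 2 * (norm (g x))\<^sup>2" for x
  proof -
    have "(norm (f x + g x))\<^sup>2 \<le> (norm (f x) + norm (g x))\<^sup>2"
      by (intro power_mono norm_triangle_ineq) auto
    also have "\<dots> \<le> 2 * (norm (f x))\<^sup>2 + 2 * (norm (g x))\<^sup>2"
      using sum_squares_bound[of "norm (f x)" "norm (g x)"] by (simp add: power2_sum)
    finally show ?thesis .
  qed
  show "integrable lborel (\<lambda>x. (norm (f x + g x))\<^sup>2)"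
    by (rule Bochner_Integration.integrable_bound[where f="\<lambda>x. 2 * (norm (f x))\<^sup>2 + 2 * (norm (g x))\<^sup>2"])
       (use assms m b in \<open>auto simp: square_integrable_def\<close>)
qed

lemma norm_scaleC_vec: "norm (c *\<^sub>C (x :: complex^'n)) = cmod c * norm x"
  by (simp add: norm_vec_def scaleC_vec_def scaleC_complex_def L2_set_def norm_mult
      power_mult_distrib real_sqrt_mult flip: sum_distrib_left)

lemma borel_measurable_vec_component:
  "f \<in> borel_measurable borel \<Longrightarrow> (\<lambda>x. f x $ i) \<in> borel_measurable borel"
  for f :: "real^3 \<Rightarrow> complex^'n"
  by (rule borel_measurable_continuous_on[where f="\<lambda>v. v $ i"]) (auto intro: continuous_intros)

lemma borel_measurable_scaleC_vec:
  fixes f :: "real^3 \<Rightarrow> complex^'n"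
  assumes "f \<in> borel_measurable borel"
  shows "(\<lambda>x. c *\<^sub>C f x) \<in> borel_measurable borel"
proof (rule borel_measurable_continuous_on[where f="\<lambda>v. c *\<^sub>C v", OF _ assms])
  show "continuous_on UNIV (\<lambda>v::complex^'n. c *\<^sub>C v)"
    unfolding scaleC_vec_def scaleC_complex_def by (intro continuous_intros)
qed

lemma square_integrable_scaleC:
  "square_integrable f \<Longrightarrow> square_integrable (\<lambda>x. c *\<^sub>C f x)"
  by (auto simp: square_integrable_def norm_scaleC_vec power_mult_distrib
      intro: borel_measurable_scaleC_vec)

lemma square_integrable_scaleR:
  "square_integrable f \<Longrightarrow> square_integrable (\<lambda>x. c *\<^sub>R f x)"
  by (auto simp: square_integrable_def power_mult_distrib)

lemma square_integrable_uminus: "square_integrable f \<Longrightarrow> square_integrable (\<lambda>x. - f x)"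
  by (auto simp: square_integrable_def)

lemma square_integrable_diff:
  "square_integrable f \<Longrightarrow> square_integrable g \<Longrightarrow> square_integrable (\<lambda>x. f x - g x)"
  using square_integrable_add[of f "\<lambda>x. - g x"] square_integrable_uminus[of g] by simp

lemma integrable_cinner:
  assumes "square_integrable f" "square_integrable g"
  shows "integrable lborel (\<lambda>x. cinner (f x) (g x))"
proof -
  have "integrable lborel (\<lambda>x. f x $ i * cnj (g x $ i))" for i
  proof (rule Bochner_Integration.integrable_bound[where f="\<lambda>x. (norm (f x))\<^sup>2 + (norm (g x))\<^sup>2"])
    have [measurable]: "(\<lambda>x. f x $ i) \<in> borel_measurable lborel" "(\<lambda>x. g x $ i) \<in> borel_measurable lborel"
      using assms by (auto simp: square_integrable_def intro: borel_measurable_vec_component)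
    have [measurable]: "cnj \<in> borel_measurable borel"
      by (rule borel_measurable_continuous_onI) (intro continuous_intros)
    show "(\<lambda>x. f x $ i * cnj (g x $ i)) \<in> borel_measurable lborel"
      by measurable
    show "integrable lborel (\<lambda>x. (norm (f x))\<^sup>2 + (norm (g x))\<^sup>2)"
      using assms by (auto simp: square_integrable_def)
    show "AE x in lborel. norm (f x $ i * cnj (g x $ i)) \<le> norm ((norm (f x))\<^sup>2 + (norm (g x))\<^sup>2)"
    proof (rule AE_I2)
      fix x
      have "norm (f x $ i * cnj (g x $ i)) \<le> norm (f x) * norm (g x)"
        by (auto simp: norm_mult intro!: mult_mono Finite_Cartesian_Product.norm_nth_le)
      also have "\<dots> \<le> (norm (f x))\<^sup>2 + (norm (g x))\<^sup>2"
      proof -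
        have "0 \<le> norm (f x) * norm (g x)" by simp
        then show ?thesis
          using sum_squares_bound[of "norm (f x)" "norm (g x)"] by linarith
      qed
      finally show "norm (f x $ i * cnj (g x $ i)) \<le> norm ((norm (f x))\<^sup>2 + (norm (g x))\<^sup>2)"
        by simp
    qed
  qed
  then show ?thesis
    by (simp add: cinner_vec_def cinner_complex_def)
qed

quotient_type 'n L2 = "real^3 \<Rightarrow> complex^'n" / partial: L2_rel
proof (rule part_equivpI)
  show "\<exists>x. L2_rel x x"
    using square_integrable_zero by (auto simp: L2_rel_def)
  show "symp L2_rel"
    by (auto simp: symp_def L2_rel_def)
  show "transp L2_rel"
    by (auto simp: transp_def L2_rel_def)
qed

lemma L2_rel_rep: "L2_rel (rep_L2 f) (rep_L2 f)"
  using Quotient3_L2 by (rule Quotient3_rep_reflp)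

lemma square_integrable_rep: "square_integrable (rep_L2 f)"
  using L2_rel_rep[of f] by (simp add: L2_rel_def)

lemma abs_L2_eq_iff:
  "square_integrable f \<Longrightarrow> square_integrable g \<Longrightarrow> abs_L2 f = abs_L2 g \<longleftrightarrow> (AE x in lborel. f x = g x)"
  using Quotient3_rel[OF Quotient3_L2, of f g] by (simp add: L2_rel_def)

lemma AE_rep_abs_L2: "square_integrable f \<Longrightarrow> AE x in lborel. rep_L2 (abs_L2 f) x = f x"
  using Quotient3_rel_rep[OF Quotient3_L2] abs_L2_eq_iff[OF square_integrable_rep, of f]
    Quotient3_abs_rep[OF Quotient3_L2] by blast

instantiation L2 :: (finite) complex_inner
begin

lift_definition zero_L2 :: "'a L2" is "\<lambda>x. 0"
  by (simp add: L2_rel_def square_integrable_zero)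

lift_definition plus_L2 :: "'a L2 \<Rightarrow> 'a L2 \<Rightarrow> 'a L2" is "\<lambda>f g x. f x + g x"
  by (auto simp: L2_rel_def square_integrable_add)

lift_definition minus_L2 :: "'a L2 \<Rightarrow> 'a L2 \<Rightarrow> 'a L2" is "\<lambda>f g x. f x - g x"
  by (auto simp: L2_rel_def square_integrable_diff)

lift_definition uminus_L2 :: "'a L2 \<Rightarrow> 'a L2" is "\<lambda>f x. - f x"
  by (auto simp: L2_rel_def square_integrable_uminus)

lift_definition scaleR_L2 :: "real \<Rightarrow> 'a L2 \<Rightarrow> 'a L2" is "\<lambda>c f x. c *\<^sub>R f x"
  by (auto simp: L2_rel_def square_integrable_scaleR)

lift_definition scaleC_L2 :: "complex \<Rightarrow> 'a L2 \<Rightarrow> 'a L2" is "\<lambda>c f x. c *\<^sub>C f x"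
  by (auto simp: L2_rel_def square_integrable_scaleC)

lift_definition cinner_L2 :: "'a L2 \<Rightarrow> 'a L2 \<Rightarrow> complex"
  is "\<lambda>f g. \<integral>x. cinner (f x) (g x) \<partial>lborel"
proof -
  fix f f' g g' :: "real^3 \<Rightarrow> complex^'a"
  assume *: "L2_rel f f'" "L2_rel g g'"
  show "(\<integral>x. cinner (f x) (g x) \<partial>lborel) = (\<integral>x. cinner (f' x) (g' x) \<partial>lborel)"
  proof (rule integral_cong_AE)
    show "(\<lambda>x. cinner (f x) (g x)) \<in> borel_measurable lborel"
      "(\<lambda>x. cinner (f' x) (g' x)) \<in> borel_measurable lborel"
      using * unfolding L2_rel_def by (blast intro: borel_measurable_integrable integrable_cinner)+
    show "AE x in lborel. cinner (f x) (g x) = cinner (f' x) (g' x)"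
      using * by (auto simp: L2_rel_def)
  qed
qed

definition inner_L2 :: "'a L2 \<Rightarrow> 'a L2 \<Rightarrow> real" where "inner_L2 f g = Re (cinner f g)"
definition norm_L2 :: "'a L2 \<Rightarrow> real" where "norm_L2 f = sqrt (inner f f)"
definition dist_L2 :: "'a L2 \<Rightarrow> 'a L2 \<Rightarrow> real" where "dist_L2 f g = norm (f - g)"
definition sgn_L2 :: "'a L2 \<Rightarrow> 'a L2" where "sgn_L2 f = inverse (norm f) *\<^sub>R f"
definition uniformity_L2 :: "('a L2 \<times> 'a L2) filter" where
  "uniformity_L2 = (INF e\<in>{0 <..}. principal {(f, g). dist f g < e})"
definition open_L2 :: "'a L2 set \<Rightarrow> bool" where
  "open_L2 U \<longleftrightarrow> (\<forall>f\<in>U. eventually (\<lambda>(f', g). f' = f \<longrightarrow> g \<in> U) uniformity)"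

lemma Re_cinner_vec: "Re (cinner x y) = inner x y" for x y :: "complex^'n"
  by (rule inner_eq_Re_cinner[symmetric])

instance
proof
  fix a b c :: "'a L2" and r s :: real and z w :: complex and U :: "'a L2 set"
  show "a + b + c = a + (b + c)"
    by transfer (simp add: L2_rel_def square_integrable_add add.assoc)
  show "a + b = b + a"
    by transfer (simp add: L2_rel_def square_integrable_add add.commute)
  show "0 + a = a"
    by transfer (simp add: L2_rel_def)
  show "- a + a = 0"
    by transfer (simp add: L2_rel_def square_integrable_zero)
  show "a - b = a + - b"
    by transfer (simp add: L2_rel_def square_integrable_diff)
  show "r *\<^sub>R (a + b) = r *\<^sub>R a + r *\<^sub>R b"
    by transfer (simp add: L2_rel_def square_integrable_add square_integrable_scaleR scaleR_add_right)
  show "(r + s) *\<^sub>R a = r *\<^sub>R a + s *\<^sub>R a"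
    by transfer (simp add: L2_rel_def square_integrable_add square_integrable_scaleR scaleR_add_left)
  show "r *\<^sub>R s *\<^sub>R a = (r * s) *\<^sub>R a"
    by transfer (simp add: L2_rel_def square_integrable_scaleR)
  show "1 *\<^sub>R a = a"
    by transfer (simp add: L2_rel_def)
  show "dist a b = norm (a - b)" by (rule dist_L2_def)
  show "sgn a = inverse (norm a) *\<^sub>R a" by (rule sgn_L2_def)
  show "uniformity = (INF e\<in>{0 <..}. principal {(f, g). dist f (g :: 'a L2) < e})"
    by (rule uniformity_L2_def)
  show "open U \<longleftrightarrow> (\<forall>f\<in>U. eventually (\<lambda>(f', g). f' = f \<longrightarrow> g \<in> U) uniformity)"
    by (rule open_L2_def)
  show "z *\<^sub>C (a + b) = z *\<^sub>C a + z *\<^sub>C b"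
    by transfer (simp add: L2_rel_def square_integrable_add square_integrable_scaleC scaleC_add_right)
  show "(z + w) *\<^sub>C a = z *\<^sub>C a + w *\<^sub>C a"
    by transfer (simp add: L2_rel_def square_integrable_add square_integrable_scaleC scaleC_add_left)
  show "z *\<^sub>C w *\<^sub>C a = (z * w) *\<^sub>C a"
    by transfer (simp add: L2_rel_def square_integrable_scaleC scaleC_scaleC)
  show "complex_of_real r *\<^sub>C a = r *\<^sub>R a"
    by transfer (simp add: L2_rel_def square_integrable_scaleR scaleC_of_real)
  show cadd: "cinner (a + b) c = cinner a c + cinner b c" for a b c :: "'a L2"
    by transfer (simp add: L2_rel_def cinner_add_left integrable_cinner)
  show cscale: "cinner (z *\<^sub>C a) b = z * cinner a b" for z and a b :: "'a L2"
    by transfer (simp add: cinner_scaleC_left)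
  show ccomm: "cinner a b = cnj (cinner b a)" for a b :: "'a L2"
  proof transfer
    fix f g :: "real^3 \<Rightarrow> complex^'a"
    have "(\<integral>x. cinner (f x) (g x) \<partial>lborel) = (\<integral>x. cnj (cinner (g x) (f x)) \<partial>lborel)"
      by (rule Bochner_Integration.integral_cong) (auto intro: cinner_commute)
    then show "(\<integral>x. cinner (f x) (g x) \<partial>lborel) = cnj (\<integral>x. cinner (g x) (f x) \<partial>lborel)"
      by simp
  qed
  show "inner a b = Re (cinner a b)" by (rule inner_L2_def)
  show "inner a b = inner b a"
    by (metis inner_L2_def ccomm complex_cnj(1) complex.sel(1) complex_surj cnj.simps(1))
  show "inner (a + b) c = inner a c + inner b c"
    by (simp add: inner_L2_def cadd)
  show "inner (r *\<^sub>R a) b = r * inner a b"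
  proof -
    have "r *\<^sub>R a = complex_of_real r *\<^sub>C a"
      by transfer (simp add: L2_rel_def square_integrable_scaleR scaleC_of_real)
    then show ?thesis by (simp add: inner_L2_def cscale)
  qed
  have *: "L2_rel f f \<Longrightarrow> Re (\<integral>x. cinner (f x) (f x) \<partial>lborel) = (\<integral>x. (norm (f x))\<^sup>2 \<partial>lborel)"
    for f :: "real^3 \<Rightarrow> complex^'a"
    by (subst integral_Re[symmetric])
       (auto simp: L2_rel_def integrable_cinner Re_cinner_vec power2_norm_eq_inner)
  show "0 \<le> inner a a"
    unfolding inner_L2_def by transfer (simp add: *)
  show "inner a a = 0 \<longleftrightarrow> a = 0"
    unfolding inner_L2_def
  proof transfer
    fix f :: "real^3 \<Rightarrow> complex^'a"
    assume f: "L2_rel f f"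
    then have "integrable lborel (\<lambda>x. (norm (f x))\<^sup>2)"
      by (simp add: L2_rel_def square_integrable_def)
    then have "(\<integral>x. (norm (f x))\<^sup>2 \<partial>lborel) = 0 \<longleftrightarrow> (AE x in lborel. (norm (f x))\<^sup>2 = 0)"
      by (intro integral_nonneg_eq_0_iff_AE) auto
    with * f show "Re (\<integral>x. cinner (f x) (f x) \<partial>lborel) = 0 \<longleftrightarrow> L2_rel f (\<lambda>x. 0)"
      by (simp add: L2_rel_def square_integrable_zero)
  qed
  show "norm a = sqrt (inner a a)" by (rule norm_L2_def)
qed

end

lemma norm_L2_power2: "(norm f)\<^sup>2 = (\<integral>x. (norm (rep_L2 f x))\<^sup>2 \<partial>lborel)" for f :: "'n::finite L2"
proof -
  have "(norm f)\<^sup>2 = Re (cinner f f)"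
    by (simp add: power2_norm_eq_inner inner_eq_Re_cinner)
  also have "cinner f f = (\<integral>x. cinner (rep_L2 f x) (rep_L2 f x) \<partial>lborel)"
    by (simp add: cinner_L2_def)
  also have "Re \<dots> = (\<integral>x. (norm (rep_L2 f x))\<^sup>2 \<partial>lborel)"
    by (subst integral_Re[symmetric])
       (auto simp: integrable_cinner square_integrable_rep Re_cinner_vec power2_norm_eq_inner)
  finally show ?thesis .
qed

lemma norm_L2_diff_power2:
  "(norm (f - g))\<^sup>2 = (\<integral>x. (norm (rep_L2 f x - rep_L2 g x))\<^sup>2 \<partial>lborel)" for f g :: "'n::finite L2"
proof -
  have e: "f - g = abs_L2 (\<lambda>x. rep_L2 f x - rep_L2 g x)"
    by (simp add: minus_L2_def)
  have ae: "AE x in lborel. rep_L2 (f - g) x = rep_L2 f x - rep_L2 g x"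
    unfolding e by (rule AE_rep_abs_L2) (intro square_integrable_diff square_integrable_rep)
  have [measurable]: "rep_L2 h \<in> borel_measurable lborel" for h :: "'n L2"
    using square_integrable_rep[of h] unfolding square_integrable_def by blast
  show ?thesis
    unfolding norm_L2_power2
  proof (rule integral_cong_AE)
    show "AE x in lborel. (norm (rep_L2 (f - g) x))\<^sup>2 = (norm (rep_L2 f x - rep_L2 g x))\<^sup>2"
      using ae by eventually_elim simp
  qed measurable
qed

text \<open>The Riesz--Fischer theorem.\<close>

instance L2 :: (finite) complex_hilbert
proof
  fix X :: "nat \<Rightarrow> 'a L2"
  assume "Cauchy X"
  then have "\<exists>N. \<forall>m\<ge>N. \<forall>n\<ge>N. dist (X m) (X n) < (1/2) ^ k" for k :: nat
    by (auto dest: metric_CauchyD[where e="(1/2)^k"])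
  then obtain N where N: "\<And>k m n. m \<ge> N k \<Longrightarrow> n \<ge> N k \<Longrightarrow> dist (X m) (X n) < (1/2) ^ k"
    by metis
  define r where "r k = (\<Sum>i\<le>k. N i)" for k
  have rN: "N k \<le> r l" if "k \<le> l" for k l
    unfolding r_def using that by (intro member_le_sum) auto
  define F where "F k = rep_L2 (X (r k))" for k
  have F: "square_integrable (F k)" for k
    by (simp add: F_def square_integrable_rep)
  then have Fm [measurable]: "F k \<in> borel_measurable lborel" for k
    unfolding square_integrable_def by blast
  have nn: "(\<integral>\<^sup>+x. ennreal ((norm (F n x - F k x))\<^sup>2) \<partial>lborel) \<le> ennreal (((1/2)^k)\<^sup>2)"
    if "k \<le> n" for k n
  proof -
    have i: "integrable lborel (\<lambda>x. (norm (F n x - F k x))\<^sup>2)"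
      using square_integrable_diff[OF F F] by (simp add: square_integrable_def)
    have "norm (X (r n) - X (r k)) \<le> (1/2)^k"
      using N[OF rN[OF that] rN[OF order_refl]] by (simp add: dist_norm)
    then have "(\<integral>x. (norm (F n x - F k x))\<^sup>2 \<partial>lborel) \<le> ((1/2)^k)\<^sup>2"
      unfolding F_def norm_L2_diff_power2[symmetric] by (intro power_mono) auto
    then show ?thesis
      using nn_integral_eq_integral[OF i] by (simp add: ennreal_leI)
  qed
  have "(\<integral>\<^sup>+x. (\<Sum>k. ennreal (2^k * (norm (F (Suc k) x - F k x))\<^sup>2)) \<partial>lborel)
      = (\<Sum>k. \<integral>\<^sup>+x. ennreal (2^k * (norm (F (Suc k) x - F k x))\<^sup>2) \<partial>lborel)"
    by (rule nn_integral_suminf) measurable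
  also have "\<dots> \<le> (\<Sum>k. ennreal ((1/2)^k))"
  proof (rule suminf_le)
    fix k
    have "(\<integral>\<^sup>+x. ennreal (2^k * (norm (F (Suc k) x - F k x))\<^sup>2) \<partial>lborel)
        = ennreal (2^k) * (\<integral>\<^sup>+x. ennreal ((norm (F (Suc k) x - F k x))\<^sup>2) \<partial>lborel)"
      by (subst nn_integral_cmult[symmetric]) (auto simp: ennreal_mult)
    also have "\<dots> \<le> ennreal (2^k) * ennreal (((1/2)^k)\<^sup>2)"
      by (intro mult_left_mono nn) auto
    also have "\<dots> = ennreal ((1/2)^k)"
      by (simp add: ennreal_mult[symmetric] power2_eq_square power_divide)
    finally show "(\<integral>\<^sup>+x. ennreal (2^k * (norm (F (Suc k) x - F k x))\<^sup>2) \<partial>lborel) \<le> ennreal ((1/2)^k)" .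
  qed auto
  also have "\<dots> = ennreal (\<Sum>k. (1/2)^k)"
    by (rule suminf_ennreal2) (auto intro: summable_geometric)
  also have "\<dots> < \<infinity>"
    by simp
  finally have fin: "(\<integral>\<^sup>+x. (\<Sum>k. ennreal (2^k * (norm (F (Suc k) x - F k x))\<^sup>2)) \<partial>lborel) \<noteq> \<infinity>"
    by simp
  have "AE x in lborel. (\<Sum>k. ennreal (2^k * (norm (F (Suc k) x - F k x))\<^sup>2)) \<noteq> \<infinity>"
    by (rule nn_integral_PInf_AE[OF _ fin]) measurable
  then have conv: "AE x in lborel. convergent (\<lambda>k. F k x)"
  proof eventually_elim
    case (elim x)
    define d where "d k = F (Suc k) x - F k x" for k
    have s: "summable (\<lambda>k. 2^k * (norm (d k))\<^sup>2)"
      using elim unfolding d_def by (intro summable_suminf_not_top) auto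
    have b: "norm (d k) \<le> 2^k * (norm (d k))\<^sup>2 + (1/2)^k" for k
    proof (cases "norm (d k) \<le> (1/2)^k")
      case True
      have "0 \<le> 2^k * (norm (d k))\<^sup>2"
        by simp
      with True show ?thesis
        by linarith
    next
      case False
      have "norm (d k) = 2^k * ((1/2)^k * norm (d k))"
        by (simp add: power_divide)
      also have "\<dots> \<le> 2^k * (norm (d k) * norm (d k))"
        using False by (intro mult_left_mono mult_right_mono) auto
      finally show ?thesis
        by (simp add: power2_eq_square add_increasing2)
    qed
    have "summable d"
    proof (rule summable_comparison_test')
      show "summable (\<lambda>k. 2^k * (norm (d k))\<^sup>2 + (1/2)^k)"
        by (intro summable_add s summable_geometric) auto
    qed (rule b)
    then have "convergent (\<lambda>n. \<Sum>k<n. d k)"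
      by (simp add: summable_iff_convergent)
    then have "convergent (\<lambda>n. F n x - F 0 x)"
      by (simp add: d_def sum_lessThan_telescope[of "\<lambda>k. F k x"])
    then have "convergent (\<lambda>n. (F n x - F 0 x) + F 0 x)"
      by (intro convergent_add convergent_const)
    then show ?case
      by simp
  qed
  define g where "g x = lim (\<lambda>k. F k x)" for x
  have gm [measurable]: "g \<in> borel_measurable lborel"
    unfolding g_def by (rule borel_measurable_lim_metric) measurable
  have gn: "(\<integral>\<^sup>+x. ennreal ((norm (g x - F k x))\<^sup>2) \<partial>lborel) \<le> ennreal (((1/2)^k)\<^sup>2)" for k
  proof -
    have "(\<integral>\<^sup>+x. ennreal ((norm (g x - F k x))\<^sup>2) \<partial>lborel)
        = (\<integral>\<^sup>+x. liminf (\<lambda>n. ennreal ((norm (F n x - F k x))\<^sup>2)) \<partial>lborel)"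
    proof (rule nn_integral_cong_AE)
      show "AE x in lborel. ennreal ((norm (g x - F k x))\<^sup>2) = liminf (\<lambda>n. ennreal ((norm (F n x - F k x))\<^sup>2))"
        using conv
      proof eventually_elim
        case (elim x)
        then have "(\<lambda>n. F n x) \<longlonglongrightarrow> g x"
          by (simp add: g_def convergent_LIMSEQ_iff)
        then have "(\<lambda>n. ennreal ((norm (F n x - F k x))\<^sup>2)) \<longlonglongrightarrow> ennreal ((norm (g x - F k x))\<^sup>2)"
          by (intro tendsto_intros)
        then show ?case
          by (metis lim_imp_Liminf trivial_limit_sequentially)
      qed
    qed
    also have "\<dots> \<le> liminf (\<lambda>n. \<integral>\<^sup>+x. ennreal ((norm (F n x - F k x))\<^sup>2) \<partial>lborel)"
      by (rule nn_integral_liminf) measurable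
    also have "\<dots> \<le> limsup (\<lambda>n. \<integral>\<^sup>+x. ennreal ((norm (F n x - F k x))\<^sup>2) \<partial>lborel)"
      by (rule Liminf_le_Limsup) simp
    also have "\<dots> \<le> ennreal (((1/2)^k)\<^sup>2)"
      by (rule Limsup_bounded) (auto simp: eventually_sequentially intro!: exI[of _ k] nn)
    finally show ?thesis .
  qed
  have gF: "square_integrable (\<lambda>x. g x - F k x)" for k
    unfolding square_integrable_def
  proof
    show "integrable lborel (\<lambda>x. (norm (g x - F k x))\<^sup>2)"
      using gn[of k] by (intro integrableI_nonneg) (auto simp: less_top[symmetric] top_unique)
  qed measurable
  have g: "square_integrable g"
    using square_integrable_add[OF gF[of 0] F[of 0]] by simp
  have d: "dist (X (r k)) (abs_L2 g) \<le> (1/2)^k" for k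
  proof -
    have "(norm (abs_L2 g - X (r k)))\<^sup>2 = (\<integral>x. (norm (rep_L2 (abs_L2 g) x - F k x))\<^sup>2 \<partial>lborel)"
      by (simp add: norm_L2_diff_power2 F_def)
    also have "\<dots> = (\<integral>x. (norm (g x - F k x))\<^sup>2 \<partial>lborel)"
    proof (rule integral_cong_AE)
      have [measurable]: "rep_L2 (abs_L2 g) \<in> borel_measurable lborel"
        using square_integrable_rep[of "abs_L2 g"] unfolding square_integrable_def by blast
      show "(\<lambda>x. (norm (rep_L2 (abs_L2 g) x - F k x))\<^sup>2) \<in> borel_measurable lborel"
        by measurable
      show "(\<lambda>x. (norm (g x - F k x))\<^sup>2) \<in> borel_measurable lborel"
        by measurable
      show "AE x in lborel. (norm (rep_L2 (abs_L2 g) x - F k x))\<^sup>2 = (norm (g x - F k x))\<^sup>2"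
        using AE_rep_abs_L2[OF g] by eventually_elim simp
    qed
    also have "\<dots> \<le> ((1/2)^k)\<^sup>2"
    proof -
      have "integrable lborel (\<lambda>x. (norm (g x - F k x))\<^sup>2)"
        using gF[of k] by (simp add: square_integrable_def)
      then have "ennreal (\<integral>x. (norm (g x - F k x))\<^sup>2 \<partial>lborel) \<le> ennreal (((1/2)^k)\<^sup>2)"
        using gn[of k] by (subst (asm) nn_integral_eq_integral) auto
      then show ?thesis
        by (subst (asm) ennreal_le_iff) auto
    qed
    finally have "norm (abs_L2 g - X (r k)) \<le> (1/2)^k"
      by (rule power2_le_imp_le) simp
    then show ?thesis
      by (simp add: dist_norm norm_minus_commute)
  qed
  have "X \<longlonglongrightarrow> abs_L2 g"
  proof (rule metric_LIMSEQ_I)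
    fix e :: real
    assume "e > 0"
    then obtain k where k: "(1/2)^k < e / 2"
      using real_arch_pow_inv[of "e/2" "1/2"] by auto
    have "dist (X n) (abs_L2 g) < e" if "n \<ge> N k" for n
      using N[OF that rN[OF order_refl]] d[of k] dist_triangle[of "X n" "abs_L2 g" "X (r k)"] k
      by linarith
    then show "\<exists>no. \<forall>n\<ge>no. dist (X n) (abs_L2 g) < e"
      by blast
  qed
  then show "convergent X"
    by (rule convergentI)
qed


section \<open>Sobolev spaces and point values\<close>

definition partial_deriv :: "3 \<Rightarrow> (real^3 \<Rightarrow> real) \<Rightarrow> real^3 \<Rightarrow> real" where
  "partial_deriv i \<phi> x = frechet_derivative \<phi> (at x) (axis i 1)"

primrec continuously_differentiable :: "nat \<Rightarrow> (real^3 \<Rightarrow> real) \<Rightarrow> bool" where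
  "continuously_differentiable 0 \<phi> \<longleftrightarrow> continuous_on UNIV \<phi>"
| "continuously_differentiable (Suc k) \<phi> \<longleftrightarrow> (\<forall>x. \<phi> differentiable (at x)) \<and>
     (\<forall>i. continuously_differentiable k (partial_deriv i \<phi>))"

definition test_function :: "(real^3 \<Rightarrow> real) \<Rightarrow> bool" where
  "test_function \<phi> \<longleftrightarrow>
     (\<forall>k. continuously_differentiable k \<phi>) \<and> compact (closure {x. \<phi> x \<noteq> 0})"

definition weak_deriv :: "3 \<Rightarrow> 'n::finite L2 \<Rightarrow> 'n L2 \<Rightarrow> bool" where
  "weak_deriv i f g \<longleftrightarrow> (\<forall>\<phi>. test_function \<phi> \<longrightarrow>
     (\<integral>x. partial_deriv i \<phi> x *\<^sub>R rep_L2 f x \<partial>lborel) = - (\<integral>x. \<phi> x *\<^sub>R rep_L2 g x \<partial>lborel))"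

text \<open>Weak derivatives in $L^2$ are unique; the value is meaningful only if one exists.\<close>

definition weak_partial :: "3 \<Rightarrow> 'n::finite L2 \<Rightarrow> 'n L2" where
  "weak_partial i f = (THE g. weak_deriv i f g)"

definition laplacian :: "'n::finite L2 \<Rightarrow> 'n L2" where
  "laplacian f = (\<Sum>i\<in>UNIV. weak_partial i (weak_partial i f))"

text \<open>\<open>sobolev k\<close> is $W_2^k(\mathbb{R}^3,\mathbb{C}^n)$.\<close>

primrec sobolev :: "nat \<Rightarrow> 'n::finite L2 set" where
  "sobolev 0 = UNIV"
| "sobolev (Suc k) = {f. \<forall>i. \<exists>g \<in> sobolev k. weak_deriv i f g}"

text \<open>The value at \<open>x\<close> of an $L^2$ class which has a representative that is continuous on a
  neighbourhood of \<open>x\<close>. For elements of $W_2^2(\mathbb{R}^3)$ this is the value of the globally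
  continuous representative given by the Sobolev embedding theorem; the local form also
  applies to functions that are continuous only off a finite set.\<close>

definition has_point_value :: "'n::finite L2 \<Rightarrow> real^3 \<Rightarrow> complex^'n \<Rightarrow> bool" where
  "has_point_value f x c \<longleftrightarrow>
     (\<exists>U g. open U \<and> x \<in> U \<and> continuous_on U g \<and>
            (AE y in lborel. y \<in> U \<longrightarrow> rep_L2 f y = g y) \<and> g x = c)"

definition point_value :: "'n::finite L2 \<Rightarrow> real^3 \<Rightarrow> complex^'n" where
  "point_value f x = (THE c. has_point_value f x c)"


section \<open>Schroedinger operators with point interactions\<close>

text \<open>The points are a family \<open>X\<close> indexed by a finite type \<open>'m\<close>, with \<open>CARD('m)\<close> for \<open>m\<close>.
  Accordingly the boundary space, the direct sum of \<open>m\<close> copies of $\mathbb{C}^n$, is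
  \<^typ>\<open>complex^'n^'m\<close>.\<close>

definition minimal_schroedinger :: "('m::finite \<Rightarrow> real^3) \<Rightarrow> 'n::finite L2 operator" where
  "minimal_schroedinger X =
     {(f, - laplacian f) | f. f \<in> sobolev 2 \<and> (\<forall>j. has_point_value f (X j) 0)}"

definition singular_decomposition ::
    "('m::finite \<Rightarrow> real^3) \<Rightarrow> 'n::finite L2 \<Rightarrow> complex^'n^'m \<Rightarrow> complex^'n^'m \<Rightarrow> 'n L2 \<Rightarrow> bool" where
  "singular_decomposition X f \<xi>\<^sub>0 \<xi>\<^sub>1 f\<^sub>H \<longleftrightarrow>
     f\<^sub>H \<in> Domain (minimal_schroedinger X) \<and>
     (AE x in lborel. rep_L2 f x =
        (\<Sum>j\<in>UNIV. (exp (- norm (x - X j)) / norm (x - X j)) *\<^sub>R (\<xi>\<^sub>0 $ j)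
                 + exp (- norm (x - X j)) *\<^sub>R (\<xi>\<^sub>1 $ j))
        + rep_L2 f\<^sub>H x)"

definition Gamma_0 :: "('m::finite \<Rightarrow> real^3) \<Rightarrow> 'n::finite L2 \<Rightarrow> complex^'n^'m" where
  "Gamma_0 X f =
     (\<chi> j. (4 * pi) *\<^sub>R Lim (at (X j)) (\<lambda>x. norm (x - X j) *\<^sub>R point_value f x))"

text \<open>In \<open>Gamma_1\<close> the coefficient \<open>\<xi>\<^sub>0\<^sub>j\<close> is expressed through the limit defining \<open>Gamma_0\<close>.\<close>

definition Gamma_1 :: "('m::finite \<Rightarrow> real^3) \<Rightarrow> 'n::finite L2 \<Rightarrow> complex^'n^'m" where
  "Gamma_1 X f =
     (\<chi> j. Lim (at (X j)) (\<lambda>x. point_value f x -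
        (1 / norm (x - X j)) *\<^sub>R Lim (at (X j)) (\<lambda>y. norm (y - X j) *\<^sub>R point_value f y)))"

definition H_0 :: "('m::finite \<Rightarrow> real^3) \<Rightarrow> 'n::finite L2 operator" where
  "H_0 X = {(f, g) \<in> adjoint_operator (minimal_schroedinger X). Gamma_0 X f = 0}"

end

theory Submission
  imports Defs "HOL-Real_Asymp.Real_Asymp"
begin

text \<open>Everything is read off from the resolvent \<open>R\<close> of the free operator at \<open>-1\<close>, which is convolution with
the Yukawa kernel \<open>k(x) = e\<^bsup>-|x|\<^esup> / (4 \<pi> |x|)\<close>. This operator is bounded, symmetric and injective, its
range is the Sobolev space of order two, and it inverts \<open>1 - \<Delta>\<close> there (\<open>resolvent_in_sobolev\<close>,
\<open>sobolev_eq_resolvent\<close>). In three dimensions \<open>k\<close> is itself square integrable, so \<open>R g\<close> is continuous and its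
value at \<open>x\<^sub>j\<close> is an inner product of \<open>g\<close> with the translated kernel \<open>k\<^sub>j = k(\<cdot> - x\<^sub>j)\<close>. Hence the domain
of \<open>H\<close> consists of the \<open>R g\<close> with \<open>g\<close> orthogonal to the finite dimensional space \<open>N\<close> spanned by the
vectors \<open>k\<^sub>j \<otimes> c\<close>.

From here on the argument is linear algebra, carried out in the locale \<open>singular_perturbation\<close>. The
adjoint of \<open>H\<close> acts on \<open>R g + n\<close>, \<open>n \<in> N\<close>, as \<open>g - (R g + n)\<close>, and the boundary form of two such elements
\<open>u + n\<close> and \<open>v + p\<close> is \<open>((1 - \<Delta>) u, p) - (n, (1 - \<Delta>) v)\<close>, that is, point values of \<open>u\<close> and \<open>v\<close> paired with
the coefficients of \<open>p\<close> and \<open>n\<close>. The coefficients are \<open>\<Gamma>\<^sub>0\<close>; the regularised values \<open>\<Gamma>\<^sub>1\<close> differ from the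
point values of \<open>u\<close> by a real symmetric matrix applied to \<open>\<Gamma>\<^sub>0\<close>, which cancels in the boundary form. The
functions \<open>e\<^bsup>-r\<^sub>j\<^esup>\<close> are \<open>8 \<pi> R k\<^sub>j\<close>, so that their values at the points form a multiple of the Gram matrix of
the \<open>k\<^sub>j\<close>. That matrix is invertible because the singularities sit at different points, and so
every element of the Sobolev space can be corrected by the \<open>e\<^bsup>-r\<^sub>j\<^esup>\<close> to one that vanishes at all points.
The deficiency indices agree since complex conjugation commutes with \<open>H\<close>.

The analysis behind \<open>R\<close> rests on three facts. First, \<open>R (w - \<Delta> w) = w\<close> for test functions \<open>w\<close>
(\<open>yukawa_fundamental_solution_at_0\<close>): with \<open>|x|\<close> replaced by \<open>(\<epsilon>\<^sup>2 + |x|\<^sup>2)\<^bsup>1/2\<^esup>\<close> the kernel becomes smooth, one may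
integrate by parts over the whole space, and \<open>1 - \<Delta>\<close> turns it into an explicit approximate identity.
Second, second derivatives are controlled by integration by parts alone: \<open>R\<close> commutes with weak
derivatives, which gives \<open>\<Sum>\<^sub>i\<^sub>j \<parallel>R \<partial>\<^sub>i \<partial>\<^sub>j w\<parallel>\<^sup>2 = \<parallel>R \<Delta> w\<parallel>\<^sup>2 = \<parallel>R w - w\<parallel>\<^sup>2\<close>. Third, an
explicit class of bump functions, whose partial derivatives visibly commute, is dense; the
bounds therefore extend to all of \<open>L\<^sup>2\<close> by completeness.\<close>

section \<open>Projections and orthonormal bases in Hilbert space\<close>

text \<open>The point of the closed subspace nearest to \<open>x\<close> does it. A minimising sequence is Cauchy by the
parallelogram law, and at the minimum the derivative in every direction of the subspace vanishes.\<close>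

lemma closed_subspace_projection:
  fixes C :: "'a::{real_inner, complete_space} set"
  assumes C: "subspace C" "closed C"
  obtains p where "p \<in> C" "\<And>s. s \<in> C \<Longrightarrow> inner (x - p) s = 0"
proof -
  define d where "d = infdist x C"
  have ne: "C \<noteq> {}" using subspace_0[OF C(1)] by auto
  have d0: "d \<ge> 0" by (simp add: d_def infdist_nonneg)
  have dle: "d \<le> norm (x - s)" if "s \<in> C" for s
    using infdist_le[OF that, of x] by (simp add: d_def dist_norm)
  have "\<exists>s\<in>C. (norm (x - s))\<^sup>2 < d\<^sup>2 + 1 / Suc n" for n
  proof -
    have "d < sqrt (d\<^sup>2 + 1 / Suc n)"
      by (rule real_less_rsqrt) simp
    then obtain s where s: "s \<in> C" "dist x s < sqrt (d\<^sup>2 + 1 / Suc n)"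
      using cInf_lessD[of "dist x ` C"] ne
      unfolding d_def infdist_def by auto
    then have "(dist x s)\<^sup>2 < d\<^sup>2 + 1 / Suc n"
      by (metis not_le real_le_lsqrt real_le_rsqrt real_sqrt_ge_0_iff zero_le_dist order_trans less_imp_le)
    with s(1) show ?thesis
      by (auto simp: dist_norm)
  qed
  then obtain s where sC: "\<And>n. s n \<in> C" and s: "\<And>n. (norm (x - s n))\<^sup>2 < d\<^sup>2 + 1 / Suc n"
    by metis
  have par: "(norm (s n - s m))\<^sup>2 \<le> 2 / Suc n + 2 / Suc m" for m n
  proof -
    have "d \<le> norm (x - (1/2) *\<^sub>R (s n + s m))"
      by (intro dle subspace_scale subspace_add C sC)
    then have "4 * d\<^sup>2 \<le> 4 * (norm (x - (1/2) *\<^sub>R (s n + s m)))\<^sup>2"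
      using d0 by (simp add: power_mono)
    also have "\<dots> = 2 * (norm (x - s n))\<^sup>2 + 2 * (norm (x - s m))\<^sup>2 - (norm (s n - s m))\<^sup>2"
      by (simp add: power2_norm_eq_inner inner_diff_left inner_diff_right inner_add_left
          inner_add_right inner_commute algebra_simps)
    finally show ?thesis
      using s[of n] s[of m] by simp
  qed
  have "Cauchy s"
  proof (rule metric_CauchyI)
    fix e :: real assume e: "e > 0"
    obtain M where M: "4 / e\<^sup>2 < Suc M"
      using reals_Archimedean2 by (meson less_trans of_nat_Suc of_nat_less_iff lessI)
    have "dist (s m) (s n) < e" if "m \<ge> M" "n \<ge> M" for m n
    proof -
      have "2 / real (Suc m) \<le> 2 / Suc M" "2 / real (Suc n) \<le> 2 / Suc M"
        using that by (auto simp: frac_le)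
      moreover have "4 / Suc M < e\<^sup>2"
        using M e by (simp add: field_simps)
      ultimately have "(norm (s m - s n))\<^sup>2 < e\<^sup>2"
        using par[of m n] by simp
      then show ?thesis
        using e by (simp add: dist_norm power_less_imp_less_base)
    qed
    then show "\<exists>M. \<forall>m\<ge>M. \<forall>n\<ge>M. dist (s m) (s n) < e" by blast
  qed
  then obtain p where p: "s \<longlonglongrightarrow> p"
    using Cauchy_convergent_iff convergent_def by blast
  have pC: "p \<in> C"
    using closed_sequentially[OF C(2) _ p] sC by blast
  have np: "(norm (x - p))\<^sup>2 \<le> d\<^sup>2"
  proof (rule LIMSEQ_le)
    show "(\<lambda>n. (norm (x - s n))\<^sup>2) \<longlonglongrightarrow> (norm (x - p))\<^sup>2"
      by (intro tendsto_intros p)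
    show "(\<lambda>n. d\<^sup>2 + 1 / Suc n) \<longlonglongrightarrow> d\<^sup>2"
      using tendsto_add[OF tendsto_const LIMSEQ_inverse_real_of_nat] by (simp add: divide_inverse)
    show "\<exists>N. \<forall>n\<ge>N. (norm (x - s n))\<^sup>2 \<le> d\<^sup>2 + 1 / Suc n"
      using s less_imp_le by blast
  qed
  have "inner (x - p) t = 0" if t: "t \<in> C" for t
  proof (cases "t = 0")
    case False
    \<comment> \<open>This step length minimises the distance from \<open>x\<close> along the line through \<open>p\<close> in direction \<open>t\<close>.\<close>
    define c where "c = inner (x - p) t / (norm t)\<^sup>2"
    have "d \<le> norm (x - (p + c *\<^sub>R t))"
      by (intro dle subspace_add subspace_scale C pC t)
    then have "d\<^sup>2 \<le> (norm (x - (p + c *\<^sub>R t)))\<^sup>2"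
      using d0 by (simp add: power_mono)
    also have "\<dots> = (norm (x - p))\<^sup>2 - 2 * c * inner (x - p) t + c\<^sup>2 * (norm t)\<^sup>2"
      unfolding power2_norm_eq_inner
      by (simp add: inner_diff_left inner_diff_right inner_add_left inner_add_right inner_commute
          algebra_simps power2_eq_square)
    also have "\<dots> = (norm (x - p))\<^sup>2 - (inner (x - p) t)\<^sup>2 / (norm t)\<^sup>2"
      using False by (simp add: c_def power2_eq_square)
    finally have "(inner (x - p) t)\<^sup>2 / (norm t)\<^sup>2 \<le> 0"
      using np by simp
    then show ?thesis
      using False by (simp add: divide_le_0_iff)
  qed simp
  then show ?thesis
    using that pC by blast
qed

lemma subspace_closure:
  fixes S :: "'a::real_normed_vector set"
  assumes S: "subspace S"
  shows "subspace (closure S)"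
proof (rule subspaceI)
  show "0 \<in> closure S" using subspace_0[OF S] closure_subset by blast
next
  fix x y assume "x \<in> closure S" "y \<in> closure S"
  then obtain a b where "\<forall>n. a n \<in> S" "a \<longlonglongrightarrow> x" "\<forall>n. b n \<in> S" "b \<longlonglongrightarrow> y"
    unfolding closure_sequential by blast
  then show "x + y \<in> closure S"
    unfolding closure_sequential
    by (intro exI[of _ "\<lambda>n. a n + b n"]) (auto intro: tendsto_add subspace_add[OF S])
next
  fix c x assume "x \<in> closure S"
  then obtain a where "\<forall>n. a n \<in> S" "a \<longlonglongrightarrow> x"
    unfolding closure_sequential by blast
  then show "c *\<^sub>R x \<in> closure S"
    unfolding closure_sequential
    by (intro exI[of _ "\<lambda>n. c *\<^sub>R a n"]) (auto intro: tendsto_scaleR subspace_scale[OF S])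
qed

lemma dense_subspaceI:
  fixes S :: "'a::{real_inner, complete_space} set"
  assumes S: "subspace S" and orth: "\<And>h. (\<And>s. s \<in> S \<Longrightarrow> inner h s = 0) \<Longrightarrow> h = 0"
  shows "closure S = UNIV"
proof -
  have "x \<in> closure S" for x
  proof -
    obtain p where "p \<in> closure S" "\<And>s. s \<in> closure S \<Longrightarrow> inner (x - p) s = 0"
      using closed_subspace_projection[of "closure S" x] subspace_closure[OF S] by auto
    then show ?thesis
      using orth[of "x - p"] closure_subset[of S] by auto
  qed
  then show ?thesis by auto
qed

text \<open>A maximal orthonormal subset, given by Zorn's lemma, is a basis: a nonzero vector orthogonal to it
could be normalised and added.\<close>

lemma orthonormal_basis_exists:
  fixes S :: "'a::complex_inner set"
  assumes sc: "\<And>r f. f \<in> S \<Longrightarrow> r *\<^sub>R f \<in> S"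
  shows "\<exists>B. orthonormal_basis_of S B"
proof -
  define ON where "ON B \<longleftrightarrow> B \<subseteq> S \<and> (\<forall>b\<in>B. \<forall>c\<in>B. cinner b c = (if b = c then 1 else 0))" for B
  have "\<exists>M\<in>{B. ON B}. \<forall>X\<in>{B. ON B}. M \<subseteq> X \<longrightarrow> X = M"
  proof (rule subset_Zorn')
    fix C assume C: "subset.chain {B. ON B} C"
    have "ON (\<Union>C)"
      unfolding ON_def
    proof (intro conjI ballI)
      show "\<Union>C \<subseteq> S" using C by (auto simp: subset.chain_def ON_def)
    next
      fix b c assume "b \<in> \<Union>C" "c \<in> \<Union>C"
      then obtain B D where *: "B \<in> C" "D \<in> C" "b \<in> B" "c \<in> D" by auto
      then have "B \<subseteq> D \<or> D \<subseteq> B" using C unfolding subset.chain_def by blast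
      then obtain Z where "Z \<in> C" "b \<in> Z" "c \<in> Z" using * by blast
      then show "cinner b c = (if b = c then 1 else 0)"
        using C unfolding subset.chain_def ON_def by blast
    qed
    then show "\<Union>C \<in> {B. ON B}" by simp
  qed
  then obtain M where M: "ON M" "\<And>X. ON X \<Longrightarrow> M \<subseteq> X \<Longrightarrow> X = M" by auto
  have "f = 0" if f: "f \<in> S" "\<forall>b\<in>M. cinner f b = 0" for f
  proof (rule ccontr)
    assume "f \<noteq> 0"
    define e where "e = (1 / norm f) *\<^sub>R f"
    have eC: "e = complex_of_real (1 / norm f) *\<^sub>C f"
      by (simp only: e_def scaleC_of_real)
    have eb: "cinner e b = 0" "cinner b e = 0" if "b \<in> M" for b
    proof -
      show "cinner e b = 0" using f that by (simp add: eC cinner_scaleC_left)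
      then show "cinner b e = 0" by (subst cinner_commute) simp
    qed
    have "cinner e e = 1"
    proof (rule complex_eqI)
      have "Re (cinner e e) = (norm e)\<^sup>2"
        by (simp add: power2_norm_eq_inner inner_eq_Re_cinner)
      then show "Re (cinner e e) = Re 1"
        using \<open>f \<noteq> 0\<close> by (simp add: e_def)
      show "Im (cinner e e) = Im 1"
        using cinner_commute[of e e] by (metis cnj.sel(2) equation_minus_iff neg_equal_zero one_complex.sel(2))
    qed
    then have "ON (insert e M)"
      using M(1) eb sc[OF f(1)] by (auto simp: ON_def e_def[symmetric] simp del: scaleR_scaleR) (simp add: e_def sc[OF f(1)])
    then have "e \<in> M" using M(2)[of "insert e M"] by blast
    with eb \<open>cinner e e = 1\<close> show False by auto
  qed
  with M(1) show ?thesis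
    unfolding orthonormal_basis_of_def ON_def by blast
qed

section \<open>Complex inner products\<close>

text \<open>The real inner product determines the complex one. This lets most of the analysis below be done with
the real structure alone.\<close>

lemma cinner_eq_inner: "cinner f g = Complex (inner f g) (inner f (\<i> *\<^sub>C g))"
  for f g :: "'a::complex_inner"
proof -
  have "cinner f (\<i> *\<^sub>C g) = - \<i> * cinner f g"
    by (subst (1 2) cinner_commute) (simp add: cinner_scaleC_left)
  then show ?thesis
    by (simp add: inner_eq_Re_cinner complex_eq_iff)
qed

lemma cinner_add_right: "cinner f (g + h) = cinner f g + cinner f (h :: 'a::complex_inner)"
  by (simp add: cinner_eq_inner inner_add_right scaleC_add_right complex_eq_iff)

lemma cinner_scaleC_right: "cinner f (c *\<^sub>C g) = cnj c * cinner f (g :: 'a::complex_inner)"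
  by (subst (1 2) cinner_commute) (simp add: cinner_scaleC_left)

lemma scaleC_minus_one: "- 1 *\<^sub>C f = - (f :: 'a::complex_inner)"
  using scaleC_of_real[of "-1" f] by simp

lemma cinner_minus_left: "cinner (- f) g = - cinner f (g :: 'a::complex_inner)"
  using cinner_scaleC_left[of "-1" f g] by (simp add: scaleC_minus_one)

lemma cinner_minus_right: "cinner f (- g) = - cinner f (g :: 'a::complex_inner)"
  using cinner_scaleC_right[of f "-1" g] by (simp add: scaleC_minus_one)

lemma cinner_diff_left: "cinner (f - h) g = cinner f g - cinner h (g :: 'a::complex_inner)"
  using cinner_add_left[of f "- h" g] by (simp add: cinner_minus_left)

lemma cinner_diff_right: "cinner f (g - h) = cinner f g - cinner f (h :: 'a::complex_inner)"
  using cinner_add_right[of f g "- h"] by (simp add: cinner_minus_right)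

lemma cinner_zero_left [simp]: "cinner 0 g = (0 :: complex)" for g :: "'a::complex_inner"
  using cinner_diff_left[of g g g] by simp

lemma cinner_zero_right [simp]: "cinner g 0 = (0 :: complex)" for g :: "'a::complex_inner"
  using cinner_diff_right[of g g g] by simp

lemma scaleC_zero_right [simp]: "c *\<^sub>C (0 :: 'a::complex_inner) = 0"
  using scaleC_add_right[of c 0 0] by simp

lemma cinner_extensionality:
  fixes f g :: "'a::complex_inner"
  assumes "\<And>h. cinner f h = cinner g h"
  shows "f = g"
proof -
  have "cinner (f - g) (f - g) = 0" using assms by (simp add: cinner_diff_left)
  then have "inner (f - g) (f - g) = 0" by (simp add: inner_eq_Re_cinner)
  then show ?thesis by simp
qed

section \<open>Finite rank restrictions of a resolvent\<close>

text \<open>A conjugation that leaves the operator invariant leaves its adjoint invariant as well, and being antilinear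
it maps the defect subspace at \<open>\<i>\<close> onto that at \<open>- \<i>\<close>, carrying an orthonormal basis to one.\<close>

lemma equal_deficiency_indices_conjugation:
  fixes A :: "'a::complex_inner operator" and J :: "'a \<Rightarrow> 'a"
  assumes J_cinner: "\<And>f g. cinner (J f) (J g) = cnj (cinner f g)"
    and J_J: "\<And>f. J (J f) = f"
    and J_scaleC: "\<And>c f. J (c *\<^sub>C f) = cnj c *\<^sub>C J f"
    and J_A: "\<And>f f'. (f, f') \<in> A \<Longrightarrow> (J f, J f') \<in> A"
  shows "equal_deficiency_indices A"
proof -
  have adj: "(J g, J g') \<in> adjoint_operator A" if "(g, g') \<in> adjoint_operator A" for g g'
    unfolding adjoint_operator_def
  proof (clarify)
    fix f f' assume "(f, f') \<in> A"
    then have "cinner (J f') g = cinner (J f) g'"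
      using J_A[OF \<open>(f, f') \<in> A\<close>] that by (force simp: adjoint_operator_def)
    then show "cinner f' (J g) = cinner f (J g')"
      using J_cinner[of "J f'" g] J_cinner[of "J f" g'] by (simp add: J_J)
  qed
  have defect: "J f \<in> defect_subspace A (cnj z)" if "f \<in> defect_subspace A z" for f z
    using adj[of f "z *\<^sub>C f"] that by (simp add: defect_subspace_def J_scaleC)
  have "\<exists>B. orthonormal_basis_of (defect_subspace A \<i>) B"
  proof (rule orthonormal_basis_exists)
    fix r :: real and f assume "f \<in> defect_subspace A \<i>"
    then show "r *\<^sub>R f \<in> defect_subspace A \<i>"
      unfolding defect_subspace_def adjoint_operator_def
      by (auto simp: scaleC_of_real[symmetric] cinner_scaleC_right mult.left_commute)
  qed
  then obtain B where B: "orthonormal_basis_of (defect_subspace A \<i>) B" ..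
  have inj: "inj J" by (rule inj_on_inverseI[where g=J]) (rule J_J)
  have "orthonormal_basis_of (defect_subspace A (- \<i>)) (J ` B)"
    unfolding orthonormal_basis_of_def
  proof (intro conjI ballI impI)
    show "J ` B \<subseteq> defect_subspace A (- \<i>)"
      using B defect[of _ \<i>] by (auto simp: orthonormal_basis_of_def)
    show "cinner b c = (if b = c then 1 else 0)" if "b \<in> J ` B" "c \<in> J ` B" for b c
      using that B inj by (auto simp: orthonormal_basis_of_def J_cinner dest: injD)
    show "f = 0" if f: "f \<in> defect_subspace A (- \<i>)" and b: "\<forall>b\<in>J ` B. cinner f b = 0" for f
    proof -
      have "cinner (J f) c = 0" if "c \<in> B" for c
        using J_cinner[of f "J c"] b that by (simp add: J_J)
      then have "J f = 0"
        using B defect[OF f] by (auto simp: orthonormal_basis_of_def)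
      moreover have "J 0 = 0"
        using J_scaleC[of 0 0] scaleC_of_real[of 0 "J 0"] by simp
      ultimately show "f = 0"
        using J_J[of f] by simp
    qed
  qed
  moreover have "B \<approx> J ` B"
    using inj_on_subset[OF inj subset_UNIV] by (rule eqpoll_sym[OF inj_on_image_eqpoll_self])
  ultimately show ?thesis
    unfolding equal_deficiency_indices_def using B by blast
qed

text \<open>An abstract form of point interactions. \<open>R\<close> plays the part of the resolvent at \<open>-1\<close> of a self-adjoint
operator, \<open>E\<close> parametrises a finite dimensional space of singular elements, and the adjoint \<open>V\<close> of \<open>E\<close>
evaluates \<open>R g\<close> at the points. The last assumption says that no singular element other than zero is
regular; it makes \<open>E\<close> injective and the restriction densely defined.\<close>

locale singular_perturbation =
  fixes R :: "'a::complex_hilbert \<Rightarrow> 'a"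
    and E :: "'h::{complex_hilbert,euclidean_space} \<Rightarrow> 'a"
    and V :: "'a \<Rightarrow> 'h"
  assumes R_add: "\<And>f g. R (f + g) = R f + R g"
    and R_scaleC: "\<And>c f. R (c *\<^sub>C f) = c *\<^sub>C R f"
    and R_bounded: "\<exists>K. \<forall>f. norm (R f) \<le> norm f * K"
    and R_symmetric: "\<And>f g. cinner (R f) g = cinner f (R g)"
    and R_injective: "\<And>f. R f = 0 \<Longrightarrow> f = 0"
    and E_add: "\<And>c d. E (c + d) = E c + E d"
    and E_scaleC: "\<And>z c. E (z *\<^sub>C c) = z *\<^sub>C E c"
    and V_adjoint_E: "\<And>g c. cinner (V g) c = cinner g (E c)"
    and range_R_E: "\<And>g c. R g = E c \<Longrightarrow> c = 0"
begin

text \<open>The operator whose resolvent at \<open>-1\<close> is \<open>R\<close>, and its restriction to elements with vanishing evaluation.\<close>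

definition T :: "'a operator" where
  "T = {(R g, g - R g) | g. True}"

definition S :: "'a operator" where
  "S = {(R g, g - R g) | g. V g = 0}"

lemma R_linear: "bounded_linear R"
proof -
  obtain K where "\<And>f. norm (R f) \<le> norm f * K" using R_bounded by blast
  then show ?thesis
  proof (rule bounded_linear_intro[rotated 2])
  show "R (r *\<^sub>R f) = r *\<^sub>R R f" for r f
    using R_scaleC[of "complex_of_real r" f] by (simp add: scaleC_of_real)
  qed (rule R_add)
qed

lemma R_diff: "R (f - g) = R f - R g"
  by (rule linear_diff[OF bounded_linear.linear[OF R_linear]])

lemma R_zero [simp]: "R 0 = 0"
  by (rule linear_0[OF bounded_linear.linear[OF R_linear]])

lemma E_linear: "linear E"
proof (rule linearI)
  show "E (r *\<^sub>R c) = r *\<^sub>R E c" for r c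
    using E_scaleC[of "complex_of_real r" c] by (simp add: scaleC_of_real)
qed (rule E_add)

lemma E_zero [simp]: "E 0 = 0"
  by (rule linear_0[OF E_linear])

lemma V_add: "V (f + g) = V f + V g"
  by (rule cinner_extensionality) (simp add: V_adjoint_E cinner_add_left)

lemma V_scaleC: "V (z *\<^sub>C f) = z *\<^sub>C V f"
  by (rule cinner_extensionality) (simp add: V_adjoint_E cinner_scaleC_left)

lemma V_zero [simp]: "V 0 = 0"
  using V_add[of 0 0] by simp

lemma V_diff: "V (f - g) = V f - V g"
  by (rule cinner_extensionality) (simp add: V_adjoint_E cinner_diff_left)

lemma V_eq_0_iff: "V g = 0 \<longleftrightarrow> (\<forall>c. cinner g (E c) = 0)"
  by (metis V_adjoint_E cinner_extensionality cinner_zero_left)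

lemma V_eq_0_iff_inner: "V g = 0 \<longleftrightarrow> (\<forall>c. inner g (E c) = 0)"
proof -
  have "inner g (E c) = inner (V g) c" for c
    by (simp add: inner_eq_Re_cinner V_adjoint_E)
  then show ?thesis by (metis inner_eq_zero_iff inner_zero_left)
qed

text \<open>\<open>V \<circ> E\<close> is the Gram operator of the singular elements. It is injective because \<open>V (E c) = 0\<close> forces
\<open>E c\<close> to be orthogonal to itself, hence bijective in finite dimensions.\<close>

lemma surj_V_E: "surj (\<lambda>c. V (E c))"
proof (rule linear_injective_imp_surjective)
  show lin: "linear (\<lambda>c. V (E c))"
  proof (rule linearI)
    show "V (E (r *\<^sub>R c)) = r *\<^sub>R V (E c)" for r c
      using V_scaleC[of "complex_of_real r" "E c"] E_scaleC[of "complex_of_real r" c]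
      by (simp add: scaleC_of_real)
  qed (simp add: E_add V_add)
  show "inj (\<lambda>c. V (E c))"
  proof (subst linear_injective_0[OF lin], intro allI impI)
    fix c assume "V (E c) = 0"
    then have "inner (E c) (E c) = 0" by (simp add: V_eq_0_iff_inner)
    then show "c = 0" using range_R_E[of 0 c] by simp
  qed
qed simp

lemma V_decompose: obtains c where "V (g - E c) = 0"
proof -
  obtain c where "V g = V (E c)" using surjD[OF surj_V_E, of "V g"] by auto
  then show ?thesis using that[of c] by (simp add: V_diff)
qed

text \<open>The double orthogonal complement of the range of \<open>E\<close> is that range: the inverse of the Gram operator
yields the orthogonal projection onto it.\<close>

lemma orthogonal_kernel_V:
  assumes h: "\<And>w. V w = 0 \<Longrightarrow> inner w h = 0"
  obtains c where "h = E c"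
proof -
  obtain c where c: "V (h - E c) = 0" by (rule V_decompose)
  then have "inner (h - E c) (E c) = 0" by (simp add: V_eq_0_iff_inner)
  with h[OF c] have "inner (h - E c) (h - E c) = 0"
    by (subst inner_diff_right) simp
  then show ?thesis using that[of c] by simp
qed

lemma S_conv: "S = {p. R (fst p + snd p) = fst p \<and> (\<forall>c. inner (fst p + snd p) (E c) = 0)}"
proof (intro equalityI subsetI)
  fix p assume "p \<in> {p. R (fst p + snd p) = fst p \<and> (\<forall>c. inner (fst p + snd p) (E c) = 0)}"
  then show "p \<in> S"
    unfolding S_def V_eq_0_iff_inner mem_Collect_eq
    by (intro exI[of _ "fst p + snd p"]) (auto simp: prod_eq_iff)
qed (auto simp: S_def V_eq_0_iff_inner)

lemma closed_S: "closed S"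
  unfolding S_conv
  by (intro closed_Collect_conj closed_Collect_eq closed_Collect_all continuous_intros
      bounded_linear.continuous_on[OF R_linear])

lemma subspace_Domain_S: "subspace (Domain S)"
proof (rule subspaceI)
  show "0 \<in> Domain S" unfolding S_def by (force intro: exI[of _ 0])
  show "x + y \<in> Domain S" if "x \<in> Domain S" "y \<in> Domain S" for x y
  proof -
    from that obtain g h where "x = R g" "y = R h" "V g = 0" "V h = 0" by (auto simp: S_def)
    then show ?thesis unfolding S_def
      by (auto intro!: exI[of _ "g + h"] simp: R_add V_add)
  qed
  show "r *\<^sub>R x \<in> Domain S" if "x \<in> Domain S" for r x
  proof -
    from that obtain g where "x = R g" "V g = 0" by (auto simp: S_def)
    then show ?thesis unfolding S_def
      by (auto intro!: exI[of _ "complex_of_real r *\<^sub>C g"] simp: R_scaleC V_scaleC simp flip: scaleC_of_real)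
  qed
qed

text \<open>A vector orthogonal to the domain has an image under \<open>R\<close> that is orthogonal to the kernel of \<open>V\<close>, hence
singular; being regular at the same time, this image vanishes.\<close>

lemma densely_defined_S: "densely_defined S"
  unfolding densely_defined_def
proof (rule dense_subspaceI[OF subspace_Domain_S])
  fix h assume h: "\<And>s. s \<in> Domain S \<Longrightarrow> inner h s = 0"
  have "inner w (R h) = 0" if "V w = 0" for w
  proof -
    have "inner h (R w) = 0" using h that by (auto simp: S_def)
    then show ?thesis by (simp add: inner_eq_Re_cinner R_symmetric[symmetric]) (metis cinner_commute complex_cnj(1) complex.sel(1) complex_surj cnj.simps(1) R_symmetric)
  qed
  then obtain c where "R h = E c" by (rule orthogonal_kernel_V)
  then show "h = 0" using range_R_E R_injective by fastforce
qed

lemma T_graph: "(f, f') \<in> T \<longleftrightarrow> f = R (f + f')"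
  by (auto simp: T_def intro: exI[of _ "f + f'"])

lemma S_graph: "(f, f') \<in> S \<longleftrightarrow> f = R (f + f') \<and> V (f + f') = 0"
  by (auto simp: S_def intro: exI[of _ "f + f'"])

lemma linear_T: "linear_operator T"
  unfolding linear_operator_def
proof (intro conjI allI)
  show "single_valued T"
  proof (rule single_valuedI)
    fix f a b assume "(f, a) \<in> T" "(f, b) \<in> T"
    then have "R ((f + a) - (f + b)) = 0" unfolding T_graph R_diff by simp
    then show "a = b" using R_injective by fastforce
  qed
qed (auto simp: T_graph R_add R_scaleC add.left_commute add.assoc simp flip: scaleC_add_right)

lemma linear_S: "linear_operator S"
  unfolding linear_operator_def
proof (intro conjI allI)
  show "single_valued S"
    using linear_T unfolding linear_operator_def single_valued_def
    by (metis S_graph T_graph)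
next
  show "\<forall>(f, f')\<in>S. \<forall>(g, g')\<in>S. (f + g, f' + g') \<in> S"
  proof (clarify)
    fix f f' g g' assume *: "(f, f') \<in> S" "(g, g') \<in> S"
    have "f + g + (f' + g') = (f + f') + (g + g')" by simp
    with * show "(f + g, f' + g') \<in> S" by (simp only: S_graph R_add V_add) auto
  qed
qed (auto simp: S_graph R_scaleC V_scaleC simp flip: scaleC_add_right)

lemma symmetric_S: "symmetric_operator S"
  by (auto simp: symmetric_operator_def S_def cinner_diff_left cinner_diff_right R_symmetric)

text \<open>If \<open>(h, h')\<close> belongs to the adjoint then \<open>h - R (h + h')\<close> is orthogonal to the kernel of \<open>V\<close>, that is, to the
range of \<open>1 + S\<close>, and is therefore a singular element.\<close>

lemma adjoint_S: "adjoint_operator S = {(R g + E c, g - (R g + E c)) | g c. True}"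
proof (intro equalityI subsetI)
  fix p assume p: "p \<in> adjoint_operator S"
  obtain h h' where hh: "p = (h, h')" by (cases p)
  have "inner w (h - R (h + h')) = 0" if "V w = 0" for w
  proof -
    have "cinner (w - R w) h = cinner (R w) h'"
      using p that by (auto simp: hh adjoint_operator_def S_def)
    then have "cinner w h = cinner w (R (h + h'))"
      by (simp add: R_symmetric[symmetric] cinner_diff_left cinner_add_right R_add algebra_simps)
    then show ?thesis by (simp add: inner_eq_Re_cinner cinner_diff_right)
  qed
  then obtain c where "h - R (h + h') = E c" by (rule orthogonal_kernel_V)
  then show "p \<in> {(R g + E c, g - (R g + E c)) | g c. True}"
    using hh by (auto intro!: exI[of _ "h + h'"] exI[of _ c] simp: algebra_simps)
next
  fix p assume "p \<in> {(R g + E c, g - (R g + E c)) | g c. True}"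
  then obtain g c where p: "p = (R g + E c, g - (R g + E c))" by auto
  have "cinner (w - R w) (R g + E c) = cinner (R w) (g - (R g + E c))" if "V w = 0" for w
    using that by (simp add: V_eq_0_iff cinner_diff_left cinner_diff_right cinner_add_right R_symmetric)
  then show "p \<in> adjoint_operator S" by (auto simp: p adjoint_operator_def S_def)
qed

lemma Domain_adjoint_S: "Domain (adjoint_operator S) = {R g + E c | g c. True}"
  by (auto simp: adjoint_S)

lemma self_adjoint_T: "self_adjoint T"
  unfolding self_adjoint_def
proof (intro conjI linear_T)
  have "Domain S \<subseteq> Domain T" by (auto simp: S_def T_def)
  then show "densely_defined T"
    using densely_defined_S closure_mono unfolding densely_defined_def by blast
  show "adjoint_operator T = T"
  proof (intro equalityI subrelI)
    fix h h' assume *: "(h, h') \<in> adjoint_operator T"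
    have "h = R (h + h')"
    proof (rule cinner_extensionality)
      fix w
      have "cinner (w - R w) h = cinner (R w) h'"
        using * by (auto simp: adjoint_operator_def T_def)
      then have "cinner w h = cinner w (R (h + h'))"
        by (simp add: R_symmetric[symmetric] cinner_diff_left cinner_add_right R_add algebra_simps)
      then show "cinner h w = cinner (R (h + h')) w" by (metis cinner_commute)
    qed
    then show "(h, h') \<in> T" by (simp add: T_graph)
  qed (auto simp: adjoint_operator_def T_def cinner_diff_left cinner_diff_right R_symmetric)
qed

text \<open>In the boundary form of \<open>R g + E c\<close> and \<open>R h + E d\<close> only \<open>(g, E d) - (E c, h) = (V g, d) - (c, V h)\<close>
survives. Any symmetric \<open>A\<close> may be added to the second boundary map, since its contributions cancel.
Surjectivity holds because already the values \<open>V (E d)\<close> exhaust the boundary space.\<close>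

lemma boundary_triplet_S:
  fixes A :: "'h \<Rightarrow> 'h"
  assumes A_add: "\<And>c d. A (c + d) = A c + A d"
    and A_scaleC: "\<And>z c. A (z *\<^sub>C c) = z *\<^sub>C A c"
    and A_symmetric: "\<And>c d. cinner (A c) d = cinner c (A d)"
    and G0: "\<And>g c. \<Gamma>\<^sub>0 (R g + E c) = c"
    and G1: "\<And>g c. \<Gamma>\<^sub>1 (R g + E c) = V g + A c"
    and deficiency: "equal_deficiency_indices S"
  shows "boundary_triplet S \<Gamma>\<^sub>0 \<Gamma>\<^sub>1"
proof -
  have sum: "R g + E c + (R h + E d) = R (g + h) + E (c + d)" for g c h d
    by (simp add: R_add E_add)
  have scale: "z *\<^sub>C (R g + E c) = R (z *\<^sub>C g) + E (z *\<^sub>C c)" for z g c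
    by (simp add: R_scaleC E_scaleC scaleC_add_right)
  have V_adjoint': "cinner c (V g) = cinner (E c) g" for c g
    by (metis V_adjoint_E cinner_commute)
  have linear: "clinear_map_on (Domain (adjoint_operator S)) \<Gamma>\<^sub>0"
      "clinear_map_on (Domain (adjoint_operator S)) \<Gamma>\<^sub>1"
    unfolding clinear_map_on_def Domain_adjoint_S
    by (safe; simp only: sum scale G0 G1 V_add V_scaleC A_add A_scaleC; simp add: scaleC_add_right)+
  have Green: "cinner f' g - cinner f g' = cinner (\<Gamma>\<^sub>1 f) (\<Gamma>\<^sub>0 g) - cinner (\<Gamma>\<^sub>0 f) (\<Gamma>\<^sub>1 g)"
    if "(f, f') \<in> adjoint_operator S" "(g, g') \<in> adjoint_operator S" for f f' g g'
  proof -
    from that obtain u c v d where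
      "f = R u + E c" "f' = u - (R u + E c)" "g = R v + E d" "g' = v - (R v + E d)"
      by (auto simp: adjoint_S)
    then show ?thesis
      by (simp add: G0 G1 cinner_add_left cinner_add_right cinner_diff_left cinner_diff_right
          V_adjoint_E V_adjoint' A_symmetric R_symmetric)
  qed
  have surj: "(\<lambda>f. (\<Gamma>\<^sub>0 f, \<Gamma>\<^sub>1 f)) ` Domain (adjoint_operator S) = UNIV"
  proof (rule equalityI[OF subset_UNIV], clarify)
    fix a b :: 'h
    obtain d where "V (E d) = b - A a" using surjD[OF surj_V_E, of "b - A a"] by auto
    then have "(a, b) = (\<Gamma>\<^sub>0 (R (E d) + E a), \<Gamma>\<^sub>1 (R (E d) + E a))"
      by (simp add: G0 G1)
    then show "(a, b) \<in> (\<lambda>f. (\<Gamma>\<^sub>0 f, \<Gamma>\<^sub>1 f)) ` Domain (adjoint_operator S)"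
      unfolding Domain_adjoint_S by blast
  qed
  show ?thesis
    unfolding boundary_triplet_def
    using linear_S closed_S densely_defined_S symmetric_S deficiency linear Green surj by blast
qed

end

section \<open>Calculus of partial derivatives\<close>

lemma partial_deriv_eq: "(\<phi> has_derivative D) (at x) \<Longrightarrow> partial_deriv i \<phi> x = D (axis i 1)"
  by (simp add: partial_deriv_def frechet_derivative_at[symmetric])

lemma has_real_derivative_line:
  assumes "\<phi> differentiable at (x + t *\<^sub>R axis i 1)"
  shows "((\<lambda>t. \<phi> (x + t *\<^sub>R axis i 1)) has_real_derivative partial_deriv i \<phi> (x + t *\<^sub>R axis i 1)) (at t)"
proof -
  define D where "D = frechet_derivative \<phi> (at (x + t *\<^sub>R axis i 1))"
  have D: "(\<phi> has_derivative D) (at (x + t *\<^sub>R axis i 1))"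
    using assms by (simp add: frechet_derivative_works D_def)
  then have "((\<lambda>t. \<phi> (x + t *\<^sub>R axis i 1)) has_derivative (\<lambda>h. D (h *\<^sub>R axis i 1))) (at t)"
    by (auto intro!: derivative_eq_intros has_derivative_compose[of "\<lambda>t. x + t *\<^sub>R axis i 1" _ _ _ \<phi> D, simplified])
  then show ?thesis
    using linear_scale[OF has_derivative_linear[OF D]]
    by (simp add: has_field_derivative_def partial_deriv_def D_def[symmetric] mult_commute_abs)
qed

lemma partial_deriv_const [simp]: "partial_deriv i (\<lambda>x. c) = (\<lambda>x. 0)"
  by (rule ext, subst partial_deriv_eq[OF has_derivative_const]) simp

lemma partial_deriv_add:
  assumes "f differentiable at x" "g differentiable at x"
  shows "partial_deriv i (\<lambda>x. f x + g x) x = partial_deriv i f x + partial_deriv i g x"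
  using assms unfolding frechet_derivative_works
  by (subst partial_deriv_eq[OF has_derivative_add]) (auto simp: partial_deriv_def)

lemma partial_deriv_mult:
  assumes "f differentiable at x" "g differentiable at x"
  shows "partial_deriv i (\<lambda>x. f x * g x) x = f x * partial_deriv i g x + partial_deriv i f x * g x"
  using assms unfolding frechet_derivative_works
  by (subst partial_deriv_eq[OF has_derivative_mult]) (auto simp: partial_deriv_def)

lemma partial_deriv_real_compose:
  assumes "(h has_real_derivative h') (at (f x))" "f differentiable at x"
  shows "(\<lambda>x. h (f x)) differentiable at x"
    and "partial_deriv i (\<lambda>x. h (f x)) x = h' * partial_deriv i f x"
proof -
  have "((\<lambda>x. h (f x)) has_derivative (\<lambda>y. h' * frechet_derivative f (at x) y)) (at x)"
    using assms unfolding frechet_derivative_works has_field_derivative_def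
    by (auto intro: has_derivative_compose)
  then show "(\<lambda>x. h (f x)) differentiable at x"
    "partial_deriv i (\<lambda>x. h (f x)) x = h' * partial_deriv i f x"
    by (auto simp: differentiable_def partial_deriv_eq) (simp add: partial_deriv_def)
qed

text \<open>At corresponding points both sides select from the same set of linear maps.\<close>

lemma partial_deriv_translate:
  "partial_deriv i (\<lambda>x. \<phi> (x + z)) = (\<lambda>x. partial_deriv i \<phi> (x + z))"
proof
  fix x
  have "frechet_derivative (\<lambda>x. \<phi> (x + z)) (at x) = frechet_derivative \<phi> (at (x + z))"
    unfolding frechet_derivative_def has_derivative_at
    by (rule arg_cong[where f=Eps], rule ext) (simp add: add.commute add.left_commute)
  then show "partial_deriv i (\<lambda>x. \<phi> (x + z)) x = partial_deriv i \<phi> (x + z)"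
    by (simp add: partial_deriv_def)
qed

lemma differentiable_coordinate: "(\<lambda>x::real^3. x $ k) differentiable at x"
  by (intro bounded_linear_imp_differentiable bounded_linear_vec_nth)

lemma partial_deriv_coordinate: "partial_deriv i (\<lambda>x. x $ k) x = (if i = k then 1 else 0)"
  by (subst partial_deriv_eq[OF bounded_linear_imp_has_derivative[OF bounded_linear_vec_nth]])
     (simp add: axis_def)

lemma partial_deriv_outside_support:
  assumes "open U" "x \<in> U" "\<And>y. y \<in> U \<Longrightarrow> \<phi> y = 0"
  shows "partial_deriv i \<phi> x = 0"
proof -
  have "(\<phi> has_derivative (\<lambda>_. 0)) (at x)"
    by (rule has_derivative_transform_within_open[OF has_derivative_const[of 0] assms(1,2)])
       (use assms(3) in auto)
  then show ?thesis by (simp add: partial_deriv_eq)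
qed

section \<open>Integration by parts\<close>

lemma bounded_support_partial_deriv:
  assumes "\<And>x. \<phi> x \<noteq> 0 \<Longrightarrow> norm x \<le> M" "partial_deriv i \<phi> x \<noteq> 0"
  shows "norm x \<le> M"
proof (rule ccontr)
  assume "\<not> norm x \<le> M"
  then have "partial_deriv i \<phi> x = 0"
    by (intro partial_deriv_outside_support[of "- cball 0 M"]) (use assms(1) in auto)
  with assms(2) show False by simp
qed

lemma bounded_support_bound:
  assumes "continuous_on UNIV (f :: real^3 \<Rightarrow> real)" "\<And>x. f x \<noteq> 0 \<Longrightarrow> norm x \<le> M"
  obtains B where "B > 0" "\<And>x. \<bar>f x\<bar> \<le> B"
proof -
  have "compact (f ` cball 0 M)"
    by (intro compact_continuous_image continuous_on_subset[OF assms(1)]) auto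
  then obtain B where B: "B > 0" "\<And>y. y \<in> f ` cball 0 M \<Longrightarrow> norm y \<le> B"
    using compact_imp_bounded bounded_pos by meson
  have "\<bar>f x\<bar> \<le> B" for x
  proof (cases "f x = 0")
    case False
    then show ?thesis using B(2)[of "f x"] assms(2)[of x] by auto
  qed (use B(1) in auto)
  then show ?thesis using that B(1) by blast
qed

lemma integrable_bounded_support:
  fixes f :: "real^3 \<Rightarrow> real"
  assumes "continuous_on UNIV f" "\<And>x. f x \<noteq> 0 \<Longrightarrow> norm x \<le> M"
  shows "integrable lborel f"
proof -
  have "integrable lborel (\<lambda>x. indicator (cball 0 M) x *\<^sub>R f x)"
    by (intro borel_integrable_compact continuous_on_subset[OF assms(1)]) auto
  moreover have "(\<lambda>x. indicator (cball 0 M) x *\<^sub>R f x) = f"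
    using assms(2) by (auto simp: fun_eq_iff indicator_def)
  ultimately show ?thesis by simp
qed

lemma lborel_translate: "distr lborel borel (\<lambda>x. x + z) = (lborel :: 'a::euclidean_space measure)"
proof -
  have "(\<lambda>x. x + z) = (+) z" by (simp add: fun_eq_iff add.commute)
  then show ?thesis by (simp only: lborel_distr_plus)
qed

lemma integral_lborel_translate:
  fixes f :: "'a::euclidean_space \<Rightarrow> 'b::{banach, second_countable_topology}"
  assumes "f \<in> borel_measurable borel"
  shows "(\<integral>x. f (x + z) \<partial>lborel) = (\<integral>x. f x \<partial>lborel)"
  using integral_distr[of "\<lambda>x. x + z" lborel borel f] assms by (simp add: lborel_translate)

lemma integrable_lborel_translate:
  fixes f :: "'a::euclidean_space \<Rightarrow> 'b::{banach, second_countable_topology}"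
  assumes "integrable lborel f"
  shows "integrable lborel (\<lambda>x. f (x + z))"
proof -
  have "f \<in> borel_measurable borel" using assms by auto
  then show ?thesis
    using integrable_distr_eq[of "\<lambda>x. x + z" lborel borel f] assms by (simp add: lborel_translate)
qed

text \<open>The difference quotients have integral zero by translation invariance. They are bounded by the mean value
theorem and supported in a common ball, so dominated convergence gives the claim.\<close>

lemma integral_partial_deriv_eq_0:
  assumes F: "\<And>x. F differentiable at x" and D: "continuous_on UNIV (partial_deriv i F)"
    and M: "\<And>x. F x \<noteq> 0 \<Longrightarrow> norm x \<le> M"
  shows "(\<integral>x. partial_deriv i F x \<partial>lborel) = 0"
proof -
  note DM = bounded_support_partial_deriv[of F M i, OF M]
  obtain B where B: "B > 0" "\<And>x. \<bar>partial_deriv i F x\<bar> \<le> B"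
    using bounded_support_bound[OF D DM] by blast
  have cF: "continuous_on UNIV F"
    using F by (simp add: differentiable_imp_continuous_on differentiable_on_def differentiable_at_withinI)
  note iF = integrable_bounded_support[OF cF M]
  define h where "h n = 1 / real (Suc n)" for n
  have h: "0 < h n" "h n \<le> 1" for n by (auto simp: h_def)
  have h0: "h \<longlonglongrightarrow> 0" using LIMSEQ_inverse_real_of_nat by (simp add: h_def[abs_def] divide_inverse)
  define q where "q n x = (F (x + h n *\<^sub>R axis i 1) - F x) / h n" for n x
  have mF [measurable]: "F \<in> borel_measurable borel"
    using cF by (rule borel_measurable_continuous_onI)
  have "(\<lambda>n. \<integral>x. q n x \<partial>lborel) \<longlonglongrightarrow> (\<integral>x. partial_deriv i F x \<partial>lborel)"
  proof (rule integral_dominated_convergence)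
    show "integrable lborel (\<lambda>x. B * indicator (cball 0 (M + 1)) x)"
      by (intro integrable_mult_right integrable_real_indicator) (auto simp: emeasure_lborel_cball_finite[unfolded infinity_ennreal_def])
    show "AE x in lborel. (\<lambda>n. q n x) \<longlonglongrightarrow> partial_deriv i F x"
    proof (rule AE_I2)
      fix x
      have "((\<lambda>t. F (x + t *\<^sub>R axis i 1)) has_real_derivative partial_deriv i F x) (at 0)"
        using has_real_derivative_line[of F x 0 i] F by simp
      then have "((\<lambda>t. (F (x + t *\<^sub>R axis i 1) - F x) / t) \<longlongrightarrow> partial_deriv i F x) (at 0)"
        by (simp add: DERIV_def)
      moreover have "filterlim h (at 0) sequentially"
        using h0 h(1) by (auto simp: filterlim_at intro!: always_eventually) (metis less_irrefl)
      ultimately show "(\<lambda>n. q n x) \<longlonglongrightarrow> partial_deriv i F x"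
        unfolding q_def by (rule filterlim_compose)
    qed
    show "AE x in lborel. norm (q n x) \<le> B * indicator (cball 0 (M + 1)) x" for n
    proof (rule AE_I2)
      fix x
      have "\<exists>z>0. z < h n \<and> F (x + h n *\<^sub>R axis i 1) - F (x + 0 *\<^sub>R axis i 1) =
          (h n - 0) * partial_deriv i F (x + z *\<^sub>R axis i 1)"
        using h(1) has_real_derivative_line[OF F] by (intro MVT2) auto
      then obtain z where "F (x + h n *\<^sub>R axis i 1) - F x = h n * partial_deriv i F (x + z *\<^sub>R axis i 1)"
        by auto
      then have le: "\<bar>q n x\<bar> \<le> B"
        using B(2) h(1)[of n] by (simp add: q_def)
      show "norm (q n x) \<le> B * indicator (cball 0 (M + 1)) x"
      proof (cases "norm x \<le> M + 1")
        case True then show ?thesis using le by (simp add: indicator_def)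
      next
        case False
        have "norm x \<le> norm (x + h n *\<^sub>R axis i 1) + norm (h n *\<^sub>R axis i (1::real))"
          using norm_triangle_ineq4[of "x + h n *\<^sub>R axis i 1" "h n *\<^sub>R axis i 1"] by simp
        then have "M < norm (x + h n *\<^sub>R axis i 1)" "M < norm x"
          using False h(1,2)[of n] by (auto simp: norm_axis_1)
        then have "F x = 0" "F (x + h n *\<^sub>R axis i 1) = 0"
          using M by (meson not_le)+
        then show ?thesis using B(1) by (simp add: q_def)
      qed
    qed
    show "partial_deriv i F \<in> borel_measurable lborel"
      using borel_measurable_continuous_onI[OF D] by simp
    show "q n \<in> borel_measurable lborel" for n
      unfolding q_def by measurable
  qed
  moreover have "(\<integral>x. q n x \<partial>lborel) = 0" for n
    unfolding q_def
    using integral_lborel_translate[OF mF, of "h n *\<^sub>R axis i 1"]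
      integrable_lborel_translate[OF iF, of "h n *\<^sub>R axis i 1"] iF by simp
  ultimately show ?thesis
    by (simp add: LIMSEQ_const_iff)
qed

lemma integral_by_parts:
  assumes u: "\<And>x. u differentiable at x" "continuous_on UNIV (partial_deriv i u)"
    and w: "\<And>x. w differentiable at x" "continuous_on UNIV (partial_deriv i w)"
    and M: "\<And>x. w x \<noteq> 0 \<Longrightarrow> norm x \<le> M"
  shows "(\<integral>x. partial_deriv i u x * w x \<partial>lborel) = - (\<integral>x. u x * partial_deriv i w x \<partial>lborel)"
proof -
  have cont: "continuous_on UNIV u" "continuous_on UNIV w"
    using u w by (simp_all add: differentiable_imp_continuous_on differentiable_on_def differentiable_at_withinI)
  have eq: "partial_deriv i (\<lambda>x. u x * w x) = (\<lambda>x. u x * partial_deriv i w x + partial_deriv i u x * w x)"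
    by (rule ext) (rule partial_deriv_mult[OF u(1) w(1)])
  have int: "integrable lborel (\<lambda>x. u x * partial_deriv i w x)"
      "integrable lborel (\<lambda>x. partial_deriv i u x * w x)"
    using M bounded_support_partial_deriv[of w M i, OF M]
    by (auto intro!: integrable_bounded_support[of _ M] continuous_on_mult cont u w)
  have "(\<integral>x. partial_deriv i (\<lambda>x. u x * w x) x \<partial>lborel) = 0"
    by (rule integral_partial_deriv_eq_0[of _ _ M])
       (use M in \<open>auto simp: eq intro!: continuous_intros cont u w differentiable_mult\<close>)
  then show ?thesis
    unfolding eq using int by simp
qed

section \<open>A separating class of test functions\<close>

text \<open>These functions vanish to infinite order at the origin. The power is carried along so that
the family is closed under differentiation up to linear combinations.\<close>

definition flat :: "real \<Rightarrow> nat \<Rightarrow> real \<Rightarrow> real" where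
  "flat c j t = (if t > 0 then (1 / t) ^ j * exp (- c / t) else 0)"

lemma flat_tendsto_0:
  assumes "c > 0"
  shows "(flat c j \<longlongrightarrow> 0) (at 0)"
proof (rule filterlim_split_at)
  show "(flat c j \<longlongrightarrow> 0) (at_left 0)"
    by (rule tendsto_eventually) (auto simp: flat_def eventually_at_filter)
  have "((\<lambda>x. (1 / c) ^ j * ((c * inverse x) ^ j / exp (c * inverse x))) \<longlongrightarrow> (1 / c) ^ j * 0) (at_right 0)"
    by (intro tendsto_mult tendsto_const filterlim_compose[OF tendsto_power_div_exp_0]
        filterlim_tendsto_pos_mult_at_top[OF tendsto_const assms] filterlim_inverse_at_top_right)
  moreover have "\<forall>\<^sub>F x in at_right 0. (1 / c) ^ j * ((c * inverse x) ^ j / exp (c * inverse x)) = flat c j x"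
    using assms by (auto simp: eventually_at_filter flat_def field_simps exp_minus power_mult_distrib)
  ultimately show "(flat c j \<longlongrightarrow> 0) (at_right 0)"
    by (auto intro: Lim_transform_eventually)
qed

lemma flat_has_derivative:
  assumes c: "c > 0"
  shows "(flat c j has_real_derivative c * flat c (j + 2) t - j * flat c (j + 1) t) (at t)"
proof (cases t "0::real" rule: linorder_cases)
  case less
  have "((\<lambda>_. 0) has_real_derivative 0) (at t)" by simp
  then have "(flat c j has_real_derivative 0) (at t)"
    by (rule has_field_derivative_transform_within_open[of _ _ _ "{..<0}"])
       (use less in \<open>auto simp: flat_def\<close>)
  then show ?thesis using less by (simp add: flat_def)
next
  case equal
  \<comment> \<open>At the origin the difference quotient is again a member of the family, with the next power.\<close>
  have "((\<lambda>h. (flat c j (0 + h) - flat c j 0) / h) \<longlongrightarrow> 0) (at 0)"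
    by (rule Lim_transform_eventually[OF flat_tendsto_0[OF c, of "j + 1"]])
       (auto simp: eventually_at_filter flat_def)
  then show ?thesis using equal by (simp add: DERIV_def flat_def)
next
  case greater
  have "((\<lambda>t. (1 / t) ^ j * exp (- c / t)) has_real_derivative
      (1 / t) ^ j * (exp (- c / t) * (c / t\<^sup>2)) + (j * (1 / t) ^ (j - 1) * (- 1 / t\<^sup>2)) * exp (- c / t)) (at t)"
    using greater by (auto intro!: derivative_eq_intros simp: power2_eq_square)
  moreover have "(1 / t) ^ j * (exp (- c / t) * (c / t\<^sup>2)) + (j * (1 / t) ^ (j - 1) * (- 1 / t\<^sup>2)) * exp (- c / t)
      = c * flat c (j + 2) t - j * flat c (j + 1) t"
    using greater by (cases j) (auto simp: flat_def power2_eq_square field_simps)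
  ultimately have "((\<lambda>t. (1 / t) ^ j * exp (- c / t)) has_real_derivative
      c * flat c (j + 2) t - j * flat c (j + 1) t) (at t)"
    by simp
  then show ?thesis
    by (rule has_field_derivative_transform_within_open[of _ _ _ "{0<..}"])
       (use greater in \<open>auto simp: flat_def\<close>)
qed

text \<open>An explicit algebra of smooth functions. Its generators depend on one coordinate each, so that smoothness and the
symmetry of second partial derivatives follow by induction.\<close>

inductive_set elementary :: "(real^3 \<Rightarrow> real) set" where
  const: "(\<lambda>x. a) \<in> elementary"
| flat: "c > 0 \<Longrightarrow> (\<lambda>x. flat c j (s * x $ k + a)) \<in> elementary"
| add: "f \<in> elementary \<Longrightarrow> g \<in> elementary \<Longrightarrow> (\<lambda>x. f x + g x) \<in> elementary"
| mult: "f \<in> elementary \<Longrightarrow> g \<in> elementary \<Longrightarrow> (\<lambda>x. f x * g x) \<in> elementary"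

lemma flat_coordinate:
  assumes "c > 0"
  shows "(\<lambda>x. flat c j (s * x $ k + a)) differentiable at x"
    and "partial_deriv i (\<lambda>x. flat c j (s * x $ k + a)) =
      (\<lambda>x. (if i = k then s else 0) * (c * flat c (j + 2) (s * x $ k + a) + (- real j) * flat c (j + 1) (s * x $ k + a)))"
proof -
  have *: "(\<lambda>x. s * x $ k + a) differentiable at x" "partial_deriv i (\<lambda>x. s * x $ k + a) x = (if i = k then s else 0)" for x
  proof -
    have "((\<lambda>t. s * t + a) has_real_derivative s) (at (x $ k))"
      by (auto intro!: derivative_eq_intros)
    from partial_deriv_real_compose[OF this differentiable_coordinate]
    show "(\<lambda>x. s * x $ k + a) differentiable at x"
      "partial_deriv i (\<lambda>x. s * x $ k + a) x = (if i = k then s else 0)"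
      by (auto simp: partial_deriv_coordinate)
  qed
  show "(\<lambda>x. flat c j (s * x $ k + a)) differentiable at x"
    by (rule partial_deriv_real_compose(1)[OF flat_has_derivative[OF assms] *(1)])
  show "partial_deriv i (\<lambda>x. flat c j (s * x $ k + a)) =
      (\<lambda>x. (if i = k then s else 0) * (c * flat c (j + 2) (s * x $ k + a) + (- real j) * flat c (j + 1) (s * x $ k + a)))"
    by (rule ext) (subst partial_deriv_real_compose(2)[OF flat_has_derivative[OF assms] *(1)], simp add: *(2))
qed

lemma elementary_differentiable: "f \<in> elementary \<Longrightarrow> f differentiable at x"
  by (induction rule: elementary.induct) (auto intro: flat_coordinate)

lemma partial_deriv_elementary_add:
  "f \<in> elementary \<Longrightarrow> g \<in> elementary \<Longrightarrow>
    partial_deriv i (\<lambda>x. f x + g x) = (\<lambda>x. partial_deriv i f x + partial_deriv i g x)"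
  by (rule ext) (simp add: partial_deriv_add elementary_differentiable)

lemma partial_deriv_elementary_mult:
  "f \<in> elementary \<Longrightarrow> g \<in> elementary \<Longrightarrow>
    partial_deriv i (\<lambda>x. f x * g x) = (\<lambda>x. f x * partial_deriv i g x + partial_deriv i f x * g x)"
  by (rule ext) (simp add: partial_deriv_mult elementary_differentiable)

lemma elementary_partial_deriv: "f \<in> elementary \<Longrightarrow> partial_deriv i f \<in> elementary"
proof (induction rule: elementary.induct)
  case (flat c j s k a)
  then show ?case
    unfolding flat_coordinate(2)[OF flat] by (intro elementary.intros)
qed (auto simp: partial_deriv_elementary_add partial_deriv_elementary_mult intro: elementary.intros)

lemma elementary_partial_deriv_commute:
  "f \<in> elementary \<Longrightarrow> partial_deriv i (partial_deriv j f) = partial_deriv j (partial_deriv i f)"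
proof (induction rule: elementary.induct)
  case (flat c m s k a)
  have 0: "partial_deriv i (\<lambda>x. h (x $ k)) = (\<lambda>x. 0)" if "i \<noteq> k" "(\<lambda>x. h (x $ k)) \<in> elementary" for i h
  proof
    fix x
    have "((\<lambda>t. h (x $ k)) has_real_derivative partial_deriv i (\<lambda>x. h (x $ k)) x) (at 0)"
      using has_real_derivative_line[of "\<lambda>x. h (x $ k)" x 0 i] that
      by (simp add: elementary_differentiable axis_def)
    then show "partial_deriv i (\<lambda>x. h (x $ k)) x = 0"
      using DERIV_const DERIV_unique by blast
  qed
  note el = elementary.flat[OF flat, of m s k a]
  consider "i = j" | "i \<noteq> k" "j = k" | "j \<noteq> k" "i = k" | "i \<noteq> k" "j \<noteq> k" by blast
  then show ?case
  proof cases
    case 2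
    then show ?thesis
      using 0[of i "\<lambda>t. flat c m (s * t + a)"] elementary_partial_deriv[OF el, of j]
        0[of i "\<lambda>t. s * (c * flat c (m + 2) (s * t + a) + (- real m) * flat c (m + 1) (s * t + a))"] el
      by (simp add: flat_coordinate(2)[OF flat])
  next
    case 3
    then show ?thesis
      using 0[of j "\<lambda>t. flat c m (s * t + a)"] elementary_partial_deriv[OF el, of i]
        0[of j "\<lambda>t. s * (c * flat c (m + 2) (s * t + a) + (- real m) * flat c (m + 1) (s * t + a))"] el
      by (simp add: flat_coordinate(2)[OF flat])
  next
    case 4
    then show ?thesis
      using 0[of j "\<lambda>t. flat c m (s * t + a)"] 0[of i "\<lambda>t. flat c m (s * t + a)"] el by simp
  qed simp
next
  case (add f g)
  then show ?case
    by (simp add: partial_deriv_elementary_add elementary_partial_deriv)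
next
  case (mult f g)
  then show ?case
    by (simp add: partial_deriv_elementary_add partial_deriv_elementary_mult elementary_partial_deriv
        elementary.intros fun_eq_iff algebra_simps)
qed simp

lemma elementary_continuously_differentiable:
  "f \<in> elementary \<Longrightarrow> continuously_differentiable k f"
proof (induction k arbitrary: f)
  case 0
  then show ?case
    by (simp add: elementary_differentiable differentiable_imp_continuous_on differentiable_on_def
        differentiable_at_withinI)
qed (auto simp: elementary_differentiable elementary_partial_deriv)

lemma test_function_elementary:
  assumes "f \<in> elementary" "bounded {x. f x \<noteq> 0}"
  shows "test_function f"
  using assms by (simp add: test_function_def elementary_continuously_differentiable compact_closure)

lemma elementary_prod: "finite A \<Longrightarrow> (\<And>i. i \<in> A \<Longrightarrow> f i \<in> elementary) \<Longrightarrow> (\<lambda>x. \<Prod>i\<in>A. f i x) \<in> elementary"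
  by (induction rule: finite_induct) (auto intro: elementary.intros)

lemma elementary_continuous: "f \<in> elementary \<Longrightarrow> continuous_on A f"
  by (simp add: elementary_differentiable differentiable_imp_continuous_on differentiable_on_def
        differentiable_at_withinI)

text \<open>The parameter \<open>c\<close> of \<open>flat\<close> tends to zero as \<open>n\<close> grows. The exponentials then tend to \<open>1\<close> inside the box, so that
these functions converge boundedly to its indicator.\<close>

definition box_bump :: "real^3 \<Rightarrow> real^3 \<Rightarrow> nat \<Rightarrow> real^3 \<Rightarrow> real" where
  "box_bump a b n x = (\<Prod>i\<in>UNIV. flat (1 / Suc n) 0 (1 * x $ i + (- a $ i)) * flat (1 / Suc n) 0 ((- 1) * x $ i + b $ i))"

lemma box_bump_elementary: "box_bump a b n \<in> elementary"
  unfolding box_bump_def[abs_def]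
  by (intro elementary_prod elementary.mult elementary.flat) auto

lemma box_bump_eq_0: "x \<notin> box a b \<Longrightarrow> box_bump a b n x = 0"
  by (auto simp: box_bump_def mem_box_cart flat_def)

lemma box_bump_bounds: "0 \<le> box_bump a b n x" "box_bump a b n x \<le> 1"
  unfolding box_bump_def
  by (auto intro!: prod_nonneg prod_le_1 mult_le_one simp: flat_def)

lemma box_bump_tendsto: "(\<lambda>n. box_bump a b n x) \<longlonglongrightarrow> indicator (box a b) x"
proof (cases "x \<in> box a b")
  case True
  have flat1: "(\<lambda>n. flat (1 / Suc n) 0 t) \<longlonglongrightarrow> 1" if "t > 0" for t
  proof -
    have "(\<lambda>n. exp (- (1 / real (Suc n)) / t)) \<longlonglongrightarrow> exp (- 0 / t)"
      using LIMSEQ_inverse_real_of_nat that by (intro tendsto_intros) (auto simp: divide_inverse)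
    then show ?thesis using that by (simp add: flat_def)
  qed
  have "(\<lambda>n. box_bump a b n x) \<longlonglongrightarrow> (\<Prod>i\<in>(UNIV::3 set). 1 * 1)"
    unfolding box_bump_def using True
    by (intro tendsto_prod tendsto_mult flat1) (auto simp: mem_box_cart)
  then show ?thesis using True by simp
qed (simp add: box_bump_eq_0)

text \<open>The positive and negative parts are densities of two measures that agree on boxes, a generator that is stable under
intersection; hence the measures, and then the densities, coincide.\<close>

lemma AE_eq_0_of_box_integrals:
  fixes g :: "'a::euclidean_space \<Rightarrow> real"
  assumes g [measurable]: "g \<in> borel_measurable borel"
    and int: "\<And>a b. integrable lborel (\<lambda>x. indicator (box a b) x * g x)"
    and zero: "\<And>a b. (\<integral>x. indicator (box a b) x * g x \<partial>lborel) = 0"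
  shows "AE x in lborel. g x = 0"
proof -
  define p where "p x = ennreal (g x)" for x
  define q where "q x = ennreal (- g x)" for x
  have [measurable]: "p \<in> borel_measurable borel" "q \<in> borel_measurable borel"
    unfolding p_def q_def by measurable
  have fin: "emeasure (density lborel p) (box a b) = emeasure (density lborel q) (box a b)"
      "emeasure (density lborel p) (box a b) \<noteq> \<infinity>" for a b
  proof -
    let ?f = "\<lambda>x. indicator (box a b) x * g x"
    have eq: "emeasure (density lborel p) (box a b) = (\<integral>\<^sup>+x. ennreal (?f x) \<partial>lborel)"
      "emeasure (density lborel q) (box a b) = (\<integral>\<^sup>+x. ennreal (- ?f x) \<partial>lborel)"
      by (auto simp: emeasure_density p_def q_def indicator_def intro!: nn_integral_cong)
    from integrableD[OF int[of a b]]
    have fin: "(\<integral>\<^sup>+x. ennreal (?f x) \<partial>lborel) \<noteq> \<infinity>" "(\<integral>\<^sup>+x. ennreal (- ?f x) \<partial>lborel) \<noteq> \<infinity>"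
      by simp_all
    have "enn2real (\<integral>\<^sup>+x. ennreal (?f x) \<partial>lborel) = enn2real (\<integral>\<^sup>+x. ennreal (- ?f x) \<partial>lborel)"
      using real_lebesgue_integral_def[OF int[of a b]] zero[of a b] by simp
    then have "ennreal (enn2real (\<integral>\<^sup>+x. ennreal (?f x) \<partial>lborel)) = ennreal (enn2real (\<integral>\<^sup>+x. ennreal (- ?f x) \<partial>lborel))"
      by (rule arg_cong)
    then show "emeasure (density lborel p) (box a b) = emeasure (density lborel q) (box a b)"
      unfolding eq using fin by (simp only: infinity_ennreal_def top.not_eq_extremum ennreal_enn2real)
    show "emeasure (density lborel p) (box a b) \<noteq> \<infinity>"
      unfolding eq by (rule fin)
  qed
  have "density lborel p = density lborel q"
  proof (rule measure_eqI_generator_eq)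
    let ?E = "range (\<lambda>(a, b). box a b::'a set)"
    show "Int_stable ?E"
      by (auto simp: Int_stable_def box_Int_box)
    show "?E \<subseteq> Pow UNIV" "sets (density lborel p) = sigma_sets UNIV ?E"
      "sets (density lborel q) = sigma_sets UNIV ?E"
      by (simp_all add: borel_eq_box)
    let ?A = "\<lambda>n::nat. box (- (real n *\<^sub>R One)) (real n *\<^sub>R One) :: 'a set"
    show "range ?A \<subseteq> ?E" "(\<Union>i. ?A i) = UNIV"
      unfolding UN_box_eq_UNIV by auto
    show "emeasure (density lborel p) (?A i) \<noteq> \<infinity>" for i by (rule fin)
    show "emeasure (density lborel p) X = emeasure (density lborel q) X" if "X \<in> ?E" for X
      using that fin by auto
  qed
  then have "AE x in lborel. p x = q x"
    by (intro sigma_finite_measure.density_unique[OF sigma_finite_lborel]) auto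
  then show ?thesis
  proof eventually_elim
    case (elim x)
    then show ?case
      by (cases "g x \<ge> 0") (auto simp: p_def q_def ennreal_neg ennreal_eq_0_iff dest: sym)
  qed
qed

section \<open>Radial integrals in three dimensions\<close>

text \<open>Integration in polar coordinates of radial functions: both measures give the half line up to \<open>a\<close> the
volume of the ball of radius \<open>a\<close>.\<close>

lemma distr_norm_lborel:
  "distr lborel borel (norm :: real^3 \<Rightarrow> real) = density lborel (\<lambda>r. ennreal (4 * pi * r\<^sup>2) * indicator {0..} r)"
  (is "?M = ?N")
proof (rule measure_eqI_generator_eq)
  have N: "emeasure ?N {..a} = (if a \<ge> 0 then ennreal (4 / 3 * pi * a ^ 3) else 0)" for a
  proof (cases "a \<ge> 0")
    case True
    have "emeasure ?N {..a} = (\<integral>\<^sup>+r. ennreal (4 * pi * r\<^sup>2) * indicator {0..a} r \<partial>lborel)"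
      by (auto simp: emeasure_density indicator_def intro!: nn_integral_cong)
    also have "\<dots> = ennreal (4 / 3 * pi * a ^ 3 - 4 / 3 * pi * 0 ^ 3)"
      using True by (intro nn_integral_FTC_Icc) (auto intro!: derivative_eq_intros simp: has_real_derivative_iff_has_vector_derivative[symmetric])
    finally show ?thesis using True by simp
  next
    case False
    then have "emeasure ?N {..a} = (\<integral>\<^sup>+r. 0 \<partial>(lborel :: real measure))"
      by (subst emeasure_density, simp, simp, intro nn_integral_cong) (auto simp: indicator_def)
    then show ?thesis using False by simp
  qed
  have M: "emeasure ?M {..a} = (if a \<ge> 0 then ennreal (4 / 3 * pi * a ^ 3) else 0)" for a
  proof -
    have "emeasure ?M {..a} = emeasure lborel (cball 0 a :: (real^3) set)"
      by (subst emeasure_distr) (auto intro!: arg_cong2[where f=emeasure] simp: dist_norm)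
    then show ?thesis by (auto simp: emeasure_cball unit_ball_vol_3)
  qed
  show "Int_stable (range (\<lambda>a::real. {..a}))"
    by (auto simp: Int_stable_def)
  show "range (\<lambda>a::real. {..a}) \<subseteq> Pow UNIV"
    "sets ?M = sigma_sets UNIV (range (\<lambda>a::real. {..a}))"
    "sets ?N = sigma_sets UNIV (range (\<lambda>a::real. {..a}))"
    by (simp_all add: borel_eq_atMost)
  show "emeasure ?M X = emeasure ?N X" if "X \<in> range (\<lambda>a::real. {..a})" for X
    using that M N by auto
  show "range (\<lambda>n. {..real n}) \<subseteq> range (\<lambda>a::real. {..a})" by auto
  show "(\<Union>n. {..real n}) = UNIV" by (auto intro: real_arch_simple)
  show "emeasure ?M {..real n} \<noteq> \<infinity>" for n by (simp add: M)
qed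

lemma nn_integral_radial:
  assumes [measurable]: "f \<in> borel_measurable borel"
  shows "(\<integral>\<^sup>+x. f (norm (x :: real^3)) \<partial>lborel) =
    (\<integral>\<^sup>+r. ennreal (4 * pi * r\<^sup>2) * indicator {0..} r * f r \<partial>lborel)"
proof -
  have "(\<integral>\<^sup>+x. f (norm (x :: real^3)) \<partial>lborel) = (\<integral>\<^sup>+r. f r \<partial>distr lborel borel (norm :: real^3 \<Rightarrow> real))"
    by (subst nn_integral_distr) auto
  also have "\<dots> = (\<integral>\<^sup>+r. ennreal (4 * pi * r\<^sup>2) * indicator {0..} r * f r \<partial>lborel)"
    unfolding distr_norm_lborel by (subst nn_integral_density) auto
  finally show ?thesis .
qed

lemma nn_integral_radial_FTC:
  fixes f :: "real \<Rightarrow> real"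
  assumes [measurable]: "f \<in> borel_measurable borel" and "g \<in> borel_measurable borel"
    and "\<And>r. r \<ge> 0 \<Longrightarrow> f r \<ge> 0"
    and "\<And>r. r > 0 \<Longrightarrow> 4 * pi * r\<^sup>2 * f r = g r"
    and "\<And>r. r \<ge> 0 \<Longrightarrow> g r \<ge> 0"
    and "\<And>r. r \<ge> 0 \<Longrightarrow> (F has_real_derivative g r) (at r)"
    and "(F \<longlongrightarrow> L) at_top"
  shows "(\<integral>\<^sup>+x. ennreal (f (norm (x :: real^3))) \<partial>lborel) = ennreal (L - F 0)"
proof -
  have "AE r in lborel. ennreal (4 * pi * r\<^sup>2) * indicator {0..} r * ennreal (f r) = ennreal (g r) * indicator {0..} r"
    using AE_lborel_singleton[of 0]
    by eventually_elim (auto simp: indicator_def ennreal_mult[symmetric] assms)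
  then have "(\<integral>\<^sup>+x. ennreal (f (norm (x :: real^3))) \<partial>lborel) = (\<integral>\<^sup>+r. ennreal (g r) * indicator {0..} r \<partial>lborel)"
    by (subst nn_integral_radial) (auto intro!: nn_integral_cong_AE)
  also have "\<dots> = ennreal (L - F 0)"
    by (rule nn_integral_FTC_atLeast) (use assms in auto)
  finally show ?thesis .
qed

text \<open>The fundamental solution of \<open>1 - \<Delta>\<close>. Division by zero makes it vanish at the origin, which is a
null set.\<close>

definition yukawa :: "real^3 \<Rightarrow> real" where
  "yukawa x = exp (- norm x) / (4 * pi * norm x)"

lemma yukawa_measurable [measurable]: "yukawa \<in> borel_measurable borel"
  unfolding yukawa_def[abs_def] by measurable

lemma yukawa_nonneg: "yukawa x \<ge> 0"
  by (simp add: yukawa_def)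

lemma yukawa_minus [simp]: "yukawa (- x) = yukawa x"
  by (simp add: yukawa_def)

lemma nn_integral_yukawa: "(\<integral>\<^sup>+x. ennreal (yukawa x) \<partial>lborel) = 1"
proof -
  have "((\<lambda>r::real. - (r + 1) * exp (- r)) \<longlongrightarrow> 0) at_top" by real_asymp
  then show ?thesis unfolding yukawa_def
    by (subst nn_integral_radial_FTC[where f="\<lambda>r. exp (- r) / (4 * pi * r)" and g="\<lambda>r. r * exp (- r)" and
        F="\<lambda>r. - (r + 1) * exp (- r)" and L=0])
      (auto intro!: derivative_eq_intros simp: power2_eq_square algebra_simps)
qed

lemma nn_integral_yukawa_square: "(\<integral>\<^sup>+x. ennreal ((yukawa x)\<^sup>2) \<partial>lborel) = ennreal (1 / (8 * pi))"
proof -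
  have "((\<lambda>r::real. - exp (- 2 * r) / (8 * pi)) \<longlongrightarrow> 0) at_top" by real_asymp
  then show ?thesis unfolding yukawa_def
    by (subst nn_integral_radial_FTC[where f="\<lambda>r. (exp (- r) / (4 * pi * r))\<^sup>2" and g="\<lambda>r. exp (- 2 * r) / (4 * pi)" and
        F="\<lambda>r. - exp (- 2 * r) / (8 * pi)" and L=0])
      (auto intro!: derivative_eq_intros simp: power2_eq_square field_simps simp flip: exp_add)
qed

lemma nn_integral_exp_square: "(\<integral>\<^sup>+x. ennreal ((exp (- norm (x :: real^3)))\<^sup>2) \<partial>lborel) = ennreal pi"
proof -
  have "((\<lambda>r::real. - (4 * pi) * (r\<^sup>2 / 2 + r / 2 + 1 / 4) * exp (- 2 * r)) \<longlongrightarrow> 0) at_top" by real_asymp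
  then show ?thesis
    by (subst nn_integral_radial_FTC[where f="\<lambda>r. (exp (- r))\<^sup>2" and g="\<lambda>r. 4 * pi * r\<^sup>2 * exp (- 2 * r)" and
        F="\<lambda>r. - (4 * pi) * (r\<^sup>2 / 2 + r / 2 + 1 / 4) * exp (- 2 * r)" and L=0])
      (auto intro!: derivative_eq_intros simp: power2_eq_square field_simps simp flip: exp_add)
qed

text \<open>The profile of the approximate identity that arises from the smoothed Yukawa kernel; its total mass fixes the
constant in the fundamental solution. The primitive of \<open>3 r\<^sup>2 (1 + r\<^sup>2)\<^bsup>-5/2\<^esup>\<close> is \<open>r\<^sup>3 (1 + r\<^sup>2)\<^bsup>-3/2\<^esup>\<close>.\<close>

lemma nn_integral_soft_profile:
  "(\<integral>\<^sup>+x. ennreal (3 / (4 * pi * sqrt (1 + (norm (x :: real^3))\<^sup>2) ^ 5)) \<partial>lborel) = 1"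
proof -
  have lim: "((\<lambda>r::real. r ^ 3 / sqrt (1 + r\<^sup>2) ^ 3) \<longlongrightarrow> 1) at_top" by real_asymp
  have der: "((\<lambda>r::real. r ^ 3 / sqrt (1 + r\<^sup>2) ^ 3) has_real_derivative 3 * r\<^sup>2 / sqrt (1 + r\<^sup>2) ^ 5) (at r)" for r
  proof -
    define s where "s = sqrt (1 + r\<^sup>2)"
    have pos: "1 + r\<^sup>2 > 0" by (simp add: add_pos_nonneg)
    then have s: "s > 0" "s * s = 1 + r\<^sup>2" unfolding s_def by auto
    have "((\<lambda>r::real. r ^ 3 / sqrt (1 + r\<^sup>2) ^ 3) has_real_derivative
        (3 * r\<^sup>2 * s ^ 3 - r ^ 3 * (3 * s\<^sup>2 * (r / s))) / (s ^ 3 * s ^ 3)) (at r)"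
      unfolding s_def using pos
      by (auto intro!: derivative_eq_intros simp: field_simps)
    also have "(3 * r\<^sup>2 * s ^ 3 - r ^ 3 * (3 * s\<^sup>2 * (r / s))) / (s ^ 3 * s ^ 3) = 3 * r\<^sup>2 * (s * s - r\<^sup>2) / s ^ 5"
      using s(1) by (simp add: field_simps eval_nat_numeral)
    finally show ?thesis using s by (simp add: s_def)
  qed
  show ?thesis
    by (subst nn_integral_radial_FTC[where f="\<lambda>r. 3 / (4 * pi * sqrt (1 + r\<^sup>2) ^ 5)" and
        g="\<lambda>r. 3 * r\<^sup>2 / sqrt (1 + r\<^sup>2) ^ 5" and F="\<lambda>r. r ^ 3 / sqrt (1 + r\<^sup>2) ^ 3" and L=1])
      (use lim der in \<open>auto simp: field_simps\<close>)
qed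

lemma nn_integral_finite_integrable:
  fixes f :: "'a \<Rightarrow> real"
  assumes "f \<in> borel_measurable M" "\<And>x. f x \<ge> 0" "(\<integral>\<^sup>+x. ennreal (f x) \<partial>M) = ennreal c" "c \<ge> 0"
  shows "integrable M f" "integral\<^sup>L M f = c"
proof -
  show "integrable M f" using assms by (intro integrableI_nonneg) auto
  then show "integral\<^sup>L M f = c"
    using assms by (subst integral_eq_nn_integral) auto
qed

lemma integrable_yukawa: "integrable lborel yukawa"
  and integral_yukawa: "(\<integral>x. yukawa x \<partial>lborel) = 1"
  using nn_integral_finite_integrable[of yukawa lborel 1] yukawa_nonneg nn_integral_yukawa
  by auto

lemma integrable_yukawa_square: "integrable lborel (\<lambda>x. (yukawa x)\<^sup>2)"
  using nn_integral_finite_integrable(1)[of "\<lambda>x. (yukawa x)\<^sup>2" lborel] nn_integral_yukawa_square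
  by auto

lemma integrable_exp_square: "integrable lborel (\<lambda>x::real^3. (exp (- norm x))\<^sup>2)"
  using nn_integral_finite_integrable(1)[of "\<lambda>x::real^3. (exp (- norm x))\<^sup>2" lborel pi] nn_integral_exp_square
  by auto

lemma soft_profile:
  "integrable lborel (\<lambda>x::real^3. 3 / (4 * pi * sqrt (1 + (norm x)\<^sup>2) ^ 5))"
  "(\<integral>x. 3 / (4 * pi * sqrt (1 + (norm (x::real^3))\<^sup>2) ^ 5) \<partial>lborel) = 1"
  using nn_integral_finite_integrable[of "\<lambda>x::real^3. 3 / (4 * pi * sqrt (1 + (norm x)\<^sup>2) ^ 5)" lborel 1]
    nn_integral_soft_profile by auto

section \<open>Computing with square integrable classes\<close>

lemma abs_rep_L2 [simp]: "abs_L2 (rep_L2 f) = f"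
  using Quotient3_L2 by (rule Quotient3_abs_rep)

lemma rep_L2_measurable [measurable]: "rep_L2 f \<in> borel_measurable borel"
  using square_integrable_rep[of f] by (simp add: square_integrable_def)

lemma L2_eqI: "AE x in lborel. rep_L2 f x = rep_L2 g x \<Longrightarrow> f = g"
  using abs_L2_eq_iff[OF square_integrable_rep square_integrable_rep, of f g] by simp

lemma L2_rel_refl: "square_integrable f \<Longrightarrow> L2_rel f f"
  by (simp add: L2_rel_def)

lemma abs_L2_add: "square_integrable F \<Longrightarrow> square_integrable G \<Longrightarrow> abs_L2 F + abs_L2 G = abs_L2 (\<lambda>x. F x + G x)"
  by (rule plus_L2.abs_eq) (auto intro: L2_rel_refl)

lemma abs_L2_scaleR: "square_integrable F \<Longrightarrow> r *\<^sub>R abs_L2 F = abs_L2 (\<lambda>x. r *\<^sub>R F x)"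
  by (rule scaleR_L2.abs_eq) (auto intro: L2_rel_refl)

lemma abs_L2_scaleC: "square_integrable F \<Longrightarrow> c *\<^sub>C abs_L2 F = abs_L2 (\<lambda>x. c *\<^sub>C F x)"
  by (rule scaleC_L2.abs_eq) (auto intro: L2_rel_refl)

lemma AE_rep_L2_add: "AE x in lborel. rep_L2 (f + g) x = rep_L2 f x + rep_L2 g x"
  using AE_rep_abs_L2[OF square_integrable_add[OF square_integrable_rep square_integrable_rep], of f g]
    abs_L2_add[OF square_integrable_rep square_integrable_rep, of f g] by simp

lemma AE_rep_L2_scaleC: "AE x in lborel. rep_L2 (c *\<^sub>C f) x = c *\<^sub>C rep_L2 f x"
  using AE_rep_abs_L2[OF square_integrable_scaleC[OF square_integrable_rep], of c f]
    abs_L2_scaleC[OF square_integrable_rep, of c f] by simp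

lemma inner_L2_abs:
  assumes "square_integrable F" "square_integrable G"
  shows "inner (abs_L2 F) (abs_L2 G) = (\<integral>x. inner (F x) (G x) \<partial>lborel)"
proof -
  have "inner (abs_L2 F) (abs_L2 G) = Re (\<integral>x. cinner (F x) (G x) \<partial>lborel)"
    using cinner_L2.abs_eq[OF L2_rel_refl[OF assms(1)] L2_rel_refl[OF assms(2)]]
    by (simp add: inner_eq_Re_cinner)
  also have "\<dots> = (\<integral>x. inner (F x) (G x) \<partial>lborel)"
    by (subst integral_Re[symmetric]) (auto simp: integrable_cinner assms Re_cinner_vec)
  finally show ?thesis .
qed

lemma inner_L2_rep: "inner f g = (\<integral>x. inner (rep_L2 f x) (rep_L2 g x) \<partial>lborel)"
  using inner_L2_abs[OF square_integrable_rep square_integrable_rep, of f g] by simp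

definition sq_int :: "(real^3 \<Rightarrow> real) \<Rightarrow> bool" where
  "sq_int \<phi> \<longleftrightarrow> \<phi> \<in> borel_measurable borel \<and> integrable lborel (\<lambda>x. (\<phi> x)\<^sup>2)"

text \<open>Scalar functions with a constant vector coefficient. Testing against \<open>tensor \<phi> c\<close> for all \<open>c\<close> replaces vector valued
integrals by inner products.\<close>

definition tensor :: "(real^3 \<Rightarrow> real) \<Rightarrow> complex^'n \<Rightarrow> 'n::finite L2" where
  "tensor \<phi> c = abs_L2 (\<lambda>x. \<phi> x *\<^sub>R c)"

lemma square_integrable_tensor:
  assumes "sq_int \<phi>"
  shows "square_integrable (\<lambda>x. \<phi> x *\<^sub>R (c :: complex^'n))"
proof -
  have [measurable]: "\<phi> \<in> borel_measurable borel" using assms by (simp add: sq_int_def)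
  show ?thesis
    using assms unfolding square_integrable_def by (auto simp: power_mult_distrib sq_int_def)
qed

lemma AE_rep_tensor: "sq_int \<phi> \<Longrightarrow> AE x in lborel. rep_L2 (tensor \<phi> c) x = \<phi> x *\<^sub>R c"
  unfolding tensor_def by (intro AE_rep_abs_L2 square_integrable_tensor)

lemma tensor_add_right: "sq_int \<phi> \<Longrightarrow> tensor \<phi> (c + d) = tensor \<phi> c + tensor \<phi> d"
  by (simp add: tensor_def abs_L2_add square_integrable_tensor scaleR_add_right)

lemma scaleC_scaleR_commute: "c *\<^sub>C r *\<^sub>R (v :: 'a::complex_inner) = r *\<^sub>R c *\<^sub>C v"
  by (simp add: scaleC_of_real[symmetric] scaleC_scaleC mult.commute)

lemma tensor_scaleC_right: "sq_int \<phi> \<Longrightarrow> tensor \<phi> (z *\<^sub>C c) = z *\<^sub>C tensor \<phi> c"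
  by (simp add: tensor_def abs_L2_scaleC square_integrable_tensor scaleC_scaleR_commute)

lemma tensor_scaleR_left: "sq_int \<phi> \<Longrightarrow> tensor (\<lambda>x. r * \<phi> x) c = r *\<^sub>R tensor \<phi> c"
  by (simp add: tensor_def abs_L2_scaleR square_integrable_tensor)

lemma sq_int_add: "sq_int \<phi> \<Longrightarrow> sq_int \<psi> \<Longrightarrow> sq_int (\<lambda>x. \<phi> x + \<psi> x)"
proof -
  assume *: "sq_int \<phi>" "sq_int \<psi>"
  then have [measurable]: "\<phi> \<in> borel_measurable borel" "\<psi> \<in> borel_measurable borel"
    by (auto simp: sq_int_def)
  have "integrable lborel (\<lambda>x. (\<phi> x + \<psi> x)\<^sup>2)"
  proof (rule Bochner_Integration.integrable_bound)
    show "integrable lborel (\<lambda>x. 2 * (\<phi> x)\<^sup>2 + 2 * (\<psi> x)\<^sup>2)"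
      using * by (auto simp: sq_int_def)
    have "(\<phi> x + \<psi> x)\<^sup>2 \<le> 2 * (\<phi> x)\<^sup>2 + 2 * (\<psi> x)\<^sup>2" for x
      using sum_squares_bound[of "\<phi> x" "\<psi> x"] by (simp add: power2_sum)
    then show "AE x in lborel. norm ((\<phi> x + \<psi> x)\<^sup>2) \<le> norm (2 * (\<phi> x)\<^sup>2 + 2 * (\<psi> x)\<^sup>2)"
      by (intro AE_I2) simp
  qed measurable
  then show ?thesis by (simp add: sq_int_def)
qed

lemma sq_int_scale: "sq_int \<phi> \<Longrightarrow> sq_int (\<lambda>x. r * \<phi> x)"
  by (auto simp: sq_int_def power_mult_distrib)

lemma tensor_add_left: "sq_int \<phi> \<Longrightarrow> sq_int \<psi> \<Longrightarrow> tensor (\<lambda>x. \<phi> x + \<psi> x) c = tensor \<phi> c + tensor \<psi> c"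
  by (simp add: tensor_def abs_L2_add square_integrable_tensor scaleR_add_left)

lemma sq_int_translate: "sq_int \<phi> \<Longrightarrow> sq_int (\<lambda>x. \<phi> (x + z))"
  using integrable_lborel_translate[of "\<lambda>x. (\<phi> x)\<^sup>2" z] by (auto simp: sq_int_def)

lemma integrable_scaleR_L2:
  assumes "sq_int \<phi>" "square_integrable F"
  shows "integrable lborel (\<lambda>x. \<phi> x *\<^sub>R F x)"
proof (rule Bochner_Integration.integrable_bound)
  have [measurable]: "\<phi> \<in> borel_measurable borel" "F \<in> borel_measurable borel"
    using assms by (auto simp: sq_int_def square_integrable_def)
  show "integrable lborel (\<lambda>x. (\<phi> x)\<^sup>2 + (norm (F x))\<^sup>2)"
    using assms by (auto simp: sq_int_def square_integrable_def)
  show "(\<lambda>x. \<phi> x *\<^sub>R F x) \<in> borel_measurable lborel" by measurable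
  have "2 * (\<bar>\<phi> x\<bar> * norm (F x)) \<le> (\<phi> x)\<^sup>2 + (norm (F x))\<^sup>2" for x
    using sum_squares_bound[of "\<bar>\<phi> x\<bar>" "norm (F x)"] by simp
  moreover have "0 \<le> \<bar>\<phi> x\<bar> * norm (F x)" for x by simp
  ultimately show "AE x in lborel. norm (\<phi> x *\<^sub>R F x) \<le> norm ((\<phi> x)\<^sup>2 + (norm (F x))\<^sup>2)"
    by (intro AE_I2) (smt (verit) norm_scaleR real_norm_def zero_le_power2)
qed

lemma inner_tensor:
  assumes "sq_int \<phi>"
  shows "inner (tensor \<phi> c) f = inner c (\<integral>x. \<phi> x *\<^sub>R rep_L2 f x \<partial>lborel)"
proof -
  have "inner (tensor \<phi> c) f = (\<integral>x. inner (\<phi> x *\<^sub>R c) (rep_L2 f x) \<partial>lborel)"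
    using inner_L2_abs[OF square_integrable_tensor[OF assms] square_integrable_rep, of c f]
    by (simp add: tensor_def)
  also have "\<dots> = (\<integral>x. inner c (\<phi> x *\<^sub>R rep_L2 f x) \<partial>lborel)" by simp
  also have "\<dots> = inner c (\<integral>x. \<phi> x *\<^sub>R rep_L2 f x \<partial>lborel)"
    by (intro integral_inner_right impI integrable_scaleR_L2 assms square_integrable_rep)
  finally show ?thesis .
qed

lemma cinner_tensor:
  assumes "sq_int \<phi>"
  shows "cinner f (tensor \<phi> c) = cinner (\<integral>x. \<phi> x *\<^sub>R rep_L2 f x \<partial>lborel) c"
  unfolding cinner_eq_inner tensor_scaleC_right[OF assms, symmetric]
  by (simp only: inner_commute[of f] inner_tensor[OF assms] inner_commute[of "integral\<^sup>L _ _"])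

section \<open>Weak derivatives\<close>

lemma test_function_facts:
  assumes "test_function \<phi>"
  shows test_function_differentiable: "\<phi> differentiable at x"
    and test_function_partial_deriv: "test_function (partial_deriv i \<phi>)"
    and test_function_continuous: "continuous_on A \<phi>"
    and test_function_support: "\<exists>M. \<forall>x. \<phi> x \<noteq> 0 \<longrightarrow> norm x \<le> M"
proof -
  have cd: "continuously_differentiable k \<phi>" for k
    using assms by (simp add: test_function_def)
  show d: "\<phi> differentiable at x" for x
    using cd[of "Suc 0"] by simp
  show "continuous_on A \<phi>"
    using cd[of 0] continuous_on_subset by auto
  have "bounded {x. \<phi> x \<noteq> 0}"
    using assms bounded_subset[OF compact_imp_bounded closure_subset] by (auto simp: test_function_def)
  then obtain M where M: "\<And>x. \<phi> x \<noteq> 0 \<Longrightarrow> norm x \<le> M"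
    by (auto simp: bounded_iff)
  then show "\<exists>M. \<forall>x. \<phi> x \<noteq> 0 \<longrightarrow> norm x \<le> M" by blast
  have "bounded {x. partial_deriv i \<phi> x \<noteq> 0}"
    unfolding bounded_iff using bounded_support_partial_deriv[of \<phi> M i, OF M] by blast
  moreover have "continuously_differentiable k (partial_deriv i \<phi>)" for k
    using cd[of "Suc k"] by simp
  ultimately show "test_function (partial_deriv i \<phi>)"
    by (simp add: test_function_def compact_closure)
qed

lemma sq_int_test_function:
  assumes "test_function \<phi>"
  shows "sq_int \<phi>"
proof -
  obtain M where "\<And>x. \<phi> x \<noteq> 0 \<Longrightarrow> norm x \<le> M"
    using test_function_support[OF assms] by blast
  then have "integrable lborel (\<lambda>x. (\<phi> x)\<^sup>2)"
    by (intro integrable_bounded_support[of _ M] continuous_intros test_function_continuous assms) auto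
  then show ?thesis
    using borel_measurable_continuous_onI[OF test_function_continuous[OF assms]] by (simp add: sq_int_def)
qed

lemma test_function_translate:
  assumes "test_function \<phi>"
  shows "test_function (\<lambda>x. \<phi> (x + z))"
proof -
  have "continuously_differentiable k (\<lambda>x. \<psi> (x + z))" if "continuously_differentiable k \<psi>" for k \<psi>
    using that
  proof (induction k arbitrary: \<psi>)
    case 0
    then show ?case
      by (auto intro!: continuous_on_compose2[of UNIV \<psi> UNIV "\<lambda>x. x + z"] continuous_intros)
  next
    case (Suc k)
    have "(\<lambda>x. \<psi> (x + z)) differentiable at x" for x
    proof -
      have "\<psi> differentiable (at (x + z))" using Suc.prems by simp
      then show ?thesis
        using differentiable_chain_at[of "\<lambda>x. x + z" x \<psi>] by (simp add: o_def)
    qed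
    then show ?case using Suc by (simp add: partial_deriv_translate)
  qed
  moreover obtain M where M: "\<And>x. \<phi> x \<noteq> 0 \<Longrightarrow> norm x \<le> M"
    using test_function_support[OF assms] by blast
  have "norm x \<le> M + norm z" if "\<phi> (x + z) \<noteq> 0" for x
    using M[OF that] norm_triangle_ineq4[of "x + z" z] by simp
  then have "bounded {x. \<phi> (x + z) \<noteq> 0}"
    unfolding bounded_iff by blast
  ultimately show ?thesis
    using assms by (simp add: test_function_def compact_closure)
qed

text \<open>Weak derivatives become statements about inner products in \<open>L\<^sup>2\<close>, which are continuous, linear and
translation invariant.\<close>

lemma weak_deriv_iff:
  "weak_deriv i f g \<longleftrightarrow>
    (\<forall>\<phi> c. test_function \<phi> \<longrightarrow> inner (tensor (partial_deriv i \<phi>) c) f = - inner (tensor \<phi> c) g)"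
proof -
  have "(\<forall>c. inner (tensor (partial_deriv i \<phi>) c) f = - inner (tensor \<phi> c) g) \<longleftrightarrow>
     (\<integral>x. partial_deriv i \<phi> x *\<^sub>R rep_L2 f x \<partial>lborel) = - (\<integral>x. \<phi> x *\<^sub>R rep_L2 g x \<partial>lborel)"
    if "test_function \<phi>" for \<phi>
    using that
    by (simp add: inner_tensor sq_int_test_function test_function_partial_deriv
        flip: inner_minus_right) (rule vector_eq_ldot)
  then show ?thesis unfolding weak_deriv_def by blast
qed

definition bumps :: "(real^3 \<Rightarrow> real) set" where
  "bumps = {\<phi> \<in> elementary. bounded {x. \<phi> x \<noteq> 0}}"

lemma bumps_test_function: "\<phi> \<in> bumps \<Longrightarrow> test_function \<phi>"
  by (auto simp: bumps_def test_function_elementary)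

lemma bumps_partial_deriv:
  assumes "\<phi> \<in> bumps"
  shows "partial_deriv i \<phi> \<in> bumps"
proof -
  obtain M where "\<And>x. \<phi> x \<noteq> 0 \<Longrightarrow> norm x \<le> M"
    using test_function_support[OF bumps_test_function[OF assms]] by blast
  then have "bounded {x. partial_deriv i \<phi> x \<noteq> 0}"
    unfolding bounded_iff using bounded_support_partial_deriv[of \<phi> M i] by blast
  then show ?thesis using assms by (auto simp: bumps_def elementary_partial_deriv)
qed

text \<open>Bumps approximate indicators of boxes, so every component of the class integrates to zero over every
box.\<close>

lemma L2_eq_0_if_orthogonal_bumps:
  fixes h :: "'n::finite L2"
  assumes "\<And>\<phi> c. \<phi> \<in> bumps \<Longrightarrow> inner (tensor \<phi> c) h = 0"
  shows "h = 0"
proof -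
  have "AE x in lborel. inner c (rep_L2 h x) = 0" for c
  proof (rule AE_eq_0_of_box_integrals)
    show m [measurable]: "(\<lambda>x. inner c (rep_L2 h x)) \<in> borel_measurable borel" by measurable
    fix a b :: "real^3"
    have sq: "sq_int (indicator (box a b))"
      by (auto simp: sq_int_def power2_eq_square simp flip: indicator_inter_arith
          intro!: integrable_real_indicator emeasure_bounded_finite bounded_box)
    have "integrable lborel (\<lambda>x. inner c (indicator (box a b) x *\<^sub>R rep_L2 h x))"
      by (intro integrable_inner_right integrable_scaleR_L2 sq square_integrable_rep)
    then show int: "integrable lborel (\<lambda>x. indicator (box a b) x * inner c (rep_L2 h x))"
      by simp
    have bb: "box_bump a b n \<in> bumps" for n
    proof -
      have "{x. box_bump a b n x \<noteq> 0} \<subseteq> box a b" using box_bump_eq_0 by blast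
      then show ?thesis
        using bounded_subset[OF bounded_box] by (simp add: bumps_def box_bump_elementary)
    qed
    have "(\<lambda>n. \<integral>x. box_bump a b n x * inner c (rep_L2 h x) \<partial>lborel) \<longlonglongrightarrow>
        (\<integral>x. indicator (box a b) x * inner c (rep_L2 h x) \<partial>lborel)"
    proof (rule integral_dominated_convergence)
      show "integrable lborel (\<lambda>x. norm (indicator (box a b) x * inner c (rep_L2 h x)))"
        using int by (rule integrable_norm)
      show "AE x in lborel. (\<lambda>n. box_bump a b n x * inner c (rep_L2 h x)) \<longlonglongrightarrow> indicator (box a b) x * inner c (rep_L2 h x)"
        by (intro AE_I2 tendsto_intros box_bump_tendsto)
      show "AE x in lborel. norm (box_bump a b n x * inner c (rep_L2 h x)) \<le> norm (indicator (box a b) x * inner c (rep_L2 h x))" for n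
        using box_bump_bounds[of a b n] box_bump_eq_0[of _ a b n]
        by (intro AE_I2) (auto simp: abs_mult indicator_def intro: mult_left_le_one_le)
      show "(\<lambda>x. box_bump a b n x * inner c (rep_L2 h x)) \<in> borel_measurable lborel" for n
        using borel_measurable_continuous_onI[OF elementary_continuous[OF box_bump_elementary, of UNIV a b n]]
        by measurable
    qed (use m in measurable)
    moreover have "(\<integral>x. box_bump a b n x * inner c (rep_L2 h x) \<partial>lborel) = 0" for n
    proof -
      note sqb = sq_int_test_function[OF bumps_test_function[OF bb]]
      have "(\<integral>x. inner c (box_bump a b n x *\<^sub>R rep_L2 h x) \<partial>lborel) = inner (tensor (box_bump a b n) c) h"
        unfolding inner_tensor[OF sqb]
        by (intro integral_inner_right impI integrable_scaleR_L2 sqb square_integrable_rep)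
      then show ?thesis using assms[OF bb] by simp
    qed
    ultimately show "(\<integral>x. indicator (box a b) x * inner c (rep_L2 h x) \<partial>lborel) = 0"
      by (simp add: LIMSEQ_const_iff)
  qed
  then have "AE x in lborel. \<forall>c\<in>Basis. inner c (rep_L2 h x) = 0"
    by (subst AE_ball_countable) (auto intro: countable_finite)
  then have "AE x in lborel. rep_L2 h x = 0"
    by eventually_elim (metis euclidean_all_zero_iff inner_commute)
  moreover have "AE x in lborel. rep_L2 (0 :: 'n L2) x = 0"
    using AE_rep_abs_L2[OF square_integrable_zero] by (simp add: zero_L2_def)
  ultimately show ?thesis
    by (intro L2_eqI) (auto elim: eventually_elim2)
qed

section \<open>Translations\<close>

definition shift :: "real^3 \<Rightarrow> 'n::finite L2 \<Rightarrow> 'n L2" where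
  "shift z f = abs_L2 (\<lambda>x. rep_L2 f (x + z))"

lemma square_integrable_translate: "square_integrable F \<Longrightarrow> square_integrable (\<lambda>x. F (x + z))"
  using integrable_lborel_translate[of "\<lambda>x. (norm (F x))\<^sup>2" z] by (auto simp: square_integrable_def)

lemma inner_shift: "inner (shift z f) g = (\<integral>x. inner (rep_L2 f (x + z)) (rep_L2 g x) \<partial>lborel)"
  using inner_L2_abs[OF square_integrable_translate[OF square_integrable_rep] square_integrable_rep, of f z g]
  by (simp add: shift_def)

lemma inner_shift_adjoint: "inner (shift z f) g = inner f (shift (- z) g)"
proof -
  have "inner (shift z f) g = (\<integral>x. inner (rep_L2 f (x - z + z)) (rep_L2 g (x - z)) \<partial>lborel)"
    unfolding inner_shift
    using integral_lborel_translate[of "\<lambda>x. inner (rep_L2 f (x + z)) (rep_L2 g x)" "- z"] by simp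
  also have "\<dots> = inner f (shift (- z) g)"
    unfolding inner_commute[of f] inner_shift by (simp add: inner_commute[of "rep_L2 f _"])
  finally show ?thesis .
qed

lemma norm_shift: "norm (shift z f) = norm f"
proof -
  have "inner (shift z f) (shift z f) = inner f f"
    unfolding shift_def
    using integral_lborel_translate[of "\<lambda>x. inner (rep_L2 f x) (rep_L2 f x)" z]
    by (subst inner_L2_abs) (auto simp: inner_L2_rep intro: square_integrable_translate square_integrable_rep)
  then show ?thesis by (simp add: norm_eq_sqrt_inner)
qed

lemma inner_tensor_shift:
  assumes "sq_int \<phi>"
  shows "inner (tensor \<phi> c) (shift z f) = inner (tensor (\<lambda>x. \<phi> (x - z)) c) f"
proof -
  have sq: "sq_int (\<lambda>x. \<phi> (x - z))" using sq_int_translate[OF assms, of "- z"] by simp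
  have m [measurable]: "\<phi> \<in> borel_measurable borel" using assms by (simp add: sq_int_def)
  have "inner (tensor \<phi> c) (shift z f) = (\<integral>x. inner (\<phi> x *\<^sub>R c) (rep_L2 f (x + z)) \<partial>lborel)"
    unfolding tensor_def shift_def
    by (intro inner_L2_abs square_integrable_tensor assms square_integrable_translate square_integrable_rep)
  also have "\<dots> = (\<integral>x. inner (\<phi> (x - z) *\<^sub>R c) (rep_L2 f x) \<partial>lborel)"
    using integral_lborel_translate[of "\<lambda>x. inner (\<phi> (x - z) *\<^sub>R c) (rep_L2 f x)" z] by simp
  also have "\<dots> = inner (tensor (\<lambda>x. \<phi> (x - z)) c) f"
    using inner_L2_abs[OF square_integrable_tensor[OF sq] square_integrable_rep, of c f] by (simp add: tensor_def)
  finally show ?thesis .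
qed

lemma weak_deriv_shift:
  assumes "weak_deriv i f g"
  shows "weak_deriv i (shift z f) (shift z g)"
  unfolding weak_deriv_iff
proof (intro allI impI)
  fix \<phi> and c :: "complex^'a" assume \<phi>: "test_function \<phi>"
  have *: "test_function (\<lambda>x. \<phi> (x - z))" using test_function_translate[OF \<phi>, of "- z"] by simp
  have "partial_deriv i (\<lambda>x. \<phi> (x - z)) = (\<lambda>x. partial_deriv i \<phi> (x - z))"
    using partial_deriv_translate[of i \<phi> "- z"] by simp
  then show "inner (tensor (partial_deriv i \<phi>) c) (shift z f) = - inner (tensor \<phi> c) (shift z g)"
    using assms[unfolded weak_deriv_iff, rule_format, OF *, of c]
    by (simp add: inner_tensor_shift sq_int_test_function \<phi> test_function_partial_deriv)
qed

section \<open>Convolution with the Yukawa kernel\<close>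

definition conv :: "'n::finite L2 \<Rightarrow> real^3 \<Rightarrow> complex^'n" where
  "conv f x = (\<integral>y. yukawa (x - y) *\<^sub>R rep_L2 f y \<partial>lborel)"

definition resolvent :: "'n::finite L2 \<Rightarrow> 'n L2" where
  "resolvent f = abs_L2 (conv f)"

lemma integral_lborel_reflect:
  fixes f :: "'a::euclidean_space \<Rightarrow> 'b::{banach, second_countable_topology}"
  assumes [measurable]: "f \<in> borel_measurable borel"
  shows "(\<integral>x. f (- x) \<partial>lborel) = (\<integral>x. f x \<partial>lborel)"
proof -
  have "lborel = density (distr lborel borel (\<lambda>x::'a. 0 + (- 1) *\<^sub>R x)) (\<lambda>_. 1)"
    using lborel_affine[of "- 1" "0 :: 'a"] by simp
  then have "lborel = distr lborel borel (\<lambda>x::'a. - x)" by (simp add: density_1)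
  then have "(\<integral>x. f x \<partial>lborel) = (\<integral>x. f x \<partial>distr lborel borel uminus)" by simp
  also have "\<dots> = (\<integral>x. f (- x) \<partial>lborel)" by (rule integral_distr) auto
  finally show ?thesis ..
qed

lemma conv_alt: "conv f x = (\<integral>z. yukawa z *\<^sub>R rep_L2 f (x + z) \<partial>lborel)"
proof -
  have "yukawa (x - y) = yukawa (y - x)" for y using yukawa_minus[of "x - y"] by simp
  then show ?thesis
    unfolding conv_def
    using integral_lborel_translate[of "\<lambda>y. yukawa (y - x) *\<^sub>R rep_L2 f y" x] by (simp add: add.commute)
qed

lemma sq_int_yukawa: "sq_int yukawa"
  using integrable_yukawa_square by (simp add: sq_int_def)

lemma sq_int_yukawa_at: "sq_int (\<lambda>y. yukawa (y - x))" "sq_int (\<lambda>y. yukawa (x - y))"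
proof -
  show "sq_int (\<lambda>y. yukawa (y - x))" using sq_int_translate[OF sq_int_yukawa, of "- x"] by simp
  moreover have "yukawa (y - x) = yukawa (x - y)" for y using yukawa_minus[of "x - y"] by simp
  ultimately show "sq_int (\<lambda>y. yukawa (x - y))" by simp
qed

lemma conv_measurable [measurable]: "conv f \<in> borel_measurable borel"
proof -
  have "(\<lambda>x. \<integral>y. yukawa (x - y) *\<^sub>R rep_L2 f y \<partial>lborel) \<in> borel_measurable lborel"
    by (rule lborel.borel_measurable_lebesgue_integral) (simp add: split_beta')
  then show ?thesis by (simp add: conv_def[abs_def])
qed

lemma nn_integral_yukawa_at: "(\<integral>\<^sup>+y. ennreal (yukawa (x - y)) \<partial>lborel) = 1"
proof -
  have "yukawa (x - y) = yukawa (y - x)" for y using yukawa_minus[of "x - y"] by simp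
  moreover have "(\<integral>\<^sup>+y. ennreal (yukawa y) \<partial>distr lborel borel (\<lambda>y. y + (- x))) = (\<integral>\<^sup>+y. ennreal (yukawa (y + (- x))) \<partial>lborel)"
    by (rule nn_integral_distr) auto
  ultimately show ?thesis unfolding lborel_translate nn_integral_yukawa by simp
qed

text \<open>Young's inequality for a kernel of mass one. By Cauchy--Schwarz the square of the convolution is at
most the convolution of the kernel with the square, and Tonelli integrates the latter.\<close>

lemma square_integrable_conv: "square_integrable (conv f)"
proof -
  have bound: "ennreal ((norm (conv f x))\<^sup>2) \<le> (\<integral>\<^sup>+y. ennreal (yukawa (x - y)) * ennreal ((norm (rep_L2 f y))\<^sup>2) \<partial>lborel)" for x
  proof -
    let ?s = "\<lambda>y. ennreal (sqrt (yukawa (x - y)))"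
    have "ennreal (norm (conv f x)) \<le> (\<integral>\<^sup>+y. ennreal (norm (yukawa (x - y) *\<^sub>R rep_L2 f y)) \<partial>lborel)"
      unfolding conv_def
      by (intro integral_norm_bound_ennreal integrable_scaleR_L2 sq_int_yukawa_at square_integrable_rep)
    also have "\<dots> = (\<integral>\<^sup>+y. ?s y * (?s y * ennreal (norm (rep_L2 f y))) \<partial>lborel)"
      by (intro nn_integral_cong) (simp add: yukawa_nonneg ennreal_mult'[symmetric] flip: mult.assoc)
    finally have "(ennreal (norm (conv f x)))\<^sup>2 \<le> \<dots>\<^sup>2" by (intro power_mono) auto
    also have "\<dots> \<le> (\<integral>\<^sup>+y. (?s y)\<^sup>2 \<partial>lborel) * (\<integral>\<^sup>+y. (?s y * ennreal (norm (rep_L2 f y)))\<^sup>2 \<partial>lborel)"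
      by (rule Cauchy_Schwarz_nn_integral) auto
    also have "\<dots> = (\<integral>\<^sup>+y. ennreal (yukawa (x - y)) * ennreal ((norm (rep_L2 f y))\<^sup>2) \<partial>lborel)"
      by (simp add: power_mult_distrib ennreal_power yukawa_nonneg nn_integral_yukawa_at)
    finally show ?thesis by (simp add: ennreal_power)
  qed
  have "(\<integral>\<^sup>+x. ennreal ((norm (conv f x))\<^sup>2) \<partial>lborel)
      \<le> (\<integral>\<^sup>+x. \<integral>\<^sup>+y. ennreal (yukawa (x - y)) * ennreal ((norm (rep_L2 f y))\<^sup>2) \<partial>lborel \<partial>lborel)"
    by (intro nn_integral_mono bound)
  also have "\<dots> = (\<integral>\<^sup>+y. \<integral>\<^sup>+x. ennreal (yukawa (x - y)) * ennreal ((norm (rep_L2 f y))\<^sup>2) \<partial>lborel \<partial>lborel)"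
    by (rule lborel_pair.Fubini') measurable
  also have "\<dots> = (\<integral>\<^sup>+y. (\<integral>\<^sup>+x. ennreal (yukawa (y - x)) \<partial>lborel) * ennreal ((norm (rep_L2 f y))\<^sup>2) \<partial>lborel)"
    using yukawa_minus[of "_ - _"] by (intro nn_integral_cong, subst nn_integral_multc) (auto simp: minus_diff_eq)
  also have "\<dots> < \<infinity>"
    using square_integrable_rep[of f] unfolding nn_integral_yukawa_at
    by (auto simp: square_integrable_def integrable_iff_bounded)
  finally show ?thesis
    unfolding square_integrable_def by (auto intro!: integrableI_nonneg)
qed

lemma AE_rep_resolvent: "AE x in lborel. rep_L2 (resolvent f) x = conv f x"
  unfolding resolvent_def by (intro AE_rep_abs_L2 square_integrable_conv)

text \<open>Fubini, with \<open>yukawa z * (\<parallel>f(x + z)\<parallel>\<^sup>2 + \<parallel>g(x)\<parallel>\<^sup>2)\<close> as an integrable majorant. This form of the resolvent is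
the source of its symmetry, of its boundedness and of the fact that it commutes with weak derivatives.\<close>

lemma resolvent_average:
  "integrable lborel (\<lambda>z. yukawa z * inner (shift z f) g)"
  "inner (resolvent f) g = (\<integral>z. yukawa z * inner (shift z f) g \<partial>lborel)"
proof -
  let ?h = "\<lambda>(x, z). yukawa z * inner (rep_L2 f (x + z)) (rep_L2 g x)"
  have m [measurable]: "?h \<in> borel_measurable (lborel \<Otimes>\<^sub>M lborel)" by measurable
  have fin: "(\<integral>\<^sup>+z. \<integral>\<^sup>+x. ennreal (yukawa z * ((norm (rep_L2 f (x + z)))\<^sup>2 + (norm (rep_L2 g x))\<^sup>2)) \<partial>lborel \<partial>lborel) < \<infinity>"
  proof -
    have "(\<integral>\<^sup>+x. ennreal (yukawa z * ((norm (rep_L2 f (x + z)))\<^sup>2 + (norm (rep_L2 g x))\<^sup>2)) \<partial>lborel)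
        = ennreal (yukawa z) * ennreal ((norm f)\<^sup>2 + (norm g)\<^sup>2)" for z
    proof -
      have i: "integrable lborel (\<lambda>x. (norm (rep_L2 f (x + z)))\<^sup>2)" "integrable lborel (\<lambda>x. (norm (rep_L2 g x))\<^sup>2)"
        using square_integrable_translate[OF square_integrable_rep[of f], of z] square_integrable_rep[of g]
        by (auto simp: square_integrable_def)
      have "(\<integral>x. (norm (rep_L2 f (x + z)))\<^sup>2 \<partial>lborel) = (norm f)\<^sup>2"
        using integral_lborel_translate[of "\<lambda>x. (norm (rep_L2 f x))\<^sup>2" z] by (simp add: norm_L2_power2)
      then have "(\<integral>\<^sup>+x. ennreal ((norm (rep_L2 f (x + z)))\<^sup>2 + (norm (rep_L2 g x))\<^sup>2) \<partial>lborel) = ennreal ((norm f)\<^sup>2 + (norm g)\<^sup>2)"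
        using i by (subst nn_integral_eq_integral) (auto simp: norm_L2_power2[of g])
      then show ?thesis
        unfolding ennreal_mult'[OF yukawa_nonneg] by (subst nn_integral_cmult) auto
    qed
    moreover have "(\<integral>\<^sup>+z. ennreal (yukawa z) * ennreal ((norm f)\<^sup>2 + (norm g)\<^sup>2) \<partial>lborel) < \<infinity>"
      by (subst nn_integral_multc) (auto simp: nn_integral_yukawa)
    ultimately show ?thesis by simp
  qed
  have "integrable (lborel \<Otimes>\<^sub>M lborel) ?h"
  proof (rule integrableI_bounded)
    have "(\<integral>\<^sup>+p. ennreal (norm (?h p)) \<partial>(lborel \<Otimes>\<^sub>M lborel))
        = (\<integral>\<^sup>+z. \<integral>\<^sup>+x. ennreal (norm (?h (x, z))) \<partial>lborel \<partial>lborel)"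
      by (rule lborel_pair.nn_integral_snd[symmetric]) measurable
    also have "\<dots> \<le> (\<integral>\<^sup>+z. \<integral>\<^sup>+x. ennreal (yukawa z * ((norm (rep_L2 f (x + z)))\<^sup>2 + (norm (rep_L2 g x))\<^sup>2)) \<partial>lborel \<partial>lborel)"
    proof (intro nn_integral_mono ennreal_leI)
      fix x z
      have "\<bar>inner (rep_L2 f (x + z)) (rep_L2 g x)\<bar> \<le> norm (rep_L2 f (x + z)) * norm (rep_L2 g x)"
        by (rule Cauchy_Schwarz_ineq2)
      also have "\<dots> \<le> (norm (rep_L2 f (x + z)))\<^sup>2 + (norm (rep_L2 g x))\<^sup>2"
      proof -
        have "0 \<le> norm (rep_L2 f (x + z)) * norm (rep_L2 g x)" by simp
        then show ?thesis using sum_squares_bound[of "norm (rep_L2 f (x + z))" "norm (rep_L2 g x)"] by linarith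
      qed
      finally show "norm (?h (x, z)) \<le> yukawa z * ((norm (rep_L2 f (x + z)))\<^sup>2 + (norm (rep_L2 g x))\<^sup>2)"
        by (auto simp: abs_mult yukawa_nonneg intro: mult_left_mono)
    qed
    also note fin
    finally show "(\<integral>\<^sup>+p. ennreal (norm (?h p)) \<partial>(lborel \<Otimes>\<^sub>M lborel)) < \<infinity>" .
  qed measurable
  then have int: "integrable (lborel \<Otimes>\<^sub>M lborel) ?h" .
  have inner: "(\<integral>x. yukawa z * inner (rep_L2 f (x + z)) (rep_L2 g x) \<partial>lborel) = yukawa z * inner (shift z f) g" for z
    by (simp add: inner_shift)
  show "integrable lborel (\<lambda>z. yukawa z * inner (shift z f) g)"
    using lborel_pair.integrable_snd[OF int] unfolding inner .
  have "inner (resolvent f) g = (\<integral>x. inner (conv f x) (rep_L2 g x) \<partial>lborel)"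
    using inner_L2_abs[OF square_integrable_conv square_integrable_rep, of f g] by (simp only: resolvent_def abs_rep_L2)
  also have "\<dots> = (\<integral>x. \<integral>z. yukawa z * inner (rep_L2 f (x + z)) (rep_L2 g x) \<partial>lborel \<partial>lborel)"
  proof (intro Bochner_Integration.integral_cong refl)
    fix x
    have "integrable lborel (\<lambda>z. yukawa z *\<^sub>R rep_L2 f (x + z))"
      using square_integrable_translate[OF square_integrable_rep, of f x]
      unfolding add.commute[of _ x] by (rule integrable_scaleR_L2[OF sq_int_yukawa])
    then show "inner (conv f x) (rep_L2 g x) = (\<integral>z. yukawa z * inner (rep_L2 f (x + z)) (rep_L2 g x) \<partial>lborel)"
      unfolding conv_alt by (subst integral_inner_left[symmetric]) auto
  qed
  also have "\<dots> = (\<integral>z. \<integral>x. yukawa z * inner (rep_L2 f (x + z)) (rep_L2 g x) \<partial>lborel \<partial>lborel)"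
    by (rule lborel_pair.Fubini_integral[OF int, symmetric])
  finally show "inner (resolvent f) g = (\<integral>z. yukawa z * inner (shift z f) g \<partial>lborel)"
    unfolding inner .
qed

lemma inner_resolvent_symmetric: "inner (resolvent f) g = inner f (resolvent g)"
proof -
  have "inner (resolvent f) g = (\<integral>z. yukawa z * inner (shift (- z) g) f \<partial>lborel)"
    unfolding resolvent_average(2) by (simp only: inner_shift_adjoint[of _ f] inner_commute[of f])
  also have "\<dots> = (\<integral>z. yukawa z * inner (shift z g) f \<partial>lborel)"
    using integral_lborel_reflect[of "\<lambda>z. yukawa z * inner (shift z g) f"]
      borel_measurable_integrable[OF resolvent_average(1)[of g f]] by simp
  also have "\<dots> = inner (resolvent g) f" by (simp only: resolvent_average(2))
  finally show ?thesis by (simp only: inner_commute[of f])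
qed

lemma norm_resolvent_le: "norm (resolvent f) \<le> norm f"
proof -
  have "\<bar>inner (resolvent f) g\<bar> \<le> norm f * norm g" for g
  proof -
    have "\<bar>inner (resolvent f) g\<bar> \<le> (\<integral>z. yukawa z * (norm f * norm g) \<partial>lborel)"
      unfolding resolvent_average(2)
    proof (rule integral_abs_bound[THEN order_trans], rule integral_mono)
      show "integrable lborel (\<lambda>z. \<bar>yukawa z * inner (shift z f) g\<bar>)"
        by (rule integrable_abs[OF resolvent_average(1)])
      show "integrable lborel (\<lambda>z. yukawa z * (norm f * norm g))"
        using integrable_yukawa by simp
      show "\<bar>yukawa z * inner (shift z f) g\<bar> \<le> yukawa z * (norm f * norm g)" for z
        using Cauchy_Schwarz_ineq2[of "shift z f" g]
        by (simp add: abs_mult yukawa_nonneg norm_shift mult_left_mono)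
    qed
    then show ?thesis by (simp add: integral_yukawa)
  qed
  from this[of "resolvent f"] have "norm (resolvent f) * norm (resolvent f) \<le> norm f * norm (resolvent f)"
    by (simp add: norm_eq_sqrt_inner)
  then show ?thesis
    by (cases "norm (resolvent f) = 0") (auto simp: mult_le_cancel_right)
qed

lemma resolvent_add: "resolvent (f + g) = resolvent f + resolvent g"
proof -
  have "inner (resolvent (f + g)) h = inner (resolvent f + resolvent g) h" for h
    by (simp add: inner_resolvent_symmetric inner_add_left)
  then show ?thesis by (rule vector_eq_rdot[THEN iffD1, rule_format])
qed

lemma conv_scaleC: "conv (c *\<^sub>C f) x = c *\<^sub>C conv f x"
proof -
  have bl: "bounded_linear (\<lambda>v :: complex^'a. c *\<^sub>C v)"
    by (rule bounded_linear_intro[of _ "cmod c"])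
       (simp_all only: scaleC_add_right scaleC_scaleR_commute norm_scaleC_vec mult.commute[of "cmod c"] order_refl)
  have int: "integrable lborel (\<lambda>y. yukawa (x - y) *\<^sub>R rep_L2 f y)"
    by (rule integrable_scaleR_L2[OF sq_int_yukawa_at(2) square_integrable_rep])
  have "c *\<^sub>C conv f x = (\<integral>y. c *\<^sub>C (yukawa (x - y) *\<^sub>R rep_L2 f y) \<partial>lborel)"
    unfolding conv_def by (rule integral_bounded_linear[OF bl int, symmetric])
  also have "\<dots> = (\<integral>y. yukawa (x - y) *\<^sub>R rep_L2 (c *\<^sub>C f) y \<partial>lborel)"
  proof (rule integral_cong_AE)
    show "AE y in lborel. c *\<^sub>C (yukawa (x - y) *\<^sub>R rep_L2 f y) = yukawa (x - y) *\<^sub>R rep_L2 (c *\<^sub>C f) y"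
      using AE_rep_L2_scaleC[of c f] by eventually_elim (simp add: scaleC_scaleR_commute)
    have "(\<lambda>y. yukawa (x - y) *\<^sub>R rep_L2 f y) \<in> borel_measurable borel" by measurable
    from borel_measurable_scaleC_vec[OF this]
    show "(\<lambda>y. c *\<^sub>C (yukawa (x - y) *\<^sub>R rep_L2 f y)) \<in> borel_measurable lborel" by simp
  qed measurable
  finally show ?thesis by (simp add: conv_def)
qed

lemma resolvent_scaleC: "resolvent (c *\<^sub>C f) = c *\<^sub>C resolvent f"
proof -
  have "conv (c *\<^sub>C f) = (\<lambda>x. c *\<^sub>C conv f x)" by (rule ext) (rule conv_scaleC)
  then show ?thesis by (simp add: resolvent_def abs_L2_scaleC square_integrable_conv)
qed

lemma weak_deriv_resolvent:
  assumes "weak_deriv i f g"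
  shows "weak_deriv i (resolvent f) (resolvent g)"
  unfolding weak_deriv_iff
proof (intro allI impI)
  fix \<phi> and c :: "complex^'a" assume \<phi>: "test_function \<phi>"
  have "inner (tensor (partial_deriv i \<phi>) c) (shift z f) = - inner (tensor \<phi> c) (shift z g)" for z
    using weak_deriv_shift[OF assms, of z] \<phi> by (simp add: weak_deriv_iff)
  then show "inner (tensor (partial_deriv i \<phi>) c) (resolvent f) = - inner (tensor \<phi> c) (resolvent g)"
    by (simp add: inner_commute[of "tensor _ _"] resolvent_average(2))
qed

section \<open>The fundamental solution\<close>

text \<open>The classical Laplacian of a scalar function, in contrast to the weak one on classes.\<close>

definition laplace :: "(real^3 \<Rightarrow> real) \<Rightarrow> real^3 \<Rightarrow> real" where
  "laplace w x = (\<Sum>i\<in>UNIV. partial_deriv i (partial_deriv i w) x)"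

text \<open>A smooth substitute for the norm. Radial functions of it are smooth across the origin.\<close>

definition soft_norm :: "real \<Rightarrow> real^3 \<Rightarrow> real" where
  "soft_norm \<epsilon> x = sqrt (\<epsilon>\<^sup>2 + (norm x)\<^sup>2)"

lemma soft_norm_pos: "\<epsilon> > 0 \<Longrightarrow> soft_norm \<epsilon> x > 0"
  by (simp add: soft_norm_def add_pos_nonneg)

lemma soft_norm_ge_norm: "norm x \<le> soft_norm \<epsilon> x"
  by (simp add: soft_norm_def real_le_rsqrt)

lemma soft_norm_ge: "\<epsilon> > 0 \<Longrightarrow> \<epsilon> \<le> soft_norm \<epsilon> x"
  by (simp add: soft_norm_def real_le_rsqrt)

lemma soft_norm_power2: "(soft_norm \<epsilon> x)\<^sup>2 = \<epsilon>\<^sup>2 + (norm x)\<^sup>2"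
  by (simp add: soft_norm_def)

lemma soft_norm_continuous: "continuous_on A (soft_norm \<epsilon>)"
  unfolding soft_norm_def[abs_def] by (intro continuous_intros)

lemma soft_norm_derivative:
  assumes "\<epsilon> > 0"
  shows "soft_norm \<epsilon> differentiable at x" "partial_deriv i (soft_norm \<epsilon>) x = x $ i / soft_norm \<epsilon> x"
proof -
  have pos: "\<epsilon>\<^sup>2 + x \<bullet> x > 0" using assms by (simp add: add_pos_nonneg)
  have D: "((\<lambda>x::real^3. \<epsilon>\<^sup>2 + x \<bullet> x) has_derivative (\<lambda>h. 2 * (x \<bullet> h))) (at x)"
    by (auto intro!: derivative_eq_intros simp: inner_commute)
  have p: "partial_deriv i (\<lambda>x::real^3. \<epsilon>\<^sup>2 + x \<bullet> x) x = 2 * x $ i"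
    by (simp add: partial_deriv_eq[OF D] inner_axis)
  have d: "(\<lambda>x::real^3. \<epsilon>\<^sup>2 + x \<bullet> x) differentiable at x" using D by (auto simp: differentiable_def)
  note * = partial_deriv_real_compose[OF DERIV_real_sqrt[OF pos] d]
  have e: "soft_norm \<epsilon> = (\<lambda>x. sqrt (\<epsilon>\<^sup>2 + x \<bullet> x))" by (simp add: fun_eq_iff soft_norm_def power2_norm_eq_inner)
  show "soft_norm \<epsilon> differentiable at x" "partial_deriv i (soft_norm \<epsilon>) x = x $ i / soft_norm \<epsilon> x"
    using * p unfolding e by (auto simp: field_simps)
qed

text \<open>Integration by parts twice. With \<open>\<rho>\<close> the smoothed norm, \<open>\<partial>\<^sub>i F(\<rho>) = G(\<rho>) x\<^sub>i\<close> where \<open>G(s) = F'(s) / s\<close>, so the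
Laplacian of \<open>F(\<rho>)\<close> is \<open>G'(\<rho>) |x|\<^sup>2 / \<rho> + 3 G(\<rho>)\<close>.\<close>

lemma laplace_radial:
  assumes \<epsilon>: "\<epsilon> > 0" and w: "test_function w"
    and F1: "\<And>s. s > 0 \<Longrightarrow> (F has_real_derivative F1 s) (at s)"
    and F2: "\<And>s. s > 0 \<Longrightarrow> (F1 has_real_derivative F2 s) (at s)"
    and F2_cont: "continuous_on {0<..} F2"
  shows "(\<integral>x. F (soft_norm \<epsilon> x) * laplace w x \<partial>lborel) =
    (\<integral>x. ((F2 (soft_norm \<epsilon> x) / soft_norm \<epsilon> x - F1 (soft_norm \<epsilon> x) / (soft_norm \<epsilon> x)\<^sup>2) * (norm x)\<^sup>2 / soft_norm \<epsilon> x
        + 3 * F1 (soft_norm \<epsilon> x) / soft_norm \<epsilon> x) * w x \<partial>lborel)"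
proof -
  define u where "u x = F (soft_norm \<epsilon> x)" for x
  define G where "G s = F1 s / s" for s
  define G' where "G' s = F2 s / s - F1 s / s\<^sup>2" for s
  have G: "(G has_real_derivative G' s) (at s)" if "s > 0" for s
    unfolding G_def[abs_def] G'_def using that
    by (auto intro!: derivative_eq_intros F2 simp: field_simps power2_eq_square)
  note rd = soft_norm_derivative[OF \<epsilon>] and pos = soft_norm_pos[OF \<epsilon>]
  have nz: "soft_norm \<epsilon> x \<noteq> 0" for x using pos[of x] by simp
  have u1: "u differentiable at x" "partial_deriv i u x = G (soft_norm \<epsilon> x) * x $ i" for x i
    unfolding u_def[abs_def] G_def
    using partial_deriv_real_compose[OF F1[OF pos] rd(1)] by (auto simp: rd(2))
  then have u1': "partial_deriv i u = (\<lambda>x. G (soft_norm \<epsilon> x) * x $ i)" for i by blast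
  have Gd: "(\<lambda>x. G (soft_norm \<epsilon> x)) differentiable at x" for x
    by (rule partial_deriv_real_compose(1)[OF G[OF pos] rd(1)])
  have u2: "partial_deriv i u differentiable at x"
      "partial_deriv i (partial_deriv i u) x = G (soft_norm \<epsilon> x) + G' (soft_norm \<epsilon> x) * (x $ i)\<^sup>2 / soft_norm \<epsilon> x" for x i
  proof -
    show "partial_deriv i u differentiable at x"
      unfolding u1' by (intro differentiable_mult Gd differentiable_coordinate)
    show "partial_deriv i (partial_deriv i u) x = G (soft_norm \<epsilon> x) + G' (soft_norm \<epsilon> x) * (x $ i)\<^sup>2 / soft_norm \<epsilon> x"
      unfolding u1' partial_deriv_mult[OF Gd differentiable_coordinate]
        partial_deriv_real_compose(2)[OF G[OF pos] rd(1)]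
      by (simp add: partial_deriv_coordinate rd(2) power2_eq_square)
  qed
  have F1_cont: "continuous_on {0<..} F1"
    using F2 by (meson DERIV_isCont continuous_at_imp_continuous_on greaterThan_iff)
  have c: "continuous_on UNIV (\<lambda>x. g (soft_norm \<epsilon> x))" if "continuous_on {0<..} g" for g :: "real \<Rightarrow> real"
    by (rule continuous_on_compose2[OF that soft_norm_continuous]) (use pos in auto)
  have cG: "continuous_on UNIV (\<lambda>x. G (soft_norm \<epsilon> x))" "continuous_on UNIV (\<lambda>x. G' (soft_norm \<epsilon> x))"
    unfolding G_def G'_def by (intro continuous_intros c F1_cont F2_cont soft_norm_continuous; simp add: nz)+
  have c1: "continuous_on UNIV (partial_deriv i u)" for i
    unfolding u1' by (intro continuous_intros cG)
  have c2: "continuous_on UNIV (partial_deriv i (partial_deriv i u))" for i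
    unfolding u2(2)[abs_def] by (intro continuous_intros cG soft_norm_continuous) (simp add: nz)
  have c0: "continuous_on UNIV u"
    using u1(1) by (simp add: differentiable_imp_continuous_on differentiable_on_def differentiable_at_withinI)
  note tw = test_function_partial_deriv[OF w] and ttw = test_function_partial_deriv[OF test_function_partial_deriv[OF w]]
  obtain M where M: "\<And>x. w x \<noteq> 0 \<Longrightarrow> norm x \<le> M"
    using test_function_support[OF w] by blast
  note M1 = bounded_support_partial_deriv[of w M, OF M]
  note M2 = bounded_support_partial_deriv[of "partial_deriv i w" M for i, OF M1]
  have parts: "(\<integral>x. u x * partial_deriv i (partial_deriv i w) x \<partial>lborel)
      = (\<integral>x. partial_deriv i (partial_deriv i u) x * w x \<partial>lborel)" for i
    using integral_by_parts[of u i "partial_deriv i w" M, OF u1(1) c1 test_function_differentiable[OF tw]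
        test_function_continuous[OF ttw] M1]
      integral_by_parts[of "partial_deriv i u" i w M, OF u2(1) c2 test_function_differentiable[OF w]
        test_function_continuous[OF tw] M]
    by simp
  have int1: "integrable lborel (\<lambda>x. u x * partial_deriv i (partial_deriv i w) x)" for i
    using M2 by (intro integrable_bounded_support[of _ M] continuous_intros c0 test_function_continuous[OF ttw]) auto
  have int2: "integrable lborel (\<lambda>x. partial_deriv i (partial_deriv i u) x * w x)" for i
    using M by (intro integrable_bounded_support[of _ M] continuous_intros c2 test_function_continuous[OF w]) auto
  have "(\<integral>x. u x * laplace w x \<partial>lborel) = (\<Sum>i\<in>UNIV. \<integral>x. u x * partial_deriv i (partial_deriv i w) x \<partial>lborel)"
    unfolding laplace_def sum_distrib_left by (intro Bochner_Integration.integral_sum int1)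
  also have "\<dots> = (\<integral>x. (\<Sum>i\<in>UNIV. partial_deriv i (partial_deriv i u) x * w x) \<partial>lborel)"
    unfolding parts by (intro Bochner_Integration.integral_sum[symmetric] int2)
  also have "(\<lambda>x. \<Sum>i\<in>UNIV. partial_deriv i (partial_deriv i u) x * w x)
      = (\<lambda>x. (G' (soft_norm \<epsilon> x) * (norm x)\<^sup>2 / soft_norm \<epsilon> x + 3 * G (soft_norm \<epsilon> x)) * w x)"
  proof
    fix x :: "real^3"
    have n: "(norm x)\<^sup>2 = (\<Sum>i\<in>UNIV. (x $ i)\<^sup>2)"
      unfolding power2_norm_eq_inner by (simp add: inner_vec_def power2_eq_square)
    show "(\<Sum>i\<in>UNIV. partial_deriv i (partial_deriv i u) x * w x)
      = (G' (soft_norm \<epsilon> x) * (norm x)\<^sup>2 / soft_norm \<epsilon> x + 3 * G (soft_norm \<epsilon> x)) * w x"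
      unfolding u2(2) n by (simp add: sum.distrib sum_distrib_left sum_divide_distrib flip: sum_distrib_right)
  qed
  finally show ?thesis by (simp add: u_def G_def G'_def)
qed

lemma test_function_laplace:
  assumes w: "test_function w"
  shows "continuous_on A (laplace w)" "\<exists>M. \<forall>x. w x \<noteq> 0 \<or> laplace w x \<noteq> 0 \<longrightarrow> norm x \<le> M"
proof -
  show "continuous_on A (laplace w)"
    unfolding laplace_def[abs_def]
    by (intro continuous_on_sum test_function_continuous test_function_partial_deriv w)
  obtain M where M: "\<And>x. w x \<noteq> 0 \<Longrightarrow> norm x \<le> M"
    using test_function_support[OF w] by blast
  note M1 = bounded_support_partial_deriv[of w M, OF M]
  note M2 = bounded_support_partial_deriv[of "partial_deriv i w" M for i, OF M1]
  have "norm x \<le> M" if "laplace w x \<noteq> 0" for x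
    using that M2 unfolding laplace_def by (elim sum.not_neutral_contains_not_neutral)
  with M show "\<exists>M. \<forall>x. w x \<noteq> 0 \<or> laplace w x \<noteq> 0 \<longrightarrow> norm x \<le> M" by blast
qed

definition epsilon :: "nat \<Rightarrow> real" where "epsilon n = 1 / real (Suc n)"

lemma epsilon: "epsilon n > 0" "epsilon n \<le> 1" "epsilon \<longlonglongrightarrow> 0"
proof -
  show "epsilon n > 0" "epsilon n \<le> 1" by (simp_all add: epsilon_def)
  show "epsilon \<longlonglongrightarrow> 0"
    using LIMSEQ_inverse_real_of_nat by (simp add: epsilon_def[abs_def] divide_inverse)
qed

lemma soft_norm_tendsto: "(\<lambda>n. soft_norm (epsilon n) x) \<longlonglongrightarrow> norm x"
proof -
  have "(\<lambda>n. sqrt ((epsilon n)\<^sup>2 + (norm x)\<^sup>2)) \<longlonglongrightarrow> sqrt (0\<^sup>2 + (norm x)\<^sup>2)"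
    by (intro tendsto_intros epsilon)
  then show ?thesis by (simp add: soft_norm_def)
qed

lemma soft_norm_measurable [measurable]: "soft_norm \<epsilon> \<in> borel_measurable borel"
  by (rule borel_measurable_continuous_onI[OF soft_norm_continuous])

lemma test_function_bounds:
  assumes w: "test_function w"
  obtains B where "B > 0" "\<And>x. \<bar>w x\<bar> \<le> B" "\<And>x. \<bar>w x - laplace w x\<bar> \<le> B"
    "integrable lborel w" "integrable lborel (\<lambda>x. w x - laplace w x)"
    "w \<in> borel_measurable borel" "laplace w \<in> borel_measurable borel"
proof -
  obtain M where M: "\<And>x. w x \<noteq> 0 \<or> laplace w x \<noteq> 0 \<Longrightarrow> norm x \<le> M"
    using test_function_laplace(2)[OF w] by blast
  note c = test_function_continuous[OF w] test_function_laplace(1)[OF w]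
  have M1: "w x \<noteq> 0 \<Longrightarrow> norm x \<le> M" "w x - laplace w x \<noteq> 0 \<Longrightarrow> norm x \<le> M" for x
    using M[of x] by auto
  obtain B1 B2 where "B1 > 0" "\<And>x. \<bar>w x\<bar> \<le> B1" "B2 > 0" "\<And>x. \<bar>w x - laplace w x\<bar> \<le> B2"
    using bounded_support_bound[of w M, OF c(1) M1(1)]
      bounded_support_bound[of "\<lambda>x. w x - laplace w x" M, OF continuous_on_diff[OF c] M1(2)] by metis
  then show ?thesis
    using M1 by (intro that[of "max B1 B2"] integrable_bounded_support[of _ M] borel_measurable_continuous_onI
        continuous_on_diff c) (auto simp: le_max_iff_disj)
qed

text \<open>Moves \<open>1 - \<Delta>\<close> from the test function to the smoothed radial kernel. Here \<open>K\<close> is the result as a function of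
\<open>s = \<rho>\<close> alone, with \<open>|x|\<^sup>2 = s\<^sup>2 - \<epsilon>\<^sup>2\<close>.\<close>

lemma radial_kernel_integral:
  assumes w: "test_function w" and \<epsilon>: "\<epsilon> > 0"
    and F1: "\<And>s. s > 0 \<Longrightarrow> (F has_real_derivative F1 s) (at s)"
    and F2: "\<And>s. s > 0 \<Longrightarrow> (F1 has_real_derivative F2 s) (at s)"
    and F2_cont: "continuous_on {0<..} F2"
    and K: "\<And>s. s > 0 \<Longrightarrow> K s = F s - ((F2 s / s - F1 s / s\<^sup>2) * (s\<^sup>2 - \<epsilon>\<^sup>2) / s + 3 * F1 s / s)"
  shows "(\<integral>x. F (soft_norm \<epsilon> x) * (w x - laplace w x) \<partial>lborel) = (\<integral>x. K (soft_norm \<epsilon> x) * w x \<partial>lborel)"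
proof -
  obtain M where M: "\<And>x. w x \<noteq> 0 \<or> laplace w x \<noteq> 0 \<Longrightarrow> norm x \<le> M"
    using test_function_laplace(2)[OF w] by blast
  note c = test_function_continuous[OF w] test_function_laplace(1)[OF w]
  have F1_cont: "continuous_on {0<..} F1"
    using F2 by (meson DERIV_isCont continuous_at_imp_continuous_on greaterThan_iff)
  have F_cont: "continuous_on {0<..} F"
    using F1 by (meson DERIV_isCont continuous_at_imp_continuous_on greaterThan_iff)
  let ?L = "\<lambda>x. (F2 (soft_norm \<epsilon> x) / soft_norm \<epsilon> x - F1 (soft_norm \<epsilon> x) / (soft_norm \<epsilon> x)\<^sup>2) * (norm x)\<^sup>2 / soft_norm \<epsilon> x + 3 * F1 (soft_norm \<epsilon> x) / soft_norm \<epsilon> x"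
  note pos = soft_norm_pos[OF \<epsilon>]
  have nz: "soft_norm \<epsilon> x \<noteq> 0" for x using pos[of x] by simp
  have cc: "continuous_on UNIV (\<lambda>x. g (soft_norm \<epsilon> x))" if "continuous_on {0<..} g" for g :: "real \<Rightarrow> real"
    by (rule continuous_on_compose2[OF that soft_norm_continuous]) (use pos in auto)
  have cL: "continuous_on UNIV ?L"
    by (intro continuous_intros cc F1_cont F2_cont soft_norm_continuous) (simp_all add: nz)
  have int: "integrable lborel (\<lambda>x. F (soft_norm \<epsilon> x) * w x)" "integrable lborel (\<lambda>x. F (soft_norm \<epsilon> x) * laplace w x)"
      "integrable lborel (\<lambda>x. ?L x * w x)"
    using M by (intro integrable_bounded_support[of _ M] continuous_on_mult cc F_cont c cL; force)+
  have KL: "K (soft_norm \<epsilon> x) = F (soft_norm \<epsilon> x) - ?L x" for x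
    using K[OF pos] by (simp add: soft_norm_power2)
  have "(\<integral>x. F (soft_norm \<epsilon> x) * (w x - laplace w x) \<partial>lborel)
      = (\<integral>x. F (soft_norm \<epsilon> x) * w x \<partial>lborel) - (\<integral>x. F (soft_norm \<epsilon> x) * laplace w x \<partial>lborel)"
    using int by (simp add: right_diff_distrib)
  also have "\<dots> = (\<integral>x. F (soft_norm \<epsilon> x) * w x \<partial>lborel) - (\<integral>x. ?L x * w x \<partial>lborel)"
    using laplace_radial[OF \<epsilon> w F1 F2 F2_cont] by simp
  also have "\<dots> = (\<integral>x. K (soft_norm \<epsilon> x) * w x \<partial>lborel)"
    using int unfolding KL by (simp add: left_diff_distrib)
  finally show ?thesis .
qed

text \<open>Away from the origin \<open>(1 - \<Delta>) e\<^bsup>-r\<^esup> = 2 e\<^bsup>-r\<^esup> / r\<close>, and \<open>2 e\<^bsup>-r\<^esup> / r\<close> is \<open>8 \<pi>\<close> times the Yukawa kernel. The smoothed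
identity carries extra terms \<open>\<epsilon>\<^sup>2 / \<rho>\<^sup>2\<close> and \<open>\<epsilon>\<^sup>2 / \<rho>\<^sup>3\<close>; they are at most \<open>1\<close> and \<open>1 / r\<close> and tend to zero pointwise.\<close>

lemma exp_solution:
  assumes w: "test_function w"
  shows "(\<integral>x. exp (- norm x) * (w x - laplace w x) \<partial>lborel) = (\<integral>x. (8 * pi * yukawa x) * w x \<partial>lborel)"
proof -
  obtain B where B: "B > 0" "\<And>x. \<bar>w x\<bar> \<le> B" "\<And>x. \<bar>w x - laplace w x\<bar> \<le> B"
    "integrable lborel w" "integrable lborel (\<lambda>x. w x - laplace w x)"
    and [measurable]: "w \<in> borel_measurable borel" "laplace w \<in> borel_measurable borel"
    using test_function_bounds[OF w] by blast
  define K where "K \<epsilon> s = exp (- s) * (2 / s + \<epsilon>\<^sup>2 / s\<^sup>2 + \<epsilon>\<^sup>2 / s ^ 3)" for \<epsilon> s :: real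
  have eq: "(\<integral>x. exp (- soft_norm (epsilon n) x) * (w x - laplace w x) \<partial>lborel)
      = (\<integral>x. K (epsilon n) (soft_norm (epsilon n) x) * w x \<partial>lborel)" for n
  proof (rule radial_kernel_integral[OF w epsilon(1)])
    show "((\<lambda>s. exp (- s)) has_real_derivative - exp (- s)) (at s)" for s :: real
      by (auto intro!: derivative_eq_intros)
    show "((\<lambda>s. - exp (- s)) has_real_derivative exp (- s)) (at s)" for s :: real
      by (auto intro!: derivative_eq_intros)
    show "continuous_on {0<..} (\<lambda>s::real. exp (- s))" by (intro continuous_intros)
    show "K (epsilon n) s = exp (- s) - ((exp (- s) / s - - exp (- s) / s\<^sup>2) * (s\<^sup>2 - (epsilon n)\<^sup>2) / s + 3 * (- exp (- s)) / s)"
      if "s > 0" for s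
      using that by (simp add: K_def field_simps eval_nat_numeral)
  qed
  have lim1: "(\<lambda>n. \<integral>x. exp (- soft_norm (epsilon n) x) * (w x - laplace w x) \<partial>lborel)
      \<longlonglongrightarrow> (\<integral>x. exp (- norm x) * (w x - laplace w x) \<partial>lborel)"
  proof (rule integral_dominated_convergence)
    show "integrable lborel (\<lambda>x. \<bar>w x - laplace w x\<bar>)" by (intro integrable_abs B)
    show "AE x in lborel. (\<lambda>n. exp (- soft_norm (epsilon n) x) * (w x - laplace w x)) \<longlonglongrightarrow> exp (- norm x) * (w x - laplace w x)"
      by (intro AE_I2 tendsto_intros soft_norm_tendsto)
    show "AE x in lborel. norm (exp (- soft_norm (epsilon n) x) * (w x - laplace w x)) \<le> \<bar>w x - laplace w x\<bar>" for n
      using less_imp_le[OF soft_norm_pos[OF epsilon(1)]] by (intro AE_I2) (auto simp: abs_mult intro!: mult_left_le_one_le)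
  qed measurable
  have lim2: "(\<lambda>n. \<integral>x. K (epsilon n) (soft_norm (epsilon n) x) * w x \<partial>lborel)
      \<longlonglongrightarrow> (\<integral>x. (8 * pi * yukawa x) * w x \<partial>lborel)"
  proof (rule integral_dominated_convergence)
    show "integrable lborel (\<lambda>x. 12 * pi * B * yukawa x + \<bar>w x\<bar>)"
      using integrable_yukawa B by simp
    show "AE x in lborel. (\<lambda>n. K (epsilon n) (soft_norm (epsilon n) x) * w x) \<longlonglongrightarrow> 8 * pi * yukawa x * w x"
      using AE_lborel_singleton[of 0]
    proof eventually_elim
      case (elim x)
      have "(\<lambda>n. K (epsilon n) (soft_norm (epsilon n) x)) \<longlonglongrightarrow>
          exp (- norm x) * (2 / norm x + 0\<^sup>2 / (norm x)\<^sup>2 + 0\<^sup>2 / (norm x) ^ 3)"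
        unfolding K_def using elim by (intro tendsto_intros soft_norm_tendsto epsilon) auto
      then show ?case by (intro tendsto_intros) (simp add: yukawa_def mult.commute)
    qed
    show "AE x in lborel. norm (K (epsilon n) (soft_norm (epsilon n) x) * w x) \<le> 12 * pi * B * yukawa x + \<bar>w x\<bar>" for n
      using AE_lborel_singleton[of 0]
    proof eventually_elim
      case (elim x)
      define s where "s = soft_norm (epsilon n) x"
      define r where "r = norm x"
      have *: "r > 0" "r \<le> s" "epsilon n \<le> s" "epsilon n > 0" "s > 0"
        using elim soft_norm_ge_norm[of x "epsilon n"] soft_norm_ge[OF epsilon(1), of n x] epsilon(1)[of n]
          soft_norm_pos[OF epsilon(1), of n x] by (auto simp: s_def r_def)
      have e2: "(epsilon n)\<^sup>2 / s\<^sup>2 \<le> 1" using * by (simp add: power_mono)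
      have i: "1 / s \<le> 1 / r" using * by (simp add: frac_le)
      have "(epsilon n)\<^sup>2 / s ^ 3 = (epsilon n)\<^sup>2 / s\<^sup>2 * (1 / s)" by (simp add: eval_nat_numeral)
      also have "\<dots> \<le> 1 * (1 / r)" using e2 i * by (intro mult_mono) auto
      finally have e3: "(epsilon n)\<^sup>2 / s ^ 3 \<le> 1 / r" by simp
      have "0 \<le> K (epsilon n) s" using * by (simp add: K_def)
      moreover have "2 / s + (epsilon n)\<^sup>2 / s\<^sup>2 + (epsilon n)\<^sup>2 / s ^ 3 \<le> 3 / r + 1"
        using e2 e3 i times_divide_eq_right[of 2 1 s] times_divide_eq_right[of 3 1 r] by linarith
      then have "K (epsilon n) s \<le> exp (- r) * (3 / r + 1)"
        unfolding K_def using * by (intro mult_mono) auto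
      ultimately have "\<bar>K (epsilon n) s * w x\<bar> \<le> exp (- r) * (3 / r + 1) * \<bar>w x\<bar>"
        by (simp add: abs_mult mult_right_mono)
      also have "\<dots> = 3 * exp (- r) / r * \<bar>w x\<bar> + exp (- r) * \<bar>w x\<bar>" by (simp add: algebra_simps)
      also have "\<dots> \<le> 3 * exp (- r) / r * B + 1 * \<bar>w x\<bar>"
        using * B by (intro add_mono mult_left_mono mult_right_mono) auto
      finally show ?case using * by (simp add: s_def r_def yukawa_def mult_ac)
    qed
  qed (unfold K_def, measurable)
  show ?thesis
    using LIMSEQ_unique[OF lim1 lim2[folded eq]] .
qed

lemma integral_lborel_scale:
  fixes f :: "real^3 \<Rightarrow> real"
  assumes [measurable]: "f \<in> borel_measurable borel" and "\<epsilon> > 0"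
  shows "(\<integral>x. f x \<partial>lborel) = (\<integral>x. \<epsilon> ^ 3 * f (\<epsilon> *\<^sub>R x) \<partial>lborel)"
proof -
  have "lborel = density (distr lborel borel (\<lambda>x::real^3. 0 + \<epsilon> *\<^sub>R x)) (\<lambda>_. ennreal (\<epsilon> ^ 3))"
    using lborel_affine[of \<epsilon> "0::real^3"] assms(2) by (simp add: ennreal_power)
  then have "(\<integral>x. f x \<partial>lborel) = (\<integral>x. f x \<partial>density (distr lborel borel (\<lambda>x::real^3. 0 + \<epsilon> *\<^sub>R x)) (\<lambda>_. ennreal (\<epsilon> ^ 3)))"
    by simp
  also have "\<dots> = (\<integral>x. \<epsilon> ^ 3 * f (0 + \<epsilon> *\<^sub>R x) \<partial>lborel)"
    using assms(2) by (subst integral_real_density, simp, simp, simp, subst integral_distr) auto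
  finally show ?thesis by simp
qed

text \<open>For the smoothed kernel, \<open>1 - \<Delta>\<close> yields \<open>\<epsilon>\<^sup>2 e\<^bsup>-\<rho>\<^esup> (1 / \<rho>\<^sup>3 + 3 / \<rho>\<^sup>4 + 3 / \<rho>\<^sup>5) / (4 \<pi>)\<close>. After scaling \<open>x = \<epsilon> y\<close> this
tends to \<open>3 / (4 \<pi>) (1 + |y|\<^sup>2)\<^bsup>-5/2\<^esup>\<close>, which has mass one, and is dominated by it.\<close>

lemma yukawa_fundamental_solution_at_0:
  assumes w: "test_function w"
  shows "(\<integral>x. yukawa x * (w x - laplace w x) \<partial>lborel) = w 0"
proof -
  obtain B where B: "B > 0" "\<And>x. \<bar>w x\<bar> \<le> B" "\<And>x. \<bar>w x - laplace w x\<bar> \<le> B"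
    "integrable lborel w" "integrable lborel (\<lambda>x. w x - laplace w x)"
    and [measurable]: "w \<in> borel_measurable borel" "laplace w \<in> borel_measurable borel"
    using test_function_bounds[OF w] by blast
  define F where "F s = exp (- s) / (4 * pi * s)" for s :: real
  define F1 where "F1 s = - exp (- s) * (1 / s + 1 / s\<^sup>2) / (4 * pi)" for s :: real
  define F2 where "F2 s = exp (- s) * (1 / s + 2 / s\<^sup>2 + 2 / s ^ 3) / (4 * pi)" for s :: real
  define K where "K \<epsilon> s = \<epsilon>\<^sup>2 * exp (- s) * (1 / s ^ 3 + 3 / s ^ 4 + 3 / s ^ 5) / (4 * pi)" for \<epsilon> s :: real
  have eq: "(\<integral>x. F (soft_norm (epsilon n) x) * (w x - laplace w x) \<partial>lborel)
      = (\<integral>x. K (epsilon n) (soft_norm (epsilon n) x) * w x \<partial>lborel)" for n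
  proof (rule radial_kernel_integral[OF w epsilon(1)])
    show "(F has_real_derivative F1 s) (at s)" if "s > 0" for s
      unfolding F_def[abs_def] F1_def using that
      by (auto intro!: derivative_eq_intros simp: field_simps power2_eq_square)
    show "(F1 has_real_derivative F2 s) (at s)" if "s > 0" for s
      unfolding F1_def[abs_def] F2_def using that
      by (auto intro!: derivative_eq_intros simp: field_simps eval_nat_numeral)
    show "continuous_on {0<..} F2" unfolding F2_def[abs_def] by (auto intro!: continuous_intros)
    show "K (epsilon n) s = F s - ((F2 s / s - F1 s / s\<^sup>2) * (s\<^sup>2 - (epsilon n)\<^sup>2) / s + 3 * F1 s / s)"
      if "s > 0" for s
      using that by (simp add: K_def F_def F1_def F2_def field_simps eval_nat_numeral)
  qed
  have lim1: "(\<lambda>n. \<integral>x. F (soft_norm (epsilon n) x) * (w x - laplace w x) \<partial>lborel)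
      \<longlonglongrightarrow> (\<integral>x. yukawa x * (w x - laplace w x) \<partial>lborel)"
  proof (rule integral_dominated_convergence)
    show "integrable lborel (\<lambda>x. yukawa x * B)" using integrable_yukawa by simp
    show "AE x in lborel. (\<lambda>n. F (soft_norm (epsilon n) x) * (w x - laplace w x)) \<longlonglongrightarrow> yukawa x * (w x - laplace w x)"
      using AE_lborel_singleton[of 0]
    proof eventually_elim
      case (elim x)
      show ?case unfolding F_def yukawa_def
        using elim by (intro tendsto_intros soft_norm_tendsto) auto
    qed
    show "AE x in lborel. norm (F (soft_norm (epsilon n) x) * (w x - laplace w x)) \<le> yukawa x * B" for n
      using AE_lborel_singleton[of 0]
    proof eventually_elim
      case (elim x)
      have "F (soft_norm (epsilon n) x) \<le> yukawa x" "0 \<le> F (soft_norm (epsilon n) x)"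
        unfolding F_def yukawa_def using elim soft_norm_ge_norm[of x "epsilon n"] soft_norm_pos[OF epsilon(1), of n x]
        by (auto intro!: frac_le)
      then show ?case using B by (auto simp: abs_mult yukawa_nonneg intro!: mult_mono)
    qed
  qed (unfold F_def, measurable)
  let ?P = "\<lambda>y::real^3. 3 / (4 * pi * sqrt (1 + (norm y)\<^sup>2) ^ 5)"
  have scale: "soft_norm \<epsilon> (\<epsilon> *\<^sub>R y) = \<epsilon> * sqrt (1 + (norm y)\<^sup>2)" if "\<epsilon> > 0" for \<epsilon> y
  proof -
    have "\<epsilon>\<^sup>2 + (norm (\<epsilon> *\<^sub>R y))\<^sup>2 = \<epsilon>\<^sup>2 * (1 + (norm y)\<^sup>2)"
      by (simp add: power_mult_distrib algebra_simps)
    then show ?thesis using that by (simp add: soft_norm_def real_sqrt_mult)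
  qed
  have Kscale: "\<epsilon> ^ 3 * K \<epsilon> (soft_norm \<epsilon> (\<epsilon> *\<^sub>R y)) =
      (let s = sqrt (1 + (norm y)\<^sup>2); t = \<epsilon> * s in exp (- t) * (t\<^sup>2 / 3 + t + 1) * (3 / (4 * pi * s ^ 5)))"
    if "\<epsilon> > 0" for \<epsilon> y
  proof -
    have "\<epsilon> ^ 3 * K \<epsilon> (\<epsilon> * s) = exp (- (\<epsilon> * s)) * ((\<epsilon> * s)\<^sup>2 / 3 + \<epsilon> * s + 1) * (3 / (4 * pi * s ^ 5))"
      if "s > 0" for s
      unfolding K_def using that \<open>\<epsilon> > 0\<close> by (simp add: field_simps eval_nat_numeral)
    moreover have "sqrt (1 + (norm y)\<^sup>2) > 0" by (simp add: add_pos_nonneg)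
    ultimately show ?thesis
      unfolding scale[OF that] Let_def by blast
  qed
  have [measurable]: "K \<epsilon> \<in> borel_measurable borel" for \<epsilon>
    unfolding K_def[abs_def] by measurable
  have lim2: "(\<lambda>n. \<integral>y. epsilon n ^ 3 * (K (epsilon n) (soft_norm (epsilon n) (epsilon n *\<^sub>R y)) * w (epsilon n *\<^sub>R y)) \<partial>lborel)
      \<longlonglongrightarrow> (\<integral>y. ?P y * w 0 \<partial>lborel)"
  proof (rule integral_dominated_convergence)
    show "integrable lborel (\<lambda>y. ?P y * B)" by (intro integrable_mult_left soft_profile)
    show "AE y in lborel. (\<lambda>n. epsilon n ^ 3 * (K (epsilon n) (soft_norm (epsilon n) (epsilon n *\<^sub>R y)) * w (epsilon n *\<^sub>R y))) \<longlonglongrightarrow> ?P y * w 0"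
    proof (rule AE_I2)
      fix y :: "real^3"
      have "(\<lambda>n. epsilon n * sqrt (1 + (norm y)\<^sup>2)) \<longlonglongrightarrow> 0 * sqrt (1 + (norm y)\<^sup>2)"
        by (intro tendsto_intros epsilon)
      then have t0: "(\<lambda>n. epsilon n * sqrt (1 + (norm y)\<^sup>2)) \<longlonglongrightarrow> 0" by simp
      have t: "(\<lambda>n. exp (- t n) * ((t n)\<^sup>2 / 3 + t n + 1) * p) \<longlonglongrightarrow> p"
        if "t \<longlonglongrightarrow> 0" for t and p :: real
      proof -
        have "(\<lambda>n. exp (- t n) * ((t n)\<^sup>2 / 3 + t n + 1) * p) \<longlonglongrightarrow> exp (- 0) * (0\<^sup>2 / 3 + 0 + 1) * p"
          by (intro tendsto_intros that) auto
        then show ?thesis by simp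
      qed
      have w_cont: "isCont w 0"
        using test_function_continuous[OF w, of UNIV] by (simp add: continuous_on_eq_continuous_at)
      have "(\<lambda>n. epsilon n *\<^sub>R y) \<longlonglongrightarrow> 0 *\<^sub>R y"
        by (intro tendsto_intros epsilon)
      then have y0: "(\<lambda>n. epsilon n *\<^sub>R y) \<longlonglongrightarrow> 0" by simp
      have w0: "(\<lambda>n. w (epsilon n *\<^sub>R y)) \<longlonglongrightarrow> w 0"
        by (rule isCont_tendsto_compose[OF w_cont y0])
      have K0: "(\<lambda>n. epsilon n ^ 3 * K (epsilon n) (soft_norm (epsilon n) (epsilon n *\<^sub>R y))) \<longlonglongrightarrow> ?P y"
        unfolding Kscale[OF epsilon(1)] Let_def by (rule t[OF t0])
      have "(\<lambda>n. epsilon n ^ 3 * K (epsilon n) (soft_norm (epsilon n) (epsilon n *\<^sub>R y)) * w (epsilon n *\<^sub>R y)) \<longlonglongrightarrow> ?P y * w 0"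
        by (rule tendsto_mult[OF K0 w0])
      then show "(\<lambda>n. epsilon n ^ 3 * (K (epsilon n) (soft_norm (epsilon n) (epsilon n *\<^sub>R y)) * w (epsilon n *\<^sub>R y))) \<longlonglongrightarrow> ?P y * w 0"
        unfolding mult.assoc .
    qed
    show "AE y in lborel. norm (epsilon n ^ 3 * (K (epsilon n) (soft_norm (epsilon n) (epsilon n *\<^sub>R y)) * w (epsilon n *\<^sub>R y))) \<le> ?P y * B" for n
    proof (rule AE_I2)
      fix y :: "real^3"
      define t where "t = epsilon n * sqrt (1 + (norm y)\<^sup>2)"
      have t: "t \<ge> 0" using epsilon(1)[of n] by (simp add: t_def)
      \<comment> \<open>This comparison with the exponential series is what makes the limit profile a majorant.\<close>
      have "t\<^sup>2 / 3 + t + 1 \<le> exp t"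
        using exp_lower_Taylor_quadratic[OF t] t zero_le_power2[of t] by linarith
      then have "exp (- t) * (t\<^sup>2 / 3 + t + 1) \<le> exp (- t) * exp t"
        by (intro mult_left_mono) auto
      then have le: "exp (- t) * (t\<^sup>2 / 3 + t + 1) \<le> 1" by (simp add: exp_minus)
      have P: "?P y \<ge> 0" by simp
      have "\<bar>exp (- t) * (t\<^sup>2 / 3 + t + 1) * ?P y * w (epsilon n *\<^sub>R y)\<bar> \<le> 1 * ?P y * B"
        unfolding abs_mult using le t P B(1,2) by (intro mult_mono) auto
      then show "norm (epsilon n ^ 3 * (K (epsilon n) (soft_norm (epsilon n) (epsilon n *\<^sub>R y)) * w (epsilon n *\<^sub>R y))) \<le> ?P y * B"
        unfolding mult.assoc[symmetric] Kscale[OF epsilon(1)] Let_def t_def[symmetric] by simp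
    qed
  qed measurable
  have "(\<integral>x. K (epsilon n) (soft_norm (epsilon n) x) * w x \<partial>lborel)
      = (\<integral>y. epsilon n ^ 3 * (K (epsilon n) (soft_norm (epsilon n) (epsilon n *\<^sub>R y)) * w (epsilon n *\<^sub>R y)) \<partial>lborel)" for n
    by (rule integral_lborel_scale) (auto intro: epsilon)
  then have "(\<integral>x. yukawa x * (w x - laplace w x) \<partial>lborel) = (\<integral>y. ?P y * w 0 \<partial>lborel)"
    using LIMSEQ_unique[OF lim1[unfolded eq]] lim2 by simp
  also have "\<dots> = (\<integral>y. ?P y \<partial>lborel) * w 0" by (rule integral_mult_left_zero)
  also have "\<dots> = w 0" by (simp only: soft_profile(2) mult_1)
  finally show ?thesis .
qed

section \<open>The resolvent and the second order Sobolev space\<close>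

lemma laplace_translate: "laplace (\<lambda>x. w (x + z)) = (\<lambda>x. laplace w (x + z))"
  by (simp add: laplace_def fun_eq_iff partial_deriv_translate)

lemma sq_int_helmholtz:
  assumes "test_function w"
  shows "sq_int (laplace w)" "sq_int (\<lambda>x. w x - laplace w x)"
proof -
  obtain M where M: "\<And>x. w x \<noteq> 0 \<or> laplace w x \<noteq> 0 \<Longrightarrow> norm x \<le> M"
    using test_function_laplace(2)[OF assms] by blast
  note c = test_function_continuous[OF assms] test_function_laplace(1)[OF assms]
  have sq: "sq_int f" if "continuous_on UNIV f" "\<And>x. f x \<noteq> 0 \<Longrightarrow> norm x \<le> M" for f :: "real^3 \<Rightarrow> real"
    unfolding sq_int_def using that
    by (intro conjI borel_measurable_continuous_onI integrable_bounded_support[of _ M] continuous_intros) auto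
  show "sq_int (laplace w)" "sq_int (\<lambda>x. w x - laplace w x)"
    using M by (intro sq continuous_intros c; force)+
qed

lemma helmholtz_bounded:
  assumes "test_function w"
  shows "\<exists>B. \<forall>x. \<bar>w x - laplace w x\<bar> \<le> B"
    and test_function_measurable: "w \<in> borel_measurable borel"
    and laplace_measurable: "laplace w \<in> borel_measurable borel"
  by (rule test_function_bounds[OF assms], blast)+

lemma inner_tensor_tensor:
  assumes "sq_int \<phi>" "sq_int \<psi>"
  shows "inner (tensor \<phi> c) (tensor \<psi> d) = inner c d * (\<integral>x. \<phi> x * \<psi> x \<partial>lborel)"
proof -
  have "inner (tensor \<phi> c) (tensor \<psi> d) = (\<integral>x. inner (\<phi> x *\<^sub>R c) (\<psi> x *\<^sub>R d) \<partial>lborel)"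
    unfolding tensor_def by (intro inner_L2_abs square_integrable_tensor assms)
  also have "\<dots> = (\<integral>x. inner c d * (\<phi> x * \<psi> x) \<partial>lborel)" by (simp add: mult_ac)
  also have "\<dots> = inner c d * (\<integral>x. \<phi> x * \<psi> x \<partial>lborel)" by (rule integral_mult_right_zero)
  finally show ?thesis .
qed

text \<open>The fundamental solution at the origin, applied to translates of \<open>w\<close>.\<close>

lemma resolvent_helmholtz_tensor:
  assumes w: "test_function w"
  shows "resolvent (tensor (\<lambda>x. w x - laplace w x) c) = tensor w c"
proof -
  let ?h = "\<lambda>x. w x - laplace w x"
  have m [measurable]: "?h \<in> borel_measurable borel" using sq_int_helmholtz(2)[OF w] by (simp add: sq_int_def)
  have "conv (tensor ?h c) x = w x *\<^sub>R c" for x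
  proof -
    have "conv (tensor ?h c) x = (\<integral>y. yukawa (x - y) *\<^sub>R (?h y *\<^sub>R c) \<partial>lborel)"
      unfolding conv_def
      by (rule integral_cong_AE) (use AE_rep_tensor[OF sq_int_helmholtz(2)[OF w], of c] in \<open>auto elim!: eventually_mono\<close>)
    also have "\<dots> = (\<integral>y. (yukawa (x - y) * ?h y) *\<^sub>R c \<partial>lborel)" by simp
    also have "\<dots> = (\<integral>y. (yukawa (x - (y + x)) * ?h (y + x)) *\<^sub>R c \<partial>lborel)"
      using integral_lborel_translate[of "\<lambda>y. (yukawa (x - y) * ?h y) *\<^sub>R c" x] by simp
    also have "\<dots> = (\<integral>y. (yukawa y * (w (y + x) - laplace (\<lambda>y. w (y + x)) y)) *\<^sub>R c \<partial>lborel)"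
      by (simp add: laplace_translate)
    also have "\<dots> = (\<integral>y. yukawa y * (w (y + x) - laplace (\<lambda>y. w (y + x)) y) \<partial>lborel) *\<^sub>R c"
    proof (rule integral_scaleR_left)
      note tw = test_function_translate[OF w, of x]
      obtain B where B: "\<And>y. \<bar>w (y + x) - laplace (\<lambda>y. w (y + x)) y\<bar> \<le> B"
        using helmholtz_bounded(1)[OF tw] by blast
      show "integrable lborel (\<lambda>y. yukawa y * (w (y + x) - laplace (\<lambda>y. w (y + x)) y))"
      proof (rule Bochner_Integration.integrable_bound)
        show "integrable lborel (\<lambda>y. yukawa y * B)" using integrable_yukawa by simp
        show "AE y in lborel. norm (yukawa y * (w (y + x) - laplace (\<lambda>y. w (y + x)) y)) \<le> norm (yukawa y * B)"
          by (intro AE_I2) (simp add: abs_mult yukawa_nonneg mult_left_mono order_trans[OF B abs_ge_self])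
        have [measurable]: "(\<lambda>y. w (y + x) - laplace (\<lambda>y. w (y + x)) y) \<in> borel_measurable borel"
          using sq_int_helmholtz(2)[OF tw] by (simp add: sq_int_def)
        show "(\<lambda>y. yukawa y * (w (y + x) - laplace (\<lambda>y. w (y + x)) y)) \<in> borel_measurable lborel" by measurable
      qed
    qed
    also have "\<dots> = w x *\<^sub>R c"
      using yukawa_fundamental_solution_at_0[OF test_function_translate[OF w, of x]] by simp
    finally show ?thesis .
  qed
  then have "conv (tensor ?h c) = (\<lambda>x. w x *\<^sub>R c)" by blast
  then show ?thesis by (simp add: resolvent_def tensor_def)
qed

lemma weak_deriv_unique:
  assumes "weak_deriv i f g" "weak_deriv i f h"
  shows "g = h"
proof -
  have "inner (tensor \<phi> c) (g - h) = 0" if "\<phi> \<in> bumps" for \<phi> c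
    using assms bumps_test_function[OF that] unfolding weak_deriv_iff inner_diff_right
    by (metis neg_equal_iff_equal right_minus_eq)
  then show ?thesis using L2_eq_0_if_orthogonal_bumps[of "g - h"] by simp
qed

lemma weak_partial_eq: "weak_deriv i f g \<Longrightarrow> weak_partial i f = g"
  unfolding weak_partial_def using weak_deriv_unique by blast

lemma weak_deriv_zero: "weak_deriv i 0 0"
  by (simp add: weak_deriv_iff)

lemma weak_deriv_add: "weak_deriv i f f' \<Longrightarrow> weak_deriv i g g' \<Longrightarrow> weak_deriv i (f + g) (f' + g')"
  by (simp add: weak_deriv_iff inner_add_right)

lemma weak_deriv_scaleR: "weak_deriv i f f' \<Longrightarrow> weak_deriv i (r *\<^sub>R f) (r *\<^sub>R f')"
  by (simp add: weak_deriv_iff)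

lemma weak_deriv_diff: "weak_deriv i f f' \<Longrightarrow> weak_deriv i g g' \<Longrightarrow> weak_deriv i (f - g) (f' - g')"
  by (simp add: weak_deriv_iff inner_diff_right)

lemma weak_deriv_limit:
  assumes "\<And>n. weak_deriv i (f n) (g n)" "f \<longlonglongrightarrow> f'" "g \<longlonglongrightarrow> g'"
  shows "weak_deriv i f' g'"
  unfolding weak_deriv_iff
proof (intro allI impI)
  fix \<phi> and c :: "complex^'a" assume \<phi>: "test_function \<phi>"
  have "(\<lambda>n. inner (tensor (partial_deriv i \<phi>) c) (f n)) \<longlonglongrightarrow> inner (tensor (partial_deriv i \<phi>) c) f'"
    by (intro tendsto_intros assms)
  moreover have "(\<lambda>n. - inner (tensor \<phi> c) (g n)) \<longlonglongrightarrow> - inner (tensor \<phi> c) g'"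
    by (intro tendsto_intros assms)
  moreover have "inner (tensor (partial_deriv i \<phi>) c) (f n) = - inner (tensor \<phi> c) (g n)" for n
    using assms(1) \<phi> by (simp add: weak_deriv_iff)
  ultimately show "inner (tensor (partial_deriv i \<phi>) c) f' = - inner (tensor \<phi> c) g'"
    using LIMSEQ_unique by auto
qed

lemma weak_deriv_tensor:
  assumes "test_function \<phi>"
  shows "weak_deriv i (tensor \<phi> c) (tensor (partial_deriv i \<phi>) c)"
  unfolding weak_deriv_iff
proof (intro allI impI)
  fix \<psi> and d :: "complex^'a" assume \<psi>: "test_function \<psi>"
  obtain M where M: "\<And>x. \<phi> x \<noteq> 0 \<Longrightarrow> norm x \<le> M"
    using test_function_support[OF assms] by blast
  note t = test_function_partial_deriv[OF assms] test_function_partial_deriv[OF \<psi>]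
  have "(\<integral>x. partial_deriv i \<psi> x * \<phi> x \<partial>lborel) = - (\<integral>x. \<psi> x * partial_deriv i \<phi> x \<partial>lborel)"
    by (rule integral_by_parts[of _ _ _ M]) (auto intro: test_function_differentiable test_function_continuous t assms \<psi> M)
  then show "inner (tensor (partial_deriv i \<psi>) d) (tensor \<phi> c) = - inner (tensor \<psi> d) (tensor (partial_deriv i \<phi>) c)"
    by (simp add: inner_tensor_tensor sq_int_test_function t assms \<psi>)
qed

text \<open>A dense space on which weak derivatives are classical, stay in the space and commute. The
real span suffices, because \<open>c\<close> runs through all complex vectors.\<close>

definition bump_space :: "'n::finite L2 set" where
  "bump_space = span {tensor \<phi> c | \<phi> c. \<phi> \<in> bumps}"

lemma bump_space_dense: "closure bump_space = UNIV"
proof (rule dense_subspaceI)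
  show "subspace bump_space" by (simp add: bump_space_def)
  fix h :: "'a L2" assume h: "\<And>s. s \<in> bump_space \<Longrightarrow> inner h s = 0"
  show "h = 0"
  proof (rule L2_eq_0_if_orthogonal_bumps)
    fix \<phi> and c :: "complex^'a" assume "\<phi> \<in> bumps"
    then have "tensor \<phi> c \<in> bump_space" unfolding bump_space_def by (intro span_base) auto
    then show "inner (tensor \<phi> c) h = 0" by (subst inner_commute) (rule h)
  qed
qed

lemma bump_space_induct [consumes 1, case_names zero add scale bump]:
  assumes "u \<in> bump_space" "P 0" "\<And>u v. u \<in> bump_space \<Longrightarrow> v \<in> bump_space \<Longrightarrow> P u \<Longrightarrow> P v \<Longrightarrow> P (u + v)"
    "\<And>r u. u \<in> bump_space \<Longrightarrow> P u \<Longrightarrow> P (r *\<^sub>R u)" "\<And>\<phi> c. \<phi> \<in> bumps \<Longrightarrow> P (tensor \<phi> c)"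
  shows "P u"
proof -
  have "u \<in> bump_space \<and> P u"
    using assms(1) unfolding bump_space_def
  proof (induction rule: span_induct)
    show "subspace {u. u \<in> span {tensor \<phi> c | \<phi> c. \<phi> \<in> bumps} \<and> P u}"
      using assms(2-4) unfolding bump_space_def
      by (intro subspaceI) (auto intro: span_zero span_add span_scale)
  qed (auto intro: span_base assms)
  then show ?thesis ..
qed

lemma bump_space_weak_partial:
  assumes "u \<in> bump_space"
  shows "weak_deriv i u (weak_partial i u)" "weak_partial i u \<in> bump_space"
proof -
  have "\<exists>v\<in>bump_space. weak_deriv i u v"
    using assms
  proof (induction rule: bump_space_induct)
    case zero
    then show ?case unfolding bump_space_def by (intro bexI[of _ 0] weak_deriv_zero span_zero)
  next
    case (add u v)
    then show ?case unfolding bump_space_def by (meson weak_deriv_add span_add)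
  next
    case (scale r u)
    then show ?case unfolding bump_space_def by (meson weak_deriv_scaleR span_scale)
  next
    case (bump \<phi> c)
    then have "tensor (partial_deriv i \<phi>) c \<in> bump_space"
      unfolding bump_space_def by (intro span_base) (auto intro: bumps_partial_deriv)
    then show ?case using weak_deriv_tensor[OF bumps_test_function[OF bump]] by blast
  qed
  then show "weak_deriv i u (weak_partial i u)" "weak_partial i u \<in> bump_space"
    using weak_partial_eq by blast+
qed

lemma bump_space_sub: "u \<in> bump_space \<Longrightarrow> v \<in> bump_space \<Longrightarrow> u - v \<in> bump_space"
  unfolding bump_space_def by (rule span_diff)

lemma weak_partial_add: "u \<in> bump_space \<Longrightarrow> v \<in> bump_space \<Longrightarrow> weak_partial i (u + v) = weak_partial i u + weak_partial i v"
  by (intro weak_partial_eq weak_deriv_add bump_space_weak_partial)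

lemma weak_partial_diff: "u \<in> bump_space \<Longrightarrow> v \<in> bump_space \<Longrightarrow> weak_partial i (u - v) = weak_partial i u - weak_partial i v"
  by (intro weak_partial_eq weak_deriv_diff bump_space_weak_partial)

lemma weak_partial_scale: "u \<in> bump_space \<Longrightarrow> weak_partial i (r *\<^sub>R u) = r *\<^sub>R weak_partial i u"
  by (intro weak_partial_eq weak_deriv_scaleR bump_space_weak_partial)

lemma weak_partial_tensor: "test_function \<phi> \<Longrightarrow> weak_partial i (tensor \<phi> c) = tensor (partial_deriv i \<phi>) c"
  by (intro weak_partial_eq weak_deriv_tensor)

text \<open>The boundary terms vanish because \<open>u\<close> has bounded support. The lemma is used with resolvents in the place
of \<open>v\<close>, whose support is unbounded.\<close>

lemma bump_space_inner_by_parts: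
  assumes "u \<in> bump_space" and v: "weak_deriv i v v'"
  shows "inner (weak_partial i u) v = - inner u v'"
  using assms(1)
proof (induction rule: bump_space_induct)
  case zero
  then show ?case by (simp add: weak_partial_eq[OF weak_deriv_zero])
next
  case (bump \<phi> c)
  then show ?case
    using v bumps_test_function[OF bump] by (simp add: weak_partial_tensor weak_deriv_iff)
qed (auto simp: weak_partial_add weak_partial_scale inner_add_left)

lemma bump_space_commute:
  assumes "u \<in> bump_space"
  shows "weak_partial i (weak_partial j u) = weak_partial j (weak_partial i u)"
  using assms
proof (induction rule: bump_space_induct)
  case zero
  then show ?case by (simp add: weak_partial_eq[OF weak_deriv_zero])
next
  case (bump \<phi> c)
  then show ?case
    using bumps_test_function[OF bump] elementary_partial_deriv_commute[of \<phi> i j]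
    by (simp add: weak_partial_tensor test_function_partial_deriv bumps_def)
qed (auto simp: weak_partial_add weak_partial_scale bump_space_weak_partial)

lemma laplacian_tensor:
  assumes "test_function \<phi>"
  shows "laplacian (tensor \<phi> c) = tensor (laplace \<phi>) c"
proof -
  have t: "test_function (partial_deriv i (partial_deriv i \<phi>))" for i
    by (intro test_function_partial_deriv assms)
  have "(\<Sum>i\<in>A. tensor (partial_deriv i (partial_deriv i \<phi>)) c) = tensor (\<lambda>x. \<Sum>i\<in>A. partial_deriv i (partial_deriv i \<phi>) x) c
      \<and> sq_int (\<lambda>x. \<Sum>i\<in>A. partial_deriv i (partial_deriv i \<phi>) x)" if "finite A" for A
    using that
  proof (induction rule: finite_induct)
    case empty
    then show ?case by (simp add: tensor_def sq_int_def zero_L2_def)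
  next
    case (insert i A)
    then show ?case
      using tensor_add_left[OF sq_int_test_function[OF t[of i]], of "\<lambda>x. \<Sum>i\<in>A. partial_deriv i (partial_deriv i \<phi>) x" c]
        sq_int_add[OF sq_int_test_function[OF t[of i]], of "\<lambda>x. \<Sum>i\<in>A. partial_deriv i (partial_deriv i \<phi>) x"]
      by simp
  qed
  then show ?thesis
    unfolding laplacian_def laplace_def[abs_def]
    by (simp add: weak_partial_tensor assms test_function_partial_deriv)
qed

lemma resolvent_linear: "bounded_linear resolvent"
proof (rule bounded_linear_intro[of _ 1])
  show "resolvent (r *\<^sub>R f) = r *\<^sub>R resolvent f" for r :: real and f :: "'a L2"
    using resolvent_scaleC[of "complex_of_real r" f] by (simp add: scaleC_of_real)
qed (auto simp: resolvent_add norm_resolvent_le)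

lemmas resolvent_diff = linear_diff[OF bounded_linear.linear[OF resolvent_linear]]
lemmas resolvent_sum = linear_sum[OF bounded_linear.linear[OF resolvent_linear]]
lemmas resolvent_0 = linear_0[OF bounded_linear.linear[OF resolvent_linear]]
lemmas resolvent_scaleR = linear_scale[OF bounded_linear.linear[OF resolvent_linear]]

lemma bump_space_resolvent:
  assumes "u \<in> bump_space"
  shows "resolvent (laplacian u) = resolvent u - u"
  using assms
proof (induction rule: bump_space_induct)
  case zero
  then show ?case by (simp add: laplacian_def weak_partial_eq[OF weak_deriv_zero] resolvent_0)
next
  case (add u v)
  then show ?case
    by (simp add: laplacian_def weak_partial_add bump_space_weak_partial sum.distrib resolvent_add)
next
  case (scale r u)
  then show ?case
    by (simp add: laplacian_def weak_partial_scale bump_space_weak_partial resolvent_scaleR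
        scaleR_diff_right flip: scaleR_sum_right)
next
  case (bump \<phi> c)
  note w = bumps_test_function[OF bump]
  have neg: "sq_int (\<lambda>x. - 1 * laplace \<phi> x)" by (intro sq_int_scale sq_int_helmholtz w)
  have "tensor (\<lambda>x. \<phi> x - laplace \<phi> x) c = tensor \<phi> c - tensor (laplace \<phi>) c"
    using tensor_add_left[OF sq_int_test_function[OF w] neg, of c] tensor_scaleR_left[OF sq_int_helmholtz(1)[OF w], of "-1" c]
    by simp
  then have "resolvent (tensor \<phi> c) - resolvent (tensor (laplace \<phi>) c) = tensor \<phi> c"
    by (simp only: resolvent_diff[symmetric] resolvent_helmholtz_tensor[OF w, of c, symmetric])
  then show ?case by (simp add: laplacian_tensor[OF w] algebra_simps)
qed

text \<open>Symmetry moves one resolvent to the right, the derivative crosses \<open>R R v\<close>, and symmetry moves the resolvent back.\<close>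

lemma resolvent_by_parts:
  assumes u: "u \<in> bump_space" and v: "v \<in> bump_space"
  shows "inner (resolvent (weak_partial i u)) (resolvent v) = - inner (resolvent u) (resolvent (weak_partial i v))"
proof -
  have "inner (resolvent (weak_partial i u)) (resolvent v) = inner (weak_partial i u) (resolvent (resolvent v))"
    by (rule inner_resolvent_symmetric)
  also have "\<dots> = - inner u (resolvent (resolvent (weak_partial i v)))"
    by (intro bump_space_inner_by_parts u weak_deriv_resolvent bump_space_weak_partial v)
  finally show ?thesis by (simp add: inner_resolvent_symmetric)
qed

text \<open>\<open>\<Sum>\<^sub>i \<parallel>R \<partial>\<^sub>i u\<parallel>\<^sup>2 = - (R u, R \<Delta> u) = (R u, u) - \<parallel>R u\<parallel>\<^sup>2\<close>. The constant agrees with that for second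
derivatives below, so that both bounds feed the same completeness argument.\<close>

lemma norm_resolvent_partial_le:
  assumes u: "u \<in> bump_space"
  shows "norm (resolvent (weak_partial i u)) \<le> 2 * norm u"
proof -
  let ?D = weak_partial
  have "(norm (resolvent (?D i u)))\<^sup>2 \<le> (\<Sum>i\<in>UNIV. (norm (resolvent (?D i u)))\<^sup>2)"
    by (rule member_le_sum) auto
  also have "\<dots> = (\<Sum>i\<in>UNIV. - inner (resolvent u) (resolvent (?D i (?D i u))))"
    unfolding power2_norm_eq_inner using resolvent_by_parts[OF u bump_space_weak_partial(2)[OF u]] by simp
  also have "\<dots> = - inner (resolvent u) (resolvent (laplacian u))"
    by (simp add: laplacian_def resolvent_sum inner_sum_right sum_negf)
  also have "\<dots> = inner (resolvent u) u - inner (resolvent u) (resolvent u)"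
    by (simp add: bump_space_resolvent[OF u] inner_diff_right)
  also have "\<dots> \<le> inner (resolvent u) u" by simp
  also have "\<dots> \<le> norm (resolvent u) * norm u" by (rule norm_cauchy_schwarz)
  also have "\<dots> \<le> norm u * norm u" by (intro mult_right_mono norm_resolvent_le) auto
  also have "\<dots> \<le> (2 * norm u)\<^sup>2" by (simp add: power2_eq_square)
  finally show ?thesis by (rule power2_le_imp_le) simp
qed

text \<open>The key estimate. Since partial derivatives commute on \<open>bump_space\<close>, two integrations by parts turn
\<open>\<parallel>R \<partial>\<^sub>i \<partial>\<^sub>j u\<parallel>\<^sup>2\<close> into \<open>(R \<partial>\<^sub>j \<partial>\<^sub>j u, R \<partial>\<^sub>i \<partial>\<^sub>i u)\<close>, and the sum over \<open>i, j\<close> is \<open>\<parallel>R \<Delta> u\<parallel>\<^sup>2 = \<parallel>R u - u\<parallel>\<^sup>2\<close>.\<close>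

lemma norm_resolvent_partial_partial_le:
  assumes u: "u \<in> bump_space"
  shows "norm (resolvent (weak_partial i (weak_partial j u))) \<le> 2 * norm u"
proof -
  let ?D = weak_partial
  note b = bump_space_weak_partial(2)
  have eq: "(norm (resolvent (?D i (?D j u))))\<^sup>2 = inner (resolvent (?D j (?D j u))) (resolvent (?D i (?D i u)))" for i j
  proof -
    have "(norm (resolvent (?D i (?D j u))))\<^sup>2 = - inner (resolvent (?D j u)) (resolvent (?D i (?D i (?D j u))))"
      unfolding power2_norm_eq_inner by (intro resolvent_by_parts b u)
    also have "?D i (?D i (?D j u)) = ?D j (?D i (?D i u))"
      by (simp add: bump_space_commute[of _ i j] b u)
    also have "- inner (resolvent (?D j u)) (resolvent (?D j (?D i (?D i u)))) =
        inner (resolvent (?D j (?D j u))) (resolvent (?D i (?D i u)))"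
      using resolvent_by_parts[OF b[OF u] b[OF b[OF u]], of j j i i] by simp
    finally show ?thesis .
  qed
  have "(norm (resolvent (?D i (?D j u))))\<^sup>2 \<le> (\<Sum>i\<in>UNIV. (norm (resolvent (?D i (?D j u))))\<^sup>2)"
    by (rule member_le_sum[of i UNIV "\<lambda>i. (norm (resolvent (?D i (?D j u))))\<^sup>2"]) auto
  also have "\<dots> \<le> (\<Sum>j\<in>UNIV. \<Sum>i\<in>UNIV. (norm (resolvent (?D i (?D j u))))\<^sup>2)"
    by (rule member_le_sum[of j UNIV "\<lambda>j. \<Sum>i\<in>UNIV. (norm (resolvent (?D i (?D j u))))\<^sup>2"]) (auto intro: sum_nonneg)
  also have "\<dots> = inner (resolvent (laplacian u)) (resolvent (laplacian u))"
    unfolding eq by (simp add: laplacian_def resolvent_sum inner_sum_right inner_sum_left)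
      (subst sum.swap, simp)
  also have "\<dots> = (norm (resolvent u - u))\<^sup>2"
    by (simp add: bump_space_resolvent[OF u] power2_norm_eq_inner)
  also have "\<dots> \<le> (2 * norm u)\<^sup>2"
    using norm_triangle_ineq4[of "resolvent u" u] norm_resolvent_le[of u] by (intro power_mono) auto
  finally show ?thesis by (rule power2_le_imp_le) simp
qed

lemma convergent_bounded_on_bump_space:
  fixes L :: "'n::finite L2 \<Rightarrow> 'n L2"
  assumes diff: "\<And>u v. u \<in> bump_space \<Longrightarrow> v \<in> bump_space \<Longrightarrow> L (u - v) = L u - L v"
    and bound: "\<And>u. u \<in> bump_space \<Longrightarrow> norm (L u) \<le> 2 * norm u"
    and u: "\<And>n. u n \<in> bump_space" "u \<longlonglongrightarrow> g"
  obtains v where "(\<lambda>n. L (u n)) \<longlonglongrightarrow> v"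
proof -
  have "Cauchy u" using u(2) by (rule LIMSEQ_imp_Cauchy)
  have "Cauchy (\<lambda>n. L (u n))"
  proof (rule metric_CauchyI)
    fix e :: real assume "e > 0"
    then obtain N where N: "\<And>m n. m \<ge> N \<Longrightarrow> n \<ge> N \<Longrightarrow> dist (u m) (u n) < e / 2"
      using metric_CauchyD[OF \<open>Cauchy u\<close>, of "e / 2"] by auto
    have "dist (L (u m)) (L (u n)) < e" if "m \<ge> N" "n \<ge> N" for m n
      using bound[OF bump_space_sub[OF u(1) u(1)], of m n] N[OF that] diff[OF u(1) u(1), of m n]
      by (simp add: dist_norm)
    then show "\<exists>N. \<forall>m\<ge>N. \<forall>n\<ge>N. dist (L (u m)) (L (u n)) < e" by blast
  qed
  then show ?thesis using that Cauchy_convergent_iff convergent_def by blast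
qed

lemma sobolev_2_iff: "f \<in> sobolev 2 \<longleftrightarrow> (\<exists>f1 f2. \<forall>i. weak_deriv i f (f1 i) \<and> (\<forall>j. weak_deriv j (f1 i) (f2 i j)))"
  by (simp add: numeral_2_eq_2) metis

lemma laplacian_eq:
  assumes "\<And>i. weak_deriv i f (f1 i)" "\<And>i. weak_deriv i (f1 i) (f2 i)"
  shows "laplacian f = (\<Sum>i\<in>UNIV. f2 i)"
  unfolding laplacian_def using assms weak_partial_eq by (metis (no_types, lifting))

text \<open>Approximate \<open>g\<close> by bumps. By the two bounds the derivatives of the resolvents form Cauchy
sequences, and weak derivatives are closed under limits.\<close>

theorem resolvent_in_sobolev:
  fixes g :: "'n::finite L2"
  shows "resolvent g \<in> sobolev 2" "laplacian (resolvent g) = resolvent g - g"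
proof -
  let ?D = weak_partial
  note b = bump_space_weak_partial
  have "g \<in> closure bump_space" using bump_space_dense by auto
  then obtain u where u: "\<And>n. u n \<in> bump_space" "u \<longlonglongrightarrow> g"
    unfolding closure_sequential by blast
  have "\<exists>v. (\<lambda>n. resolvent (?D i (u n))) \<longlonglongrightarrow> v" for i
    using convergent_bounded_on_bump_space[of "\<lambda>u. resolvent (?D i u)", OF _ norm_resolvent_partial_le u]
    by (metis resolvent_diff weak_partial_diff)
  then obtain v1 where v1: "\<And>i. (\<lambda>n. resolvent (?D i (u n))) \<longlonglongrightarrow> v1 i" by metis
  have "\<exists>v. (\<lambda>n. resolvent (?D j (?D i (u n)))) \<longlonglongrightarrow> v" for i j
    using convergent_bounded_on_bump_space[of "\<lambda>u. resolvent (?D j (?D i u))", OF _ norm_resolvent_partial_partial_le u]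
    by (metis resolvent_diff weak_partial_diff b(2))
  then have "convergent (\<lambda>n. resolvent (?D j (?D i (u n))))" for i j
    unfolding convergent_def .
  moreover define v2 where "v2 i j = lim (\<lambda>n. resolvent (?D j (?D i (u n))))" for i j
  ultimately have v2: "(\<lambda>n. resolvent (?D j (?D i (u n)))) \<longlonglongrightarrow> v2 i j" for i j
    by (simp only: convergent_LIMSEQ_iff)
  have Ru: "(\<lambda>n. resolvent (u n)) \<longlonglongrightarrow> resolvent g"
    by (rule bounded_linear.tendsto[OF resolvent_linear u(2)])
  have d1: "weak_deriv i (resolvent g) (v1 i)" for i
    by (rule weak_deriv_limit[OF weak_deriv_resolvent[OF b(1)[OF u(1)]] Ru v1])
  have d2: "weak_deriv j (v1 i) (v2 i j)" for i j
    by (rule weak_deriv_limit[OF weak_deriv_resolvent[OF b(1)[OF b(2)[OF u(1)]]] v1 v2])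
  show "resolvent g \<in> sobolev 2" unfolding sobolev_2_iff using d1 d2 by blast
  have "(\<lambda>n. \<Sum>i\<in>UNIV. resolvent (?D i (?D i (u n)))) \<longlonglongrightarrow> (\<Sum>i\<in>UNIV. v2 i i)"
    by (intro tendsto_sum v2)
  moreover have "(\<Sum>i\<in>UNIV. resolvent (?D i (?D i (u n)))) = resolvent (u n) - u n" for n
    using bump_space_resolvent[OF u(1)[of n]] by (simp add: laplacian_def resolvent_sum)
  moreover have "(\<lambda>n. resolvent (u n) - u n) \<longlonglongrightarrow> resolvent g - g"
    by (intro tendsto_diff Ru u)
  ultimately have "(\<Sum>i\<in>UNIV. v2 i i) = resolvent g - g" using LIMSEQ_unique by auto
  then show "laplacian (resolvent g) = resolvent g - g" using laplacian_eq[OF d1 d2] by simp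
qed

text \<open>Compute \<open>\<Delta> R f\<close> twice: it is \<open>R \<Delta> f\<close> because \<open>R\<close> commutes with the weak derivatives of \<open>f\<close>, and \<open>R f - f\<close> by the
previous theorem.\<close>

theorem sobolev_eq_resolvent:
  assumes "f \<in> sobolev 2"
  shows "f = resolvent (f - laplacian f)"
proof -
  obtain f1 f2 where f: "\<And>i. weak_deriv i f (f1 i)" "\<And>i j. weak_deriv j (f1 i) (f2 i j)"
    using assms unfolding sobolev_2_iff by blast
  have "laplacian (resolvent f) = (\<Sum>i\<in>UNIV. resolvent (f2 i i))"
    by (rule laplacian_eq[OF weak_deriv_resolvent[OF f(1)] weak_deriv_resolvent[OF f(2)]])
  also have "\<dots> = resolvent (laplacian f)"
    by (simp add: laplacian_eq[OF f] resolvent_sum)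
  finally show ?thesis by (simp add: resolvent_in_sobolev(2) resolvent_diff algebra_simps)
qed

lemma sobolev_eq_range: "sobolev 2 = range resolvent"
  using sobolev_eq_resolvent resolvent_in_sobolev(1) by blast

lemma resolvent_injective:
  assumes "resolvent g = 0"
  shows "g = 0"
proof -
  have "- g = laplacian 0"
    using resolvent_in_sobolev(2)[of g] assms by simp
  also have "\<dots> = 0"
    using resolvent_in_sobolev(2)[of 0] by (simp add: resolvent_0)
  finally have "- g = 0" .
  then show ?thesis by simp
qed

text \<open>Uniqueness of distributional solutions. The difference \<open>h\<close> of \<open>f\<close> and \<open>R g\<close> annihilates every \<open>w - \<Delta> w\<close>; so do its translates,
hence so does their average \<open>R h\<close>, and symmetry gives that \<open>h\<close> annihilates \<open>R (w - \<Delta> w) = w\<close>.\<close>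

lemma resolvent_eqI:
  assumes eq: "\<And>w c. test_function w \<Longrightarrow> inner (tensor (\<lambda>x. w x - laplace w x) c) f = inner (tensor w c) g"
  shows "f = resolvent g"
proof -
  define h where "h = f - resolvent g"
  have 0: "inner (tensor (\<lambda>x. w x - laplace w x) c) h = 0" if "test_function w" for w c
    using eq[OF that, of c] inner_resolvent_symmetric[of "tensor (\<lambda>x. w x - laplace w x) c" g]
    by (simp add: h_def inner_diff_right resolvent_helmholtz_tensor[OF that])
  have "h = 0"
  proof (rule L2_eq_0_if_orthogonal_bumps)
    fix \<phi> and c :: "complex^'a" assume "\<phi> \<in> bumps"
    then have w: "test_function \<phi>" by (rule bumps_test_function)
    have "inner (tensor (\<lambda>x. \<phi> x - laplace \<phi> x) c) (shift z h) = 0" for z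
      using 0[OF test_function_translate[OF w, of "- z"], of c]
      by (simp add: inner_tensor_shift sq_int_helmholtz(2)[OF w] laplace_translate[of \<phi> "- z", simplified])
    then have "inner (resolvent h) (tensor (\<lambda>x. \<phi> x - laplace \<phi> x) c) = 0"
      by (simp add: resolvent_average(2) inner_commute)
    then show "inner (tensor \<phi> c) h = 0"
      by (simp add: inner_resolvent_symmetric resolvent_helmholtz_tensor[OF w] inner_commute)
  qed
  then show ?thesis by (simp add: h_def)
qed

lemma sq_int_exp: "sq_int (\<lambda>x. exp (- norm (x - a)))"
  using sq_int_translate[of "\<lambda>x. exp (- norm x)" "- a"] integrable_exp_square by (simp add: sq_int_def)

lemma resolvent_yukawa: "resolvent (tensor (\<lambda>x. 8 * pi * yukawa (x - a)) c) = tensor (\<lambda>x. exp (- norm (x - a))) c"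
proof (rule resolvent_eqI[symmetric])
  fix w and d :: "complex^'a" assume w: "test_function w"
  note tw = test_function_translate[OF w, of a]
  have [measurable]: "w \<in> borel_measurable borel" "laplace w \<in> borel_measurable borel"
    using helmholtz_bounded[OF w] by blast+
  have "(\<integral>x. (w x - laplace w x) * exp (- norm (x - a)) \<partial>lborel)
      = (\<integral>x. (w (x + a) - laplace w (x + a)) * exp (- norm (x + a - a)) \<partial>lborel)"
    by (rule integral_lborel_translate[of "\<lambda>x. (w x - laplace w x) * exp (- norm (x - a))" a, symmetric]) measurable
  also have "\<dots> = (\<integral>x. 8 * pi * yukawa x * w (x + a) \<partial>lborel)"
    using exp_solution[OF tw] by (simp add: laplace_translate mult.commute)
  also have "\<dots> = (\<integral>x. w x * (8 * pi * yukawa (x - a)) \<partial>lborel)"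
    using integral_lborel_translate[of "\<lambda>x. w x * (8 * pi * yukawa (x - a))" a] by (simp add: mult_ac)
  finally show "inner (tensor (\<lambda>x. w x - laplace w x) d) (tensor (\<lambda>x. exp (- norm (x - a))) c)
      = inner (tensor w d) (tensor (\<lambda>x. 8 * pi * yukawa (x - a)) c)"
    by (simp add: inner_tensor_tensor sq_int_helmholtz(2)[OF w] sq_int_exp sq_int_test_function[OF w]
        sq_int_scale sq_int_yukawa_at)
qed

section \<open>Point values\<close>

lemma continuous_AE_eq:
  fixes g h :: "'a::euclidean_space \<Rightarrow> 'b::real_normed_vector"
  assumes U: "open U" and c: "continuous_on U g" "continuous_on U h"
    and ae: "AE y in lborel. y \<in> U \<longrightarrow> g y = h y" and x: "x \<in> U"
  shows "g x = h x"
proof (rule ccontr)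
  assume ne: "g x \<noteq> h x"
  let ?S = "U \<inter> (\<lambda>y. g y - h y) -` (- {0})"
  have op: "open ?S"
    using continuous_open_preimage[OF continuous_on_diff[OF c] U] by (simp add: open_Compl)
  have "AE y in lborel. y \<notin> ?S" using ae by eventually_elim auto
  then have "?S \<in> null_sets lborel"
    using op by (subst AE_iff_null_sets) (auto intro: borel_open)
  then have "negligible ?S"
    using op by (simp add: negligible_iff_null_sets null_sets_completionI)
  then show False
  proof (rule open_not_negligible[OF op, THEN notE, rotated])
    show "?S \<noteq> {}" using ne x by (auto intro!: exI[of _ x])
  qed
qed

lemma has_point_value_unique:
  assumes "has_point_value f x c" "has_point_value f x d"
  shows "c = d"
proof -
  obtain U g V h where U: "open U" "x \<in> U" "continuous_on U g" "AE y in lborel. y \<in> U \<longrightarrow> rep_L2 f y = g y" "g x = c"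
    and V: "open V" "x \<in> V" "continuous_on V h" "AE y in lborel. y \<in> V \<longrightarrow> rep_L2 f y = h y" "h x = d"
    using assms unfolding has_point_value_def by blast
  have "AE y in lborel. y \<in> U \<inter> V \<longrightarrow> g y = h y"
    using U(4) V(4) by eventually_elim auto
  then have "g x = h x"
    using U V by (intro continuous_AE_eq[of "U \<inter> V"]) (auto intro: continuous_on_subset)
  then show ?thesis using U V by simp
qed

lemma point_value_eq: "has_point_value f x c \<Longrightarrow> point_value f x = c"
  unfolding point_value_def using has_point_value_unique by blast

lemma inner_conv: "inner c (conv f x) = inner (tensor (\<lambda>y. yukawa (y - x)) c) f"
proof -
  have "yukawa (x - y) = yukawa (y - x)" for y using yukawa_minus[of "x - y"] by simp
  then show ?thesis unfolding conv_def inner_tensor[OF sq_int_yukawa_at(1)] by simp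
qed

lemma conv_add: "conv (f + g) x = conv f x + conv g x"
  by (rule vector_eq_ldot[THEN iffD1, rule_format]) (simp add: inner_conv inner_add_right)

lemma conv_diff: "conv (f - g) x = conv f x - conv g x"
  by (rule vector_eq_ldot[THEN iffD1, rule_format]) (simp add: inner_conv inner_diff_right)

lemma conv_scaleR: "conv (r *\<^sub>R f) x = r *\<^sub>R conv f x"
  by (rule vector_eq_ldot[THEN iffD1, rule_format]) (simp add: inner_conv)

lemma conv_zero: "conv 0 x = 0"
  by (rule vector_eq_ldot[THEN iffD1, rule_format]) (simp add: inner_conv)

text \<open>The values of \<open>R g\<close> are inner products of \<open>g\<close> with translates of the kernel, all of the same
finite norm. This is the Sobolev embedding.\<close>

lemma conv_bounded: "\<exists>K. \<forall>(f :: 'n::finite L2) x. norm (conv f x) \<le> K * norm f"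
proof -
  define K where "K = sqrt (\<integral>y. (yukawa y)\<^sup>2 \<partial>lborel)"
  have "norm (conv f x) \<le> K * norm f" for f :: "'n L2" and x
  proof -
    have nt: "norm (tensor (\<lambda>y. yukawa (y - x)) c) = norm c * K" for c :: "complex^'n"
    proof -
      have "(\<integral>y. yukawa (y - x) * yukawa (y - x) \<partial>lborel) = (\<integral>y. (yukawa y)\<^sup>2 \<partial>lborel)"
        using integral_lborel_translate[of "\<lambda>y. (yukawa y)\<^sup>2" "- x"] by (simp add: power2_eq_square)
      then show ?thesis
        by (simp add: norm_eq_sqrt_inner inner_tensor_tensor sq_int_yukawa_at K_def real_sqrt_mult)
    qed
    have "norm (conv f x) * norm (conv f x) = inner (conv f x) (conv f x)"
      by (simp add: dot_square_norm power2_eq_square)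
    also have "\<dots> \<le> norm (conv f x) * K * norm f"
      unfolding inner_conv[of "conv f x"] using norm_cauchy_schwarz[of "tensor (\<lambda>y. yukawa (y - x)) (conv f x)" f]
      by (simp add: nt)
    finally have "norm (conv f x) * norm (conv f x) \<le> norm (conv f x) * (K * norm f)" by (simp add: mult.assoc)
    moreover have "0 \<le> K * norm f" unfolding K_def by (intro mult_nonneg_nonneg) auto
    ultimately show ?thesis
      by (cases "norm (conv f x) = 0") (auto simp: mult_le_cancel_left)
  qed
  then show ?thesis by blast
qed

lemma conv_tensor_continuous:
  assumes w: "test_function w"
  shows "continuous_on UNIV (conv (tensor w c))"
proof -
  have [measurable]: "w \<in> borel_measurable borel" by (rule test_function_measurable[OF w])
  obtain M where M: "\<And>x. w x \<noteq> 0 \<Longrightarrow> norm x \<le> M" using test_function_support[OF w] by blast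
  have "\<exists>B. \<forall>x. \<bar>w x\<bar> \<le> B"
    by (rule bounded_support_bound[OF test_function_continuous[OF w] M]) blast+
  then obtain B where B: "\<And>x. \<bar>w x\<bar> \<le> B" by blast
  have eq: "conv (tensor w c) x = (\<integral>z. (yukawa z * w (x + z)) *\<^sub>R c \<partial>lborel)" for x
  proof -
    have "conv (tensor w c) x = (\<integral>y. (yukawa (x - y) * w y) *\<^sub>R c \<partial>lborel)"
      unfolding conv_def
      by (rule integral_cong_AE) (use AE_rep_tensor[OF sq_int_test_function[OF w], of c] in \<open>auto elim!: eventually_mono\<close>)
    also have "\<dots> = (\<integral>z. (yukawa z * w (x + z)) *\<^sub>R c \<partial>lborel)"
      using integral_lborel_translate[of "\<lambda>y. (yukawa (x - y) * w y) *\<^sub>R c" x] by (simp add: add.commute)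
    finally show ?thesis .
  qed
  show ?thesis
    unfolding continuous_on_sequentially
  proof (clarify)
    fix s x assume s: "(s :: nat \<Rightarrow> real^3) \<longlonglongrightarrow> x"
    have "(\<lambda>n. \<integral>z. (yukawa z * w (s n + z)) *\<^sub>R c \<partial>lborel) \<longlonglongrightarrow> (\<integral>z. (yukawa z * w (x + z)) *\<^sub>R c \<partial>lborel)"
    proof (rule integral_dominated_convergence)
      show "integrable lborel (\<lambda>z. yukawa z * (B * norm c))" using integrable_yukawa by simp
      show "AE z in lborel. (\<lambda>n. (yukawa z * w (s n + z)) *\<^sub>R c) \<longlonglongrightarrow> (yukawa z * w (x + z)) *\<^sub>R c"
      proof (rule AE_I2)
        fix z
        have "isCont w (x + z)"
          using test_function_continuous[OF w, of UNIV] by (simp add: continuous_on_eq_continuous_at)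
        then have "(\<lambda>n. w (s n + z)) \<longlonglongrightarrow> w (x + z)"
          by (rule isCont_tendsto_compose) (intro tendsto_intros s)
        then show "(\<lambda>n. (yukawa z * w (s n + z)) *\<^sub>R c) \<longlonglongrightarrow> (yukawa z * w (x + z)) *\<^sub>R c"
          by (intro tendsto_intros)
      qed
      show "AE z in lborel. norm ((yukawa z * w (s n + z)) *\<^sub>R c) \<le> yukawa z * (B * norm c)" for n
        using B by (intro AE_I2) (auto simp: abs_mult yukawa_nonneg mult.assoc intro!: mult_left_mono mult_right_mono)
    qed measurable
    then show "(conv (tensor w c) \<circ> s) \<longlonglongrightarrow> conv (tensor w c) x" by (simp add: eq o_def)
  qed
qed

text \<open>A uniform limit of the continuous functions \<open>conv u\<close> with \<open>u\<close> in \<open>bump_space\<close>.\<close>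

lemma conv_continuous: "continuous_on UNIV (conv f)"
proof -
  have bump: "continuous_on UNIV (conv u)" if "u \<in> bump_space" for u :: "'a L2"
    using that
  proof (induction rule: bump_space_induct)
    case (bump \<phi> c)
    then show ?case by (intro conv_tensor_continuous bumps_test_function)
  qed (simp_all add: conv_zero[abs_def] conv_add[abs_def] conv_scaleR[abs_def] continuous_intros)
  have "f \<in> closure bump_space" using bump_space_dense by auto
  then obtain u where u: "\<And>n. u n \<in> bump_space" "u \<longlonglongrightarrow> f"
    unfolding closure_sequential by blast
  obtain K where K: "\<And>(g :: 'a L2) x. norm (conv g x) \<le> K * norm g" using conv_bounded by blast
  have ul: "uniform_limit UNIV (\<lambda>n. conv (u n)) (conv f) sequentially"
  proof (rule uniform_limitI)
    fix e :: real assume "e > 0"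
    have "(\<lambda>n. K * norm (u n - f)) \<longlonglongrightarrow> K * norm (f - f)" by (intro tendsto_intros u)
    then have "\<forall>\<^sub>F n in sequentially. K * norm (u n - f) < e"
      using \<open>e > 0\<close> by (intro order_tendstoD) auto
    then show "\<forall>\<^sub>F n in sequentially. \<forall>x\<in>UNIV. dist (conv (u n) x) (conv f x) < e"
    proof eventually_elim
      case (elim n)
      then show ?case
        using K[of "u n - f"] by (auto simp: dist_norm conv_diff intro: le_less_trans)
    qed
  qed
  show ?thesis
    by (rule uniform_limit_theorem[OF always_eventually ul]) (auto intro: bump u)
qed

lemma has_point_value_resolvent: "has_point_value (resolvent g) x (conv g x)"
  unfolding has_point_value_def
  by (intro exI[of _ UNIV] exI[of _ "conv g"]) (use AE_rep_resolvent in \<open>auto simp: conv_continuous\<close>)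

section \<open>Point interactions\<close>

text \<open>The elements \<open>\<Sum>\<^sub>j k\<^sub>j \<otimes> c\<^sub>j\<close>, which span the kernel of \<open>H\<^sup>* + 1\<close>.\<close>

definition deficiency :: "('m::finite \<Rightarrow> real^3) \<Rightarrow> complex^'n^'m \<Rightarrow> 'n::finite L2" where
  "deficiency X c = (\<Sum>j\<in>UNIV. tensor (\<lambda>y. yukawa (y - X j)) (c $ j))"

definition evaluation :: "('m::finite \<Rightarrow> real^3) \<Rightarrow> 'n::finite L2 \<Rightarrow> complex^'n^'m" where
  "evaluation X g = (\<chi> j. conv g (X j))"

text \<open>The matrix of the second boundary map on singular elements. At \<open>X j\<close> the kernel centred there leaves the
constant term \<open>- 1 / (4 \<pi>)\<close> of \<open>e\<^bsup>-r\<^esup> / (4 \<pi> r)\<close>, the others leave their value.\<close>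

definition coupling :: "('m::finite \<Rightarrow> real^3) \<Rightarrow> 'm \<Rightarrow> 'm \<Rightarrow> real" where
  "coupling X j k = (if j = k then - 1 / (4 * pi) else yukawa (X j - X k))"

definition interaction :: "('m::finite \<Rightarrow> real^3) \<Rightarrow> complex^'n^'m \<Rightarrow> complex^'n^'m" where
  "interaction X c = (\<chi> j. \<Sum>k\<in>UNIV. coupling X j k *\<^sub>R c $ k)"

lemma minimal_schroedinger_eq:
  "minimal_schroedinger X = {(resolvent g, g - resolvent g) | g. evaluation X g = 0}"
proof -
  have "has_point_value (resolvent g) x 0 \<longleftrightarrow> conv g x = 0" for g :: "'a L2" and x
    using has_point_value_resolvent[of g x] has_point_value_unique[OF has_point_value_resolvent, of g x 0] by auto
  then have "(\<forall>j. has_point_value (resolvent g) (X j) 0) \<longleftrightarrow> evaluation X g = 0" for g :: "'a L2"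
    by (simp add: evaluation_def vec_eq_iff[where x="vec_lambda _"])
  then show ?thesis
    unfolding minimal_schroedinger_def sobolev_eq_range
    by (auto simp: resolvent_in_sobolev(2))
qed

lemma cinner_sum_right: "cinner g (\<Sum>j\<in>A. f j) = (\<Sum>j\<in>A. cinner g (f j :: 'a::complex_inner))"
  by (induction A rule: infinite_finite_induct) (simp_all add: cinner_add_right)

lemma cinner_sum_left: "cinner (\<Sum>j\<in>A. f j) g = (\<Sum>j\<in>A. cinner (f j :: 'a::complex_inner) g)"
  by (induction A rule: infinite_finite_induct) (simp_all add: cinner_add_left)

lemma cinner_evaluation: "cinner (evaluation X g) c = cinner g (deficiency X c)"
proof -
  have "yukawa (x - y) = yukawa (y - x)" for x y using yukawa_minus[of "x - y"] by simp
  then have "cinner (conv g x) d = cinner g (tensor (\<lambda>y. yukawa (y - x)) d)" for x d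
    unfolding cinner_tensor[OF sq_int_yukawa_at(1)] conv_def by simp
  moreover have "cinner v c = (\<Sum>j\<in>UNIV. cinner (v $ j) (c $ j))" for v
    by (rule cinner_vec_def)
  ultimately show ?thesis
    by (simp add: evaluation_def deficiency_def cinner_sum_right)
qed

lemma scaleC_sum_right: "z *\<^sub>C (\<Sum>j\<in>A. f j) = (\<Sum>j\<in>A. z *\<^sub>C (f j :: 'a::complex_inner))"
  by (induction A rule: infinite_finite_induct) (simp_all add: scaleC_add_right)

lemma deficiency_add: "deficiency X (c + d) = deficiency X c + deficiency X d"
  by (simp add: deficiency_def tensor_add_right sq_int_yukawa_at sum.distrib)

lemma scaleC_vec_nth: "(z *\<^sub>C c) $ j = z *\<^sub>C (c $ j)"
  by (simp add: scaleC_vec_def)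

lemma deficiency_scaleC: "deficiency X (z *\<^sub>C c) = z *\<^sub>C deficiency X c"
  by (simp add: deficiency_def scaleC_sum_right tensor_scaleC_right sq_int_yukawa_at scaleC_vec_nth)

lemma AE_rep_sum_tensor:
  assumes "\<And>j. sq_int (\<phi> j)"
  shows "AE x in lborel. rep_L2 (\<Sum>j\<in>A. tensor (\<phi> j) (c j)) x = (\<Sum>j\<in>A. \<phi> j x *\<^sub>R c j)"
proof (induction A rule: infinite_finite_induct)
  case (insert j A)
  show ?case
    using insert(3) AE_rep_tensor[OF assms, of j "c j"]
      AE_rep_L2_add[of "tensor (\<phi> j) (c j)" "\<Sum>j\<in>A. tensor (\<phi> j) (c j)"]
    by eventually_elim (simp add: insert(1,2))
qed (use AE_rep_abs_L2[OF square_integrable_zero] in \<open>simp_all add: zero_L2_def\<close>)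

lemma AE_rep_deficiency: "AE x in lborel. rep_L2 (deficiency X c) x = (\<Sum>j\<in>UNIV. yukawa (x - X j) *\<^sub>R c $ j)"
  unfolding deficiency_def by (intro AE_rep_sum_tensor sq_int_yukawa_at)

lemma AE_rep_element:
  "AE x in lborel. rep_L2 (resolvent g + deficiency X c) x = conv g x + (\<Sum>j\<in>UNIV. yukawa (x - X j) *\<^sub>R c $ j)"
  using AE_rep_L2_add[of "resolvent g" "deficiency X c"] AE_rep_resolvent[of g] AE_rep_deficiency[of X c]
  by eventually_elim simp

lemma continuous_yukawa: "x \<noteq> 0 \<Longrightarrow> isCont yukawa x"
  unfolding yukawa_def[abs_def] by (intro continuous_intros) auto

lemma isCont_yukawa_translate:
  assumes "y \<noteq> a"
  shows "isCont (\<lambda>x. yukawa (x - a)) y"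
proof (rule isCont_o2[where g=yukawa])
  show "isCont (\<lambda>x. x - a) y" by (intro continuous_intros)
  show "isCont yukawa (y - a)" using assms by (intro continuous_yukawa) simp
qed

lemma has_point_value_element:
  assumes "x \<notin> range X"
  shows "has_point_value (resolvent g + deficiency X c) x (conv g x + (\<Sum>j\<in>UNIV. yukawa (x - X j) *\<^sub>R c $ j))"
  unfolding has_point_value_def
proof (intro exI conjI)
  show "open (- range X)" by (intro open_Compl finite_imp_closed) simp
  show "x \<in> - range X" using assms by simp
  show "continuous_on (- range X) (\<lambda>x. conv g x + (\<Sum>j\<in>UNIV. yukawa (x - X j) *\<^sub>R c $ j))"
  proof (intro continuous_intros continuous_on_subset[OF conv_continuous] subset_UNIV)
    show "continuous_on (- range X) (\<lambda>x. yukawa (x - X j))" for j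
    proof (rule continuous_at_imp_continuous_on, rule ballI)
      fix y assume "y \<in> - range X"
      then show "isCont (\<lambda>x. yukawa (x - X j)) y" by (intro isCont_yukawa_translate) auto
    qed
  qed
  show "AE y in lborel. y \<in> - range X \<longrightarrow> rep_L2 (resolvent g + deficiency X c) y = conv g y + (\<Sum>j\<in>UNIV. yukawa (y - X j) *\<^sub>R c $ j)"
    using AE_rep_element[of g X c] by eventually_elim simp
qed simp

lemmas point_value_element = point_value_eq[OF has_point_value_element]

lemma eventually_not_point: "\<forall>\<^sub>F x in at (X j). x \<notin> range (X :: 'm::finite \<Rightarrow> real^3)"
proof -
  have "open (- (range X - {X j}))" by (intro open_Compl finite_imp_closed) simp
  then have "\<forall>\<^sub>F x in nhds (X j). x \<in> - (range X - {X j})"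
    by (rule eventually_nhds_in_open) simp
  then show ?thesis
    by (auto simp: eventually_at_filter elim!: eventually_mono)
qed

lemma tendsto_norm_at: "((\<lambda>x. norm (x - a)) \<longlongrightarrow> 0) (at (a :: 'a::real_normed_vector))"
  using tendsto_norm[OF tendsto_diff[OF tendsto_ident_at tendsto_const[of a]], of a UNIV] by simp

lemma regular_part_tendsto:
  fixes X :: "'m::finite \<Rightarrow> real^3"
  assumes "inj X"
  shows "((\<lambda>x. conv g x + (\<Sum>k\<in>UNIV - {j}. yukawa (x - X k) *\<^sub>R c $ k)) \<longlongrightarrow>
     conv g (X j) + (\<Sum>k\<in>UNIV - {j}. yukawa (X j - X k) *\<^sub>R c $ k)) (at (X j))"
proof (intro tendsto_intros)
  have "isCont (conv g) (X j)"
    using conv_continuous[of g] by (simp add: continuous_on_eq_continuous_at)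
  then show "(conv g \<longlongrightarrow> conv g (X j)) (at (X j))" by (simp add: isCont_def)
  show "((\<lambda>x. yukawa (x - X k)) \<longlongrightarrow> yukawa (X j - X k)) (at (X j))" if "k \<in> UNIV - {j}" for k
  proof -
    have "X j \<noteq> X k" using that assms by (auto dest: injD)
    then have "isCont (\<lambda>x. yukawa (x - X k)) (X j)" by (rule isCont_yukawa_translate)
    then show ?thesis by (simp add: isCont_def)
  qed
qed

text \<open>Near \<open>X j\<close> only one kernel is singular.\<close>

lemma element_split:
  fixes X :: "'m::finite \<Rightarrow> real^3"
  shows "\<forall>\<^sub>F x in at (X j). point_value (resolvent g + deficiency X c) x =
     (conv g x + (\<Sum>k\<in>UNIV - {j}. yukawa (x - X k) *\<^sub>R c $ k)) + yukawa (x - X j) *\<^sub>R c $ j"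
  using eventually_not_point[of X j]
proof eventually_elim
  case (elim x)
  then show ?case
    by (simp add: point_value_element sum.remove[of UNIV j] add_ac)
qed

lemma norm_point_value_tendsto:
  fixes X :: "'m::finite \<Rightarrow> real^3"
  assumes X: "inj X"
  shows "((\<lambda>x. norm (x - X j) *\<^sub>R point_value (resolvent g + deficiency X c) x) \<longlongrightarrow> (1 / (4 * pi)) *\<^sub>R c $ j) (at (X j))"
proof -
  let ?q = "\<lambda>x. conv g x + (\<Sum>k\<in>UNIV - {j}. yukawa (x - X k) *\<^sub>R c $ k)"
  have "((\<lambda>x. norm (x - X j) *\<^sub>R ?q x + (exp (- norm (x - X j)) / (4 * pi)) *\<^sub>R c $ j) \<longlongrightarrow>
      0 *\<^sub>R (conv g (X j) + (\<Sum>k\<in>UNIV - {j}. yukawa (X j - X k) *\<^sub>R c $ k)) + (exp (- 0) / (4 * pi)) *\<^sub>R c $ j) (at (X j))"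
    by (intro tendsto_add tendsto_scaleR tendsto_norm_at regular_part_tendsto[OF X] tendsto_const
        tendsto_divide tendsto_exp tendsto_minus) simp
  moreover have "\<forall>\<^sub>F x in at (X j). norm (x - X j) *\<^sub>R ?q x + (exp (- norm (x - X j)) / (4 * pi)) *\<^sub>R c $ j
      = norm (x - X j) *\<^sub>R point_value (resolvent g + deficiency X c) x"
    using element_split[where X=X and j=j and g=g and c=c] eventually_not_point[of X j]
  proof eventually_elim
    case (elim x)
    then have "norm (x - X j) * yukawa (x - X j) = exp (- norm (x - X j)) / (4 * pi)"
      by (auto simp: yukawa_def)
    with elim show ?case by (simp add: scaleR_add_right)
  qed
  ultimately show ?thesis by (auto intro: Lim_transform_eventually)
qed

lemma exp_quotient_tendsto:
  "((\<lambda>x. (exp (- norm (x - a)) - 1) / norm (x - a)) \<longlongrightarrow> - 1) (at (a :: 'a::real_normed_vector))"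
proof -
  have "((\<lambda>t::real. exp (- t)) has_real_derivative - 1) (at 0)"
    by (auto intro!: derivative_eq_intros)
  then have d: "((\<lambda>t::real. (exp (- t) - 1) / t) \<longlongrightarrow> - 1) (at 0)"
    by (simp add: DERIV_def)
  have "filterlim (\<lambda>x. norm (x - a)) (at 0) (at a)"
    using tendsto_norm_at[of a] by (auto simp: filterlim_at eventually_at_filter)
  then show ?thesis by (rule filterlim_compose[OF d])
qed

lemma point_value_minus_singularity_tendsto:
  fixes X :: "'m::finite \<Rightarrow> real^3"
  assumes X: "inj X"
  shows "((\<lambda>x. point_value (resolvent g + deficiency X c) x - (1 / norm (x - X j)) *\<^sub>R ((1 / (4 * pi)) *\<^sub>R c $ j))
     \<longlongrightarrow> (evaluation X g + interaction X c) $ j) (at (X j))"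
proof -
  let ?q = "\<lambda>x. conv g x + (\<Sum>k\<in>UNIV - {j}. yukawa (x - X k) *\<^sub>R c $ k)"
  have "((\<lambda>x. ?q x + ((exp (- norm (x - X j)) - 1) / norm (x - X j)) *\<^sub>R ((1 / (4 * pi)) *\<^sub>R c $ j)) \<longlongrightarrow>
      (conv g (X j) + (\<Sum>k\<in>UNIV - {j}. yukawa (X j - X k) *\<^sub>R c $ k)) + (- 1) *\<^sub>R ((1 / (4 * pi)) *\<^sub>R c $ j)) (at (X j))"
    by (intro tendsto_add tendsto_scaleR exp_quotient_tendsto regular_part_tendsto[OF X] tendsto_const)
  moreover have "\<forall>\<^sub>F x in at (X j). ?q x + ((exp (- norm (x - X j)) - 1) / norm (x - X j)) *\<^sub>R ((1 / (4 * pi)) *\<^sub>R c $ j)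
      = point_value (resolvent g + deficiency X c) x - (1 / norm (x - X j)) *\<^sub>R ((1 / (4 * pi)) *\<^sub>R c $ j)"
    using element_split[where X=X and j=j and g=g and c=c]
  proof eventually_elim
    case (elim x)
    have "yukawa (x - X j) *\<^sub>R c $ j = (exp (- norm (x - X j)) / norm (x - X j)) *\<^sub>R ((1 / (4 * pi)) *\<^sub>R c $ j)"
      by (simp add: yukawa_def)
    with elim show ?case by (simp add: diff_divide_distrib scaleR_diff_left)
  qed
  moreover have "(evaluation X g + interaction X c) $ j =
      (conv g (X j) + (\<Sum>k\<in>UNIV - {j}. yukawa (X j - X k) *\<^sub>R c $ k)) + (- 1) *\<^sub>R ((1 / (4 * pi)) *\<^sub>R c $ j)"
    by (simp add: evaluation_def interaction_def coupling_def sum.remove[of UNIV j])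
  ultimately show ?thesis
    by (simp only:) (rule Lim_transform_eventually)
qed

lemma tendsto_at_Lim: "(f \<longlongrightarrow> l) (at (a :: real^3)) \<Longrightarrow> Lim (at a) f = l"
  by (rule tendsto_Lim) auto

lemma Gamma_0_element:
  assumes "inj X"
  shows "Gamma_0 X (resolvent g + deficiency X c) = c"
  unfolding Gamma_0_def tendsto_at_Lim[OF norm_point_value_tendsto[OF assms]]
  by (simp add: vec_eq_iff)

lemma Gamma_1_element:
  assumes "inj X"
  shows "Gamma_1 X (resolvent g + deficiency X c) = evaluation X g + interaction X c"
  unfolding Gamma_1_def tendsto_at_Lim[OF norm_point_value_tendsto[OF assms]]
    tendsto_at_Lim[OF point_value_minus_singularity_tendsto[OF assms]]
  by (rule vec_lambda_eta)

lemma cinner_scaleR_left: "cinner (r *\<^sub>R f) g = of_real r * cinner f (g :: 'a::complex_inner)"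
  using cinner_scaleC_left[of "of_real r" f g] by (simp add: scaleC_of_real)

lemma cinner_scaleR_right: "cinner f (r *\<^sub>R g) = of_real r * cinner f (g :: 'a::complex_inner)"
  using cinner_scaleC_right[of f "of_real r" g] by (simp add: scaleC_of_real)

lemma interaction_symmetric:
  fixes X :: "'m::finite \<Rightarrow> real^3" and c d :: "complex^'n^'m"
  shows "cinner (interaction X c) d = cinner c (interaction X d)"
proof -
  have M: "coupling X j k = coupling X k j" for j k
    using yukawa_minus[of "X j - X k"] by (simp add: coupling_def)
  have v: "cinner u v = (\<Sum>j\<in>UNIV. cinner (u $ j) (v $ j))" for u v :: "complex^'n^'m"
    by (rule cinner_vec_def)
  have "cinner (interaction X c) d = (\<Sum>j\<in>UNIV. \<Sum>k\<in>UNIV. coupling X j k * cinner (c $ k) (d $ j))"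
    unfolding v by (simp add: interaction_def cinner_sum_left cinner_scaleR_left)
  also have "\<dots> = (\<Sum>k\<in>UNIV. \<Sum>j\<in>UNIV. coupling X k j * cinner (c $ k) (d $ j))"
    by (subst sum.swap) (simp add: M)
  also have "\<dots> = cinner c (interaction X d)"
    unfolding v by (simp add: interaction_def cinner_sum_right cinner_scaleR_right)
  finally show ?thesis .
qed

lemma interaction_add: "interaction X (c + d) = interaction X c + interaction X d"
  by (simp add: interaction_def vec_eq_iff scaleR_add_right sum.distrib)

lemma interaction_scaleC: "interaction X (z *\<^sub>C c) = z *\<^sub>C interaction X c"
proof (subst vec_eq_iff, rule allI)
  fix j
  show "interaction X (z *\<^sub>C c) $ j = (z *\<^sub>C interaction X c) $ j"
    unfolding scaleC_vec_nth by (simp add: interaction_def scaleC_vec_nth scaleC_sum_right scaleC_scaleR_commute)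
qed

lemma deficiency_scaleR: "deficiency X (r *\<^sub>R c) = r *\<^sub>R deficiency X c"
  using deficiency_scaleC[of X "of_real r" c] by (simp add: scaleC_of_real)

lemma deficiency_zero: "deficiency X 0 = 0"
  using deficiency_scaleR[of X 0 0] by simp

text \<open>The first boundary map recovers \<open>c\<close> from \<open>deficiency X c\<close> but vanishes on the range of the resolvent.\<close>

lemma deficiency_inter_range_resolvent:
  fixes X :: "'m::finite \<Rightarrow> real^3"
  assumes "inj X" "resolvent g = deficiency X c"
  shows "c = 0"
  using Gamma_0_element[OF assms(1), of g 0] Gamma_0_element[OF assms(1), of 0 c] assms(2)
  by (simp add: deficiency_zero resolvent_0)

text \<open>The exponentials are resolvents of the singular elements. Their values at the points therefore
form a Gram matrix.\<close>

lemma resolvent_deficiency: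
  "resolvent ((8 * pi) *\<^sub>R deficiency X c) = (\<Sum>j\<in>UNIV. tensor (\<lambda>x. exp (- norm (x - X j))) (c $ j))"
  unfolding deficiency_def scaleR_sum_right resolvent_sum
  by (simp add: resolvent_yukawa[symmetric] tensor_scaleR_left sq_int_yukawa_at)

lemma singular_decomposition_iff:
  "singular_decomposition X f \<xi>\<^sub>0 \<xi>\<^sub>1 f\<^sub>H \<longleftrightarrow> f\<^sub>H \<in> Domain (minimal_schroedinger X) \<and>
     f = resolvent ((8 * pi) *\<^sub>R deficiency X \<xi>\<^sub>1) + deficiency X ((4 * pi) *\<^sub>R \<xi>\<^sub>0) + f\<^sub>H"
proof -
  let ?a = "resolvent ((8 * pi) *\<^sub>R deficiency X \<xi>\<^sub>1)" and ?b = "deficiency X ((4 * pi) *\<^sub>R \<xi>\<^sub>0)"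
  let ?s = "\<lambda>x. (\<Sum>j\<in>UNIV. (exp (- norm (x - X j)) / norm (x - X j)) *\<^sub>R (\<xi>\<^sub>0 $ j)
                 + exp (- norm (x - X j)) *\<^sub>R (\<xi>\<^sub>1 $ j)) + rep_L2 f\<^sub>H x"
  have y: "yukawa z * (4 * pi) = exp (- norm z) / norm z" for z
    by (simp add: yukawa_def)
  have ae: "AE x in lborel. rep_L2 (?a + ?b + f\<^sub>H) x = ?s x"
    using AE_rep_sum_tensor[where \<phi>="\<lambda>j x. exp (- norm (x - X j))" and A=UNIV and c="\<lambda>j. \<xi>\<^sub>1 $ j", OF sq_int_exp]
      AE_rep_deficiency[of X "(4 * pi) *\<^sub>R \<xi>\<^sub>0"] AE_rep_L2_add[of ?a ?b] AE_rep_L2_add[of "?a + ?b" f\<^sub>H]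
  proof eventually_elim
    case (elim x)
    then show ?case by (simp only: resolvent_deficiency) (simp add: sum.distrib y)
  qed
  have "(AE x in lborel. rep_L2 f x = ?s x) \<longleftrightarrow> f = ?a + ?b + f\<^sub>H"
  proof
    assume "AE x in lborel. rep_L2 f x = ?s x"
    with ae have "AE x in lborel. rep_L2 f x = rep_L2 (?a + ?b + f\<^sub>H) x"
      by eventually_elim (rule trans[OF _ sym])
    then show "f = ?a + ?b + f\<^sub>H" by (rule L2_eqI)
  next
    assume "f = ?a + ?b + f\<^sub>H"
    with ae show "AE x in lborel. rep_L2 f x = ?s x" by simp
  qed
  then show ?thesis by (simp only: singular_decomposition_def)
qed

section \<open>Complex conjugation\<close>

definition cnj_vec :: "complex^'n \<Rightarrow> complex^'n" where
  "cnj_vec v = (\<chi> i. cnj (v $ i))"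

lemma bounded_linear_cnj_vec: "bounded_linear (cnj_vec :: complex^'n \<Rightarrow> complex^'n)"
  by (rule bounded_linear_intro[of _ 1])
     (auto simp: cnj_vec_def vec_eq_iff norm_vec_def complex_eq_iff)

lemma norm_cnj_vec: "norm (cnj_vec v) = norm v"
  by (simp add: cnj_vec_def norm_vec_def)

lemma cnj_vec_measurable [measurable]: "cnj_vec \<in> borel_measurable borel"
  by (intro borel_measurable_continuous_onI linear_continuous_on bounded_linear_cnj_vec)

text \<open>Componentwise complex conjugation of classes. It commutes with the resolvent since the kernel is real.\<close>

definition conjugation :: "'n::finite L2 \<Rightarrow> 'n L2" where
  "conjugation f = abs_L2 (\<lambda>x. cnj_vec (rep_L2 f x))"

lemma square_integrable_cnj_vec: "square_integrable F \<Longrightarrow> square_integrable (\<lambda>x. cnj_vec (F x))"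
  by (auto simp: square_integrable_def norm_cnj_vec)

lemma AE_rep_conjugation: "AE x in lborel. rep_L2 (conjugation f) x = cnj_vec (rep_L2 f x)"
  unfolding conjugation_def by (intro AE_rep_abs_L2 square_integrable_cnj_vec square_integrable_rep)

lemma conjugation_conjugation: "conjugation (conjugation f) = f"
  using AE_rep_conjugation[of "conjugation f"] AE_rep_conjugation[of f]
  by (intro L2_eqI, eventually_elim) (simp add: cnj_vec_def)

lemma conjugation_diff: "conjugation (f - g) = conjugation f - conjugation g"
proof (rule L2_eqI)
  have "AE x in lborel. rep_L2 (h - k) x = rep_L2 h x - rep_L2 k x" for h k :: "'a L2"
    using AE_rep_L2_add[of "h - k" k] by eventually_elim simp
  from AE_rep_conjugation[of "f - g"] this[of f g] AE_rep_conjugation[of f] AE_rep_conjugation[of g]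
    this[of "conjugation f" "conjugation g"]
  show "AE x in lborel. rep_L2 (conjugation (f - g)) x = rep_L2 (conjugation f - conjugation g) x"
    by eventually_elim (simp add: cnj_vec_def vec_eq_iff)
qed

lemma conjugation_scaleC: "conjugation (c *\<^sub>C f) = cnj c *\<^sub>C conjugation f"
proof (rule L2_eqI)
  from AE_rep_conjugation[of "c *\<^sub>C f"] AE_rep_conjugation[of f] AE_rep_L2_scaleC[of c f]
    AE_rep_L2_scaleC[of "cnj c" "conjugation f"]
  show "AE x in lborel. rep_L2 (conjugation (c *\<^sub>C f)) x = rep_L2 (cnj c *\<^sub>C conjugation f) x"
    by eventually_elim (simp add: cnj_vec_def vec_eq_iff scaleC_vec_def scaleC_complex_def)
qed

lemma inner_conjugation: "inner (conjugation f) (conjugation g) = inner f g"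
proof -
  have "inner (cnj_vec u) (cnj_vec v) = inner u v" for u v :: "complex^'a"
    by (simp add: cnj_vec_def inner_vec_def inner_complex_def)
  then show ?thesis
    unfolding conjugation_def inner_L2_abs[OF square_integrable_cnj_vec[OF square_integrable_rep] square_integrable_cnj_vec[OF square_integrable_rep]]
    by (simp add: inner_L2_rep)
qed

lemma cinner_conjugation: "cinner (conjugation f) (conjugation g) = cnj (cinner f g)"
proof -
  have "\<i> *\<^sub>C conjugation g = conjugation (- \<i> *\<^sub>C g)" by (simp add: conjugation_scaleC)
  then have "inner (conjugation f) (\<i> *\<^sub>C conjugation g) = inner f (- \<i> *\<^sub>C g)" by (simp only: inner_conjugation)
  also have "- \<i> *\<^sub>C g = - 1 *\<^sub>C (\<i> *\<^sub>C g)" by (simp add: scaleC_scaleC)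
  also have "\<dots> = - (\<i> *\<^sub>C g)" by (rule scaleC_minus_one)
  finally show ?thesis
    unfolding cinner_eq_inner by (simp add: inner_conjugation complex_eq_iff)
qed

lemma conv_conjugation: "conv (conjugation f) x = cnj_vec (conv f x)"
proof -
  have "conv (conjugation f) x = (\<integral>y. cnj_vec (yukawa (x - y) *\<^sub>R rep_L2 f y) \<partial>lborel)"
    unfolding conv_def
  proof (rule integral_cong_AE)
    show "AE y in lborel. yukawa (x - y) *\<^sub>R rep_L2 (conjugation f) y = cnj_vec (yukawa (x - y) *\<^sub>R rep_L2 f y)"
      using AE_rep_conjugation[of f]
      by eventually_elim (simp add: linear_scale[OF bounded_linear.linear[OF bounded_linear_cnj_vec]])
  qed measurable
  also have "\<dots> = cnj_vec (conv f x)"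
    unfolding conv_def
    by (rule integral_bounded_linear[OF bounded_linear_cnj_vec integrable_scaleR_L2[OF sq_int_yukawa_at(2) square_integrable_rep]])
  finally show ?thesis .
qed

lemma conjugation_resolvent: "conjugation (resolvent f) = resolvent (conjugation f)"
  using AE_rep_conjugation[of "resolvent f"] AE_rep_resolvent[of f] AE_rep_resolvent[of "conjugation f"]
  by (intro L2_eqI, eventually_elim) (simp add: conv_conjugation)

lemma equal_deficiency_indices_minimal_schroedinger:
  "equal_deficiency_indices (minimal_schroedinger X)"
proof (rule equal_deficiency_indices_conjugation[of conjugation])
  fix f f' assume "(f, f') \<in> minimal_schroedinger X"
  then obtain g where g: "f = resolvent g" "f' = g - resolvent g" "evaluation X g = 0"
    by (auto simp: minimal_schroedinger_eq)
  have "evaluation X (conjugation g) = 0"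
    using g(3) by (simp add: evaluation_def conv_conjugation vec_eq_iff[where x="vec_lambda _"])
      (simp add: cnj_vec_def vec_eq_iff)
  then show "(conjugation f, conjugation f') \<in> minimal_schroedinger X"
    unfolding minimal_schroedinger_eq g(1,2) conjugation_diff conjugation_resolvent by blast
qed (rule cinner_conjugation conjugation_conjugation conjugation_scaleC)+

theorem proposition4p1:
  fixes X :: "'m::finite \<Rightarrow> real^3"
  assumes "inj X"
  shows
    "Domain (adjoint_operator (minimal_schroedinger X :: 'n::finite L2 operator)) =
       {f. \<exists>\<xi>\<^sub>0 \<xi>\<^sub>1 f\<^sub>H. singular_decomposition X f \<xi>\<^sub>0 \<xi>\<^sub>1 f\<^sub>H} \<and>

     boundary_triplet (minimal_schroedinger X :: 'n L2 operator) (Gamma_0 X) (Gamma_1 X) \<and>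
     (\<forall>(f :: 'n L2) \<xi>\<^sub>0 \<xi>\<^sub>1 f\<^sub>H. singular_decomposition X f \<xi>\<^sub>0 \<xi>\<^sub>1 f\<^sub>H \<longrightarrow>
       (\<forall>x. x \<notin> range X \<longrightarrow> has_point_value f x (point_value f x)) \<and>
       Gamma_0 X f = (4 * pi) *\<^sub>R \<xi>\<^sub>0 \<and>
       (\<forall>j. ((\<lambda>x. norm (x - X j) *\<^sub>R point_value f x) \<longlongrightarrow> \<xi>\<^sub>0 $ j) (at (X j)) \<and>
            ((\<lambda>x. point_value f x - (1 / norm (x - X j)) *\<^sub>R (\<xi>\<^sub>0 $ j))
               \<longlongrightarrow> Gamma_1 X f $ j) (at (X j)))) \<and>

     self_adjoint (H_0 X :: 'n L2 operator) \<and>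
     Domain (H_0 X :: 'n L2 operator) = sobolev 2"
proof -
  interpret singular_perturbation "resolvent :: 'n L2 \<Rightarrow> 'n L2" "deficiency X" "evaluation X"
  proof
    show "\<exists>K. \<forall>f :: 'n L2. norm (resolvent f) \<le> norm f * K"
      using norm_resolvent_le by (intro exI[of _ 1]) auto
    show "cinner (resolvent f) g = cinner f (resolvent g)" for f g :: "'n L2"
      unfolding cinner_eq_inner resolvent_scaleC[symmetric] by (simp only: inner_resolvent_symmetric)
    show "c = 0" if "resolvent g = deficiency X c" for g :: "'n L2" and c
      using deficiency_inter_range_resolvent[OF assms that] .
  qed (rule resolvent_add resolvent_scaleC resolvent_injective deficiency_add deficiency_scaleC cinner_evaluation; assumption?)+
  have H: "minimal_schroedinger X = S"
    by (simp add: S_def minimal_schroedinger_eq)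
  have dom: "Domain S = {resolvent g | g. evaluation X g = 0}"
    unfolding S_def by auto
  have i: "Domain (adjoint_operator S) = {f. \<exists>\<xi>\<^sub>0 \<xi>\<^sub>1 f\<^sub>H. singular_decomposition X f \<xi>\<^sub>0 \<xi>\<^sub>1 f\<^sub>H}"
  proof (intro equalityI subsetI)
    fix f :: "'n L2" assume "f \<in> Domain (adjoint_operator S)"
    then obtain g c where f: "f = resolvent g + deficiency X c" by (auto simp: Domain_adjoint_S)
    \<comment> \<open>Subtracting the exponentials with these coefficients makes the regular part vanish at the points.\<close>
    obtain d where d: "evaluation X (g - deficiency X d) = 0" by (rule V_decompose)
    have "f = resolvent ((8 * pi) *\<^sub>R deficiency X ((1 / (8 * pi)) *\<^sub>R d))
        + deficiency X ((4 * pi) *\<^sub>R (1 / (4 * pi)) *\<^sub>R c) + resolvent (g - deficiency X d)"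
      by (simp add: f deficiency_scaleR resolvent_diff)
    then have "singular_decomposition X f ((1 / (4 * pi)) *\<^sub>R c) ((1 / (8 * pi)) *\<^sub>R d) (resolvent (g - deficiency X d))"
      unfolding singular_decomposition_iff H dom using d by blast
    then show "f \<in> {f. \<exists>\<xi>\<^sub>0 \<xi>\<^sub>1 f\<^sub>H. singular_decomposition X f \<xi>\<^sub>0 \<xi>\<^sub>1 f\<^sub>H}" by blast
  next
    fix f :: "'n L2" assume "f \<in> {f. \<exists>\<xi>\<^sub>0 \<xi>\<^sub>1 f\<^sub>H. singular_decomposition X f \<xi>\<^sub>0 \<xi>\<^sub>1 f\<^sub>H}"
    then obtain \<xi>\<^sub>0 \<xi>\<^sub>1 g where "f = resolvent ((8 * pi) *\<^sub>R deficiency X \<xi>\<^sub>1) + deficiency X ((4 * pi) *\<^sub>R \<xi>\<^sub>0) + resolvent g"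
      unfolding singular_decomposition_iff H dom by blast
    then have "f = resolvent ((8 * pi) *\<^sub>R deficiency X \<xi>\<^sub>1 + g) + deficiency X ((4 * pi) *\<^sub>R \<xi>\<^sub>0)"
      by (simp add: resolvent_add)
    then show "f \<in> Domain (adjoint_operator S)" unfolding Domain_adjoint_S by blast
  qed
  have ii: "boundary_triplet S (Gamma_0 X) (Gamma_1 X)"
    by (intro boundary_triplet_S[where A="interaction X"] interaction_add interaction_scaleC interaction_symmetric
        Gamma_0_element Gamma_1_element assms)
      (simp only: H[symmetric] equal_deficiency_indices_minimal_schroedinger)
  have limits: "(\<forall>x. x \<notin> range X \<longrightarrow> has_point_value f x (point_value f x)) \<and>
       Gamma_0 X f = (4 * pi) *\<^sub>R \<xi>\<^sub>0 \<and>
       (\<forall>j. ((\<lambda>x. norm (x - X j) *\<^sub>R point_value f x) \<longlongrightarrow> \<xi>\<^sub>0 $ j) (at (X j)) \<and>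
            ((\<lambda>x. point_value f x - (1 / norm (x - X j)) *\<^sub>R (\<xi>\<^sub>0 $ j))
               \<longlongrightarrow> Gamma_1 X f $ j) (at (X j)))"
    if "singular_decomposition X f \<xi>\<^sub>0 \<xi>\<^sub>1 f\<^sub>H" for f :: "'n L2" and \<xi>\<^sub>0 \<xi>\<^sub>1 f\<^sub>H
  proof -
    from that obtain g0 where "f = resolvent ((8 * pi) *\<^sub>R deficiency X \<xi>\<^sub>1) + deficiency X ((4 * pi) *\<^sub>R \<xi>\<^sub>0) + resolvent g0"
      unfolding singular_decomposition_iff H dom by blast
    then obtain g where f: "f = resolvent g + deficiency X ((4 * pi) *\<^sub>R \<xi>\<^sub>0)"
      using resolvent_add[of "(8 * pi) *\<^sub>R deficiency X \<xi>\<^sub>1" g0] by (metis add.assoc add.commute)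
    have \<xi>: "(1 / (4 * pi)) *\<^sub>R ((4 * pi) *\<^sub>R \<xi>\<^sub>0) $ j = \<xi>\<^sub>0 $ j" for j
      by simp
    show ?thesis
      unfolding f Gamma_0_element[OF assms] Gamma_1_element[OF assms]
    proof (intro conjI allI impI)
      show "has_point_value (resolvent g + deficiency X ((4 * pi) *\<^sub>R \<xi>\<^sub>0)) x
          (point_value (resolvent g + deficiency X ((4 * pi) *\<^sub>R \<xi>\<^sub>0)) x)" if "x \<notin> range X" for x
        unfolding point_value_element[OF that] by (rule has_point_value_element[OF that])
    qed (use norm_point_value_tendsto[OF assms, where c="(4 * pi) *\<^sub>R \<xi>\<^sub>0", unfolded \<xi>]
        point_value_minus_singularity_tendsto[OF assms, where c="(4 * pi) *\<^sub>R \<xi>\<^sub>0", unfolded \<xi>]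
        in \<open>blast+\<close>)
  qed
  have iii: "H_0 X = T"
  proof (intro equalityI subrelI)
    fix f f' :: "'n L2" assume "(f, f') \<in> H_0 X"
    then obtain g c where "f = resolvent g + deficiency X c" "f' = g - (resolvent g + deficiency X c)" "Gamma_0 X f = 0"
      unfolding H_0_def H adjoint_S by auto
    then show "(f, f') \<in> T"
      using Gamma_0_element[OF assms, of g c] by (auto simp: T_def)
  next
    fix f f' :: "'n L2" assume "(f, f') \<in> T"
    then obtain g where "f = resolvent g + deficiency X 0" "f' = g - (resolvent g + deficiency X 0)"
      by (auto simp: T_def deficiency_zero)
    then show "(f, f') \<in> H_0 X"
      unfolding H_0_def H adjoint_S using Gamma_0_element[OF assms, of g 0] by blast
  qed
  have "Domain T = sobolev 2" by (auto simp: T_def sobolev_eq_range)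
  with i ii limits iii self_adjoint_T show ?thesis
    unfolding H by auto
qed

end
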